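(* Let $m\in\mathbb{N}$ be odd, let $\Omega_2\subset\mathbb{C}$ be an intrinsic complex domain, and let $f(u+iv)=\alpha(u,v)+i\beta(u,v)$ be an intrinsic holomorphic function on $\Omega_2$. Write $r=|\underline{x}|$ and $f(x_0+\underline{x})=\alpha(x_0,r)+\frac{\underline{x}}{r}\,\beta(x_0,r)$ for its slice extension to $\mathbb{R}^{m+1}$. Then $$\Delta^{\frac{m-1}{2}}\left[f(x_0+\underline{x})\right]=(m-1)!!\;\mathrm{GCK}\left[\left(\tfrac1r\partial_r\right)^{\frac{m-1}{2}}[\alpha](x_0,0)\right]=(-1)^{\frac{m-1}{2}}\frac{(m-1)!!}{(m-2)!!}\;\mathrm{GCK}\left[f^{(m-1)}(x_0)\right].$$ Consequently, setting $\gamma_m=(-1)^{\frac{m-1}{2}}\frac{(m-1)!!}{(m-2)!!}$, $\Omega_1=\Omega_2\cap\mathbb{R}$ and $\Omega=\Omega_2\times\mathbb{S}^{m-1}$, one has $$\Delta^{\frac{m-1}{2}}\circ S=\gamma_m\,\mathrm{GCK}\circ\partial_{x_0}^{m-1}$$ as maps from $\mathcal{A}(\Omega_1)\otimes\mathbb{R}_m$ to $\mathcal{AM}(\Omega)$.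
   Context: $\mathbb{R}_m$ is the real Clifford algebra with generators $e_1,\dots,e_m$, $e_je_\ell+e_\ell e_j=-2\delta_{j\ell}$. Points of $\mathbb{R}^{m+1}$ are identified with paravectors $x=x_0+\underline{x}$, $\underline{x}=\sum_{j=1}^m x_je_j$, so $\underline{x}^2=-|\underline{x}|^2$. $\Delta=\sum_{j=0}^m\partial_{x_j}^2$ is the Laplacian in $\mathbb{R}^{m+1}$, and $\Delta^{\frac{m-1}{2}}$ ($m$ odd) is the pointwise differential operator. $\mathbb{S}^{m-1}$ is the unit sphere of vectors $\underline{\omega}$ in $\mathbb{R}^m$. Double factorials: $0!!=(-1)!!=1$. An intrinsic complex domain $\Omega_2\subset\mathbb{C}$ is a (nonempty) connected open set symmetric with respect to the real axis. The corresponding axially symmetric slice domain is $\Omega=\Omega_2\times\mathbb{S}^{m-1}:=\{u+v\underline{\omega}:(u,v)\in\Omega_2,\ \underline{\omega}\in\mathbb{S}^{m-1}\}\subset\mathbb{R}^{m+1}$. A holomorphic function $f=\alpha+i\beta$ on $\Omega_2$ ($\alpha,\beta$ real-valued) is intrinsic if $\alpha(u,-v)=\alpha(u,v)$ and $\beta(u,-v)=-\beta(u,v)$, equivalently if $f|_{\Omega_2\cap\mathbb{R}}$ is real-valued. $f^{(m-1)}(x_0)$ denotes the $(m-1)$-th derivative of the restriction of $f$ to the real line. Values at $r=0$ are taken by continuity ($\alpha$ is even and analytic in $r$). $\mathcal{A}(\Omega_1)$ is the space of $\mathbb{R}$-valued real-analytic functions on $\Omega_1$ having a (unique) holomorphic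 extension to $\Omega_2$. The slice extension map is $S[f_0](x)=\sum_{j\ge0}\frac{\underline{x}^j}{j!}f_0^{(j)}(x_0)$ near $\Omega_1$; if $\alpha+i\beta$ is the ($\mathbb{R}_m$-linearly extended) holomorphic extension of $f_0$, then $S[f_0](x)=\alpha(x_0,|\underline{x}|)+\frac{\underline{x}}{|\underline{x}|}\beta(x_0,|\underline{x}|)$ on $\Omega$. $\mathcal{AM}(\Omega)$ is the right $\mathbb{R}_m$-module of axially monogenic functions: real-analytic $\mathbb{R}_m$-valued $F$ on $\Omega$ with $(\partial_{x_0}+\sum_{j=1}^m e_j\partial_{x_j})F=0$ and $F(x)=A(x_0,|\underline{x}|)+\frac{\underline{x}}{|\underline{x}|}B(x_0,|\underline{x}|)$, where $A,B$ are $\mathbb{R}_m$-valued real analytic on $\Omega_2$, $A$ even and $B$ odd in the second variable. The generalized CK-extension $\mathrm{GCK}[f_0]$ of an $\mathbb{R}_m$-valued real-analytic function $f_0$ is the unique axially monogenic function $\sum_{j\ge0}\underline{x}^jf_j(x_0)$ (with $f_j$ analytic, in an axially symmetric neighbourhood of $\Omega_1$, extended analytically where possible) whose restriction to the real line $\underline{x}=0$ is $f_0(x_0)$. *)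

theory Defs
  imports "HOL-Analysis.Analysis"
begin

section \<open>The real Clifford algebra\<close>

text \<open>
  The generators are indexed by a linearly ordered finite type \<open>'n\<close>, so that \<open>m = CARD('n)\<close>.
  An element is the family of its coefficients with respect to the basis
  \<open>e\<^sub>A = e\<^bsub>j1\<^esub> \<dots> e\<^bsub>jk\<^esub>\<close>, where \<open>A = {j1 < \<dots> < jk}\<close>.
\<close>

typedef (overloaded) ('n :: finite) clifford = "UNIV :: (real ^ 'n set) set"
  morphisms coeffs Abs_clifford by simp

setup_lifting type_definition_clifford

lemma clifford_eq_iff: "x = y \<longleftrightarrow> (\<forall>A. coeffs x $ A = coeffs y $ A)"
  by (simp add: coeffs_inject[symmetric] vec_eq_iff)

instantiation clifford :: (finite) real_vector
begin
lift_definition zero_clifford :: "'a clifford" is 0 .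
lift_definition plus_clifford :: "'a clifford \<Rightarrow> 'a clifford \<Rightarrow> 'a clifford" is "(+)" .
lift_definition minus_clifford :: "'a clifford \<Rightarrow> 'a clifford \<Rightarrow> 'a clifford" is "(-)" .
lift_definition uminus_clifford :: "'a clifford \<Rightarrow> 'a clifford" is "uminus" .
lift_definition scaleR_clifford :: "real \<Rightarrow> 'a clifford \<Rightarrow> 'a clifford" is "(*\<^sub>R)" .
instance
  by standard (transfer, simp add: algebra_simps)+
end

instantiation clifford :: (finite) real_inner
begin
lift_definition inner_clifford :: "'a clifford \<Rightarrow> 'a clifford \<Rightarrow> real" is "inner" .
lift_definition norm_clifford :: "'a clifford \<Rightarrow> real" is "norm" .
definition sgn_clifford :: "'a clifford \<Rightarrow> 'a clifford"
  where "sgn_clifford x = x /\<^sub>R norm x"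
definition dist_clifford :: "'a clifford \<Rightarrow> 'a clifford \<Rightarrow> real"
  where "dist_clifford x y = norm (x - y)"
definition uniformity_clifford :: "('a clifford \<times> 'a clifford) filter"
  where "uniformity_clifford = (INF e\<in>{0<..}. principal {(x, y). dist x y < e})"
definition open_clifford :: "'a clifford set \<Rightarrow> bool"
  where "open_clifford U \<longleftrightarrow>
    (\<forall>x\<in>U. eventually (\<lambda>(x', y). x' = x \<longrightarrow> y \<in> U) uniformity)"
instance
proof
  fix x y z :: "'a clifford" and r :: real
  show "inner x y = inner y x" by transfer (rule inner_commute)
  show "inner (x + y) z = inner x z + inner y z" by transfer (rule inner_add_left)
  show "inner (r *\<^sub>R x) y = r * inner x y" by transfer simp
  show "0 \<le> inner x x" by transfer simp
  show "inner x x = 0 \<longleftrightarrow> x = 0" by transfer simp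
  show "norm x = sqrt (inner x x)" by transfer (rule norm_eq_sqrt_inner)
qed (simp_all add: sgn_clifford_def dist_clifford_def uniformity_clifford_def open_clifford_def)
end

lift_definition blade :: "'n::finite set \<Rightarrow> 'n clifford" is "\<lambda>A. axis A 1" .

instantiation clifford :: (finite) euclidean_space
begin
definition Basis_clifford :: "'a clifford set" where "Basis_clifford = range blade"
instance
proof
  show "(Basis :: 'a clifford set) \<noteq> {}" "finite (Basis :: 'a clifford set)"
    by (auto simp: Basis_clifford_def)
  fix u v :: "'a clifford"
  assume "u \<in> Basis" "v \<in> Basis"
  then show "inner u v = (if u = v then 1 else 0)"
    unfolding Basis_clifford_def by (transfer, auto simp: inner_axis_axis axis_eq_axis)
next
  fix x :: "'a clifford"
  show "(\<forall>u\<in>Basis. inner x u = 0) \<longleftrightarrow> (x = 0)"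
    unfolding Basis_clifford_def by (simp, transfer, auto simp: inner_axis vec_eq_iff)
qed
end

text \<open>
  \<open>e\<^sub>A e\<^sub>B = \<plusminus>e\<^sub>C\<close> with \<open>C\<close> the symmetric difference of \<open>A\<close> and \<open>B\<close>. The sign is \<open>-1\<close> to the number of
  pairs \<open>(a, b)\<close> with \<open>b \<le> a\<close>: the pairs with \<open>b < a\<close> are the transpositions needed for sorting,
  and those with \<open>b = a\<close> come from \<open>e\<^sub>a\<^sup>2 = -1\<close>.
\<close>

definition blade_sign :: "'n::{finite,linorder} set \<Rightarrow> 'n set \<Rightarrow> real" where
  "blade_sign A B = (\<Prod>a\<in>A. \<Prod>b\<in>B. if b \<le> a then - 1 else 1)"

lemma sym_diff_cancel: "sym_diff A (sym_diff A B) = B"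
  by auto

lemma prod_sym_diff:
  fixes f :: "'b \<Rightarrow> real"
  assumes "finite A" "finite B" and f: "\<And>x. f x * f x = 1"
  shows "prod f (sym_diff A B) = prod f A * prod f B"
proof -
  have [simp]: "prod f (A \<inter> B) * prod f (A \<inter> B) = 1"
    by (simp add: f flip: prod.distrib)
  have "prod f A = prod f (A - B) * prod f (A \<inter> B)"
    using assms(1) by (subst prod.union_disjoint[symmetric]) (auto intro!: prod.cong)
  moreover have "prod f B = prod f (B - A) * prod f (A \<inter> B)"
    using assms(2) by (subst prod.union_disjoint[symmetric]) (auto intro!: prod.cong)
  moreover have "prod f (sym_diff A B) = prod f (A - B) * prod f (B - A)"
    using assms by (intro prod.union_disjoint) auto
  ultimately show ?thesis
    by (simp add: mult_ac)
qed

lemma blade_sign_sym_diff_right: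
  "blade_sign A (sym_diff B C) = blade_sign A B * blade_sign A C"
proof -
  have "(\<Prod>b\<in>sym_diff B C. if b \<le> a then - 1 else 1 :: real)
      = (\<Prod>b\<in>B. if b \<le> a then - 1 else 1) * (\<Prod>b\<in>C. if b \<le> a then - 1 else 1)" for a
    by (rule prod_sym_diff) auto
  then show ?thesis
    unfolding blade_sign_def by (simp only: prod.distrib)
qed

lemma blade_sign_sym_diff_left:
  "blade_sign (sym_diff A B) C = blade_sign A C * blade_sign B C"
  unfolding blade_sign_def
proof (rule prod_sym_diff)
  fix a
  show "(\<Prod>b\<in>C. if b \<le> a then - 1 else 1) * (\<Prod>b\<in>C. if b \<le> a then - 1 else 1) = (1 :: real)"
    unfolding prod.distrib[symmetric] by (rule prod.neutral) auto
qed auto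

instantiation clifford :: ("{finite,linorder}") real_algebra_1
begin
lift_definition one_clifford :: "'a clifford" is "axis {} 1" .
lift_definition times_clifford :: "'a clifford \<Rightarrow> 'a clifford \<Rightarrow> 'a clifford"
  is "\<lambda>x y. \<chi> C. \<Sum>A\<in>UNIV. blade_sign A (sym_diff A C) * x $ A * y $ sym_diff A C" .
instance
proof
  fix a b c :: "'a clifford" and r :: real
  show "(a + b) * c = a * c + b * c"
    by transfer (simp add: vec_eq_iff algebra_simps sum.distrib)
  show "a * (b + c) = a * b + a * c"
    by transfer (simp add: vec_eq_iff algebra_simps sum.distrib)
  show "(r *\<^sub>R a) * b = r *\<^sub>R (a * b)"
    by transfer (simp add: vec_eq_iff sum_distrib_left mult_ac)
  show "a * (r *\<^sub>R b) = r *\<^sub>R (a * b)"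
    by transfer (simp add: vec_eq_iff sum_distrib_left mult_ac)
  show "(0 :: 'a clifford) \<noteq> 1"
    by transfer (simp add: vec_eq_iff axis_def)
  show "1 * a = a"
  proof (transfer, unfold vec_eq_iff, intro allI, simp)
    fix a :: "real ^ 'a set" and C
    have "(\<Sum>A\<in>UNIV. blade_sign A (sym_diff A C) * axis {} 1 $ A * a $ sym_diff A C)
        = (\<Sum>A\<in>(UNIV :: 'a set set). if A = {} then a $ C else 0)"
      by (rule sum.cong[OF refl]) (auto simp: axis_def blade_sign_def)
    then show "(\<Sum>A\<in>UNIV. blade_sign A (sym_diff A C) * axis {} 1 $ A * a $ sym_diff A C) = a $ C"
      by simp
  qed
  show "a * 1 = a"
  proof (transfer, unfold vec_eq_iff, intro allI, simp)
    fix a :: "real ^ 'a set" and C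
    have "(\<Sum>A\<in>UNIV. blade_sign A (sym_diff A C) * a $ A * axis {} 1 $ sym_diff A C)
        = (\<Sum>A\<in>UNIV. if A = C then a $ C else 0)"
      by (rule sum.cong[OF refl]) (auto simp: axis_def blade_sign_def)
    then show "(\<Sum>A\<in>UNIV. blade_sign A (sym_diff A C) * a $ A * axis {} 1 $ sym_diff A C) = a $ C"
      by simp
  qed
  show "a * b * c = a * (b * c)"
  proof (transfer, unfold vec_eq_iff, intro allI, simp only: vec_lambda_beta)
    fix a b c :: "real ^ 'a set" and D
    let ?d = "sym_diff :: 'a set \<Rightarrow> 'a set \<Rightarrow> 'a set"
    let ?s = "blade_sign :: 'a set \<Rightarrow> 'a set \<Rightarrow> real"
    have "(\<Sum>C\<in>UNIV. ?s C (?d C D) * (\<Sum>A\<in>UNIV. ?s A (?d A C) * a $ A * b $ ?d A C) * c $ ?d C D)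
        = (\<Sum>A\<in>UNIV. \<Sum>C\<in>UNIV. ?s C (?d C D) * (?s A (?d A C) * a $ A * b $ ?d A C) * c $ ?d C D)"
      by (simp add: sum_distrib_left sum_distrib_right) (rule sum.swap)
    also have "\<dots> = (\<Sum>A\<in>UNIV. ?s A (?d A D) * a $ A *
        (\<Sum>B\<in>UNIV. ?s B (?d B (?d A D)) * b $ B * c $ ?d B (?d A D)))"
    proof (rule sum.cong[OF refl])
      fix A :: "'a set"
      have "(\<Sum>C\<in>UNIV. ?s C (?d C D) * (?s A (?d A C) * a $ A * b $ ?d A C) * c $ ?d C D)
          = (\<Sum>B\<in>UNIV. ?s A (?d A D) * a $ A * (?s B (?d B (?d A D)) * b $ B * c $ ?d B (?d A D)))"
      proof (rule sum.reindex_bij_witness[where i = "?d A" and j = "?d A"], goal_cases)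
        case (5 C)
        have 1: "?d (?d A C) (?d A D) = ?d C D" by auto
        have 2: "?d A D = ?d (?d A C) (?d C D)" by auto
        have 3: "?s C (?d C D) = ?s A (?d C D) * ?s (?d A C) (?d C D)"
          by (subst blade_sign_sym_diff_left[symmetric]) (simp only: sym_diff_cancel)
        have 4: "?s A (?d A D) = ?s A (?d A C) * ?s A (?d C D)"
          by (subst 2) (rule blade_sign_sym_diff_right)
        show ?case unfolding 1 unfolding 3 4 by (simp only: mult_ac)
      qed (simp_all only: sym_diff_cancel UNIV_I)
      then show "(\<Sum>C\<in>UNIV. ?s C (?d C D) * (?s A (?d A C) * a $ A * b $ ?d A C) * c $ ?d C D)
          = ?s A (?d A D) * a $ A * (\<Sum>B\<in>UNIV. ?s B (?d B (?d A D)) * b $ B * c $ ?d B (?d A D))"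
        by (simp only: sum_distrib_left)
    qed
    finally show "(\<Sum>C\<in>UNIV. ?s C (?d C D) * (\<Sum>A\<in>UNIV. ?s A (?d A C) * a $ A * b $ ?d A C) * c $ ?d C D)
        = (\<Sum>A\<in>UNIV. ?s A (?d A D) * a $ A *
            (\<Sum>B\<in>UNIV. ?s B (?d B (?d A D)) * b $ B * c $ ?d B (?d A D)))" .
  qed
qed
end

lemma blade_mult: "blade A * blade B = blade_sign A B *\<^sub>R blade (sym_diff A B)"
proof (transfer, unfold vec_eq_iff, intro allI)
  fix A B C :: "'a set"
  have *: "sym_diff A C = B \<longleftrightarrow> C = sym_diff A B"
    using sym_diff_cancel by metis
  have "(\<Sum>D\<in>UNIV. blade_sign D (sym_diff D C) * axis A 1 $ D * axis B 1 $ sym_diff D C)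
      = (\<Sum>D\<in>UNIV. if D = A then blade_sign A (sym_diff A C) * axis B 1 $ sym_diff A C else 0)"
    by (rule sum.cong[OF refl]) (simp add: axis_def)
  also have "\<dots> = blade_sign A (sym_diff A C) * axis B 1 $ sym_diff A C"
    by simp
  also have "\<dots> = (blade_sign A B *\<^sub>R axis (sym_diff A B) 1) $ C"
  proof (cases "sym_diff A C = B")
    case True
    have "axis B 1 $ B = (1 :: real)" "axis (sym_diff A B) 1 $ C = (1 :: real)"
      using True * by (simp_all only: axis_def vec_lambda_beta refl if_True)
    then show ?thesis
      unfolding True by simp
  next
    case False
    have "axis B 1 $ sym_diff A C = (0 :: real)" "axis (sym_diff A B) 1 $ C = (0 :: real)"
      using False * by (simp_all only: axis_def vec_lambda_beta if_False)
    then show ?thesis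
      by simp
  qed
  finally show "(\<chi> C. \<Sum>D\<in>UNIV. blade_sign D (sym_diff D C) * axis A 1 $ D * axis B 1 $ sym_diff D C) $ C
      = (blade_sign A B *\<^sub>R axis (sym_diff A B) 1) $ C"
    by (simp only: vec_lambda_beta)
qed

definition gen :: "'n::finite \<Rightarrow> 'n clifford" where
  "gen j = blade {j}"

lemma blade_empty: "blade {} = 1"
  by transfer simp

lemma gen_anticommute:
  "gen j * gen l + gen l * gen j = (if j = l then - 2 else 0)"
proof (cases "j = l")
  case True
  then have "gen j * gen l = - 1"
    by (simp add: gen_def blade_mult blade_sign_def blade_empty)
  with True show ?thesis by simp
next
  case False
  then have "sym_diff {j} {l} = sym_diff {l} {j}" by auto
  with False show ?thesis
    by (cases j l rule: linorder_cases) (auto simp: gen_def blade_mult blade_sign_def)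
qed

lemma blade_eq_prod_list_gen: "blade A = prod_list (map gen (sorted_list_of_set A))"
proof -
  have "finite A" by simp
  then show ?thesis
  proof (induction A rule: finite_linorder_max_induct)
    case (insert b A)
    have "b \<notin> A" using insert by auto
    have "sorted_list_of_set (insert b A) = sorted_list_of_set A @ [b]"
      using insert \<open>b \<notin> A\<close>
      by (subst sorted_list_of_set_unique[symmetric]) (simp_all add: sorted_wrt_append)
    moreover have "blade_sign A {b} = 1"
      using insert unfolding blade_sign_def by (intro prod.neutral) auto
    moreover have "sym_diff A {b} = insert b A" using \<open>b \<notin> A\<close> by auto
    ultimately show ?case
      using insert blade_mult[of A "{b}"] by (simp add: gen_def)
  qed (simp_all add: blade_empty)
qed

text \<open>
  A point of \<open>\<real>\<^bsup>m+1\<^esup>\<close> is a pair \<open>(x\<^sub>0, v)\<close>, to be read as the paravector \<open>x\<^sub>0 + vect v\<close>.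
\<close>

type_synonym 'n paravector = "real \<times> (real, 'n) vec"

definition vect :: "real ^ 'n \<Rightarrow> ('n::finite) clifford" where
  "vect v = (\<Sum>j\<in>UNIV. (v $ j) *\<^sub>R gen j)"


section \<open>Differential operators\<close>

definition dir_deriv ::
    "'a::real_normed_vector \<Rightarrow> ('a \<Rightarrow> 'b::real_normed_vector) \<Rightarrow> 'a \<Rightarrow> 'b" where
  "dir_deriv b F x = vector_derivative (\<lambda>t. F (x + t *\<^sub>R b)) (at 0)"

definition laplacian :: "('a::euclidean_space \<Rightarrow> 'b::real_normed_vector) \<Rightarrow> 'a \<Rightarrow> 'b" where
  "laplacian F x = (\<Sum>b\<in>Basis. dir_deriv b (dir_deriv b F) x)"

definition dirac_op ::
    "('n paravector \<Rightarrow> ('n::{finite,linorder}) clifford) \<Rightarrow> 'n paravector \<Rightarrow> 'n clifford" where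
  "dirac_op F x = dir_deriv (1, 0) F x + (\<Sum>j\<in>UNIV. gen j * dir_deriv (0, axis j 1) F x)"

definition line_deriv :: "(real \<Rightarrow> 'b::real_normed_vector) \<Rightarrow> real \<Rightarrow> 'b" where
  "line_deriv g t = vector_derivative g (at t)"

text \<open>The operator \<open>(1/r) \<partial>\<^sub>r\<close>, with its value at \<open>r = 0\<close> taken by continuity.\<close>

definition radial_deriv :: "(real \<Rightarrow> real) \<Rightarrow> real \<Rightarrow> real" where
  "radial_deriv h r = (if r = 0 then Lim (at 0) (\<lambda>s. deriv h s / s) else deriv h r / r)"

text \<open>
  Multivariate real-analyticity. The multi-indices are the functions from the standard basis
  to the natural numbers (extended by 0); the sum is unordered.
\<close>

definition real_analytic_on ::
    "('a::euclidean_space \<Rightarrow> 'b::real_normed_vector) \<Rightarrow> 'a set \<Rightarrow> bool" where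
  "real_analytic_on F U \<longleftrightarrow>
     (\<forall>a\<in>U. \<exists>\<epsilon>>0. \<exists>c :: ('a \<Rightarrow> nat) \<Rightarrow> 'b. ball a \<epsilon> \<subseteq> U \<and>
        (\<forall>x\<in>ball a \<epsilon>.
           ((\<lambda>k. (\<Prod>b\<in>Basis. ((x - a) \<bullet> b) ^ k b) *\<^sub>R c k) has_sum F x)
             {k. \<forall>b. b \<notin> Basis \<longrightarrow> k b = 0}))"


section \<open>Slice functions and axially monogenic functions\<close>

definition cnj_closed :: "complex set \<Rightarrow> bool" where
  "cnj_closed W \<longleftrightarrow> (\<forall>z\<in>W. cnj z \<in> W)"

definition intrinsic_domain :: "complex set \<Rightarrow> bool" where
  "intrinsic_domain W \<longleftrightarrow> W \<noteq> {} \<and> open W \<and> connected W \<and> cnj_closed W"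

definition real_part :: "complex set \<Rightarrow> real set" where
  "real_part W = {t. complex_of_real t \<in> W}"

definition axial_set :: "complex set \<Rightarrow> ('n::finite paravector) set" where
  "axial_set W = {(u, v *\<^sub>R \<omega>) | u v \<omega>. Complex u v \<in> W \<and> norm \<omega> = 1}"

definition intrinsic_holomorphic :: "complex set \<Rightarrow> (complex \<Rightarrow> complex) \<Rightarrow> bool" where
  "intrinsic_holomorphic W f \<longleftrightarrow> f holomorphic_on W \<and>
     (\<forall>z\<in>W. Re (f (cnj z)) = Re (f z) \<and> Im (f (cnj z)) = - Im (f z))"

text \<open>
  \<open>A(x\<^sub>0, r) + (v / r) B(x\<^sub>0, r)\<close> with \<open>r = \<bar>v\<bar>\<close>. At \<open>v = 0\<close> the second summand vanishes, which is the
  value by continuity for every \<open>B\<close> that is odd in \<open>r\<close>.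
\<close>

definition axial_fun ::
    "(complex \<Rightarrow> ('n::{finite,linorder}) clifford) \<Rightarrow> (complex \<Rightarrow> 'n clifford)
      \<Rightarrow> 'n paravector \<Rightarrow> 'n clifford" where
  "axial_fun A B = (\<lambda>(x0, v).
     A (Complex x0 (norm v)) + (vect v /\<^sub>R norm v) * B (Complex x0 (norm v)))"

definition slice_fun ::
    "(complex \<Rightarrow> complex) \<Rightarrow> 'n paravector \<Rightarrow> ('n::{finite,linorder}) clifford" where
  "slice_fun f = axial_fun (\<lambda>z. of_real (Re (f z))) (\<lambda>z. of_real (Im (f z)))"

definition \<A> :: "complex set \<Rightarrow> (real \<Rightarrow> real) set" where
  "\<A> W = {\<phi>. real_analytic_on \<phi> (real_part W) \<and>
      (\<exists>g. g holomorphic_on W \<and> (\<forall>t\<in>real_part W. g (of_real t) = of_real (\<phi> t)))}"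

text \<open>The tensor product of \<open>\<A> W\<close> with the Clifford algebra, as a space of Clifford-valued functions.\<close>

definition \<A>_clifford :: "complex set \<Rightarrow> (real \<Rightarrow> ('n::finite) clifford) set" where
  "\<A>_clifford W = {f0. \<forall>A. (\<lambda>t. coeffs (f0 t) $ A) \<in> \<A> W}"

text \<open>The condition off \<open>W\<close> only makes the total function \<open>g\<close> unique.\<close>

definition hol_ext :: "complex set \<Rightarrow> (real \<Rightarrow> real) \<Rightarrow> complex \<Rightarrow> complex" where
  "hol_ext W \<phi> = (THE g. g holomorphic_on W \<and>
     (\<forall>t\<in>real_part W. g (of_real t) = of_real (\<phi> t)) \<and> (\<forall>z. z \<notin> W \<longrightarrow> g z = 0))"

definition slice_ext ::
    "complex set \<Rightarrow> (real \<Rightarrow> ('n::{finite,linorder}) clifford) \<Rightarrow> 'n paravector \<Rightarrow> 'n clifford"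
where
  "slice_ext W f0 = axial_fun
     (\<lambda>z. \<Sum>A\<in>UNIV. Re (hol_ext W (\<lambda>t. coeffs (f0 t) $ A) z) *\<^sub>R blade A)
     (\<lambda>z. \<Sum>A\<in>UNIV. Im (hol_ext W (\<lambda>t. coeffs (f0 t) $ A) z) *\<^sub>R blade A)"

definition axially_monogenic ::
    "complex set \<Rightarrow> ('n paravector \<Rightarrow> ('n::{finite,linorder}) clifford) set" where
  "axially_monogenic W = {F. real_analytic_on F (axial_set W) \<and>
      (\<forall>x\<in>axial_set W. dirac_op F x = 0) \<and>
      (\<exists>A B. real_analytic_on A W \<and> real_analytic_on B W \<and>
         (\<forall>z\<in>W. A (cnj z) = A z \<and> B (cnj z) = - B z) \<and>
         (\<forall>x\<in>axial_set W. F x = axial_fun A B x))}"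

text \<open>
  \<open>F\<close> is a generalized CK-extension of \<open>f0\<close> to the axially symmetric set over \<open>W\<close>: it is given by the
  power series in the vector variable near the real line and is continued analytically,
  as an axially monogenic function, to the rest.
\<close>

definition is_GCK ::
    "complex set \<Rightarrow> (real \<Rightarrow> ('n::{finite,linorder}) clifford)
      \<Rightarrow> ('n paravector \<Rightarrow> 'n clifford) \<Rightarrow> bool" where
  "is_GCK W f0 F \<longleftrightarrow> F \<in> axially_monogenic W \<and>
     (\<exists>V f. open V \<and> cnj_closed V \<and> V \<subseteq> W \<and>
        (\<forall>t\<in>real_part W. of_real t \<in> V) \<and> (\<forall>z\<in>V. Re z \<in> real_part W) \<and>
        (\<forall>j. real_analytic_on (f j) (real_part W)) \<and>
        (\<forall>(x0, v)\<in>axial_set V. (\<lambda>j. vect v ^ j * f j x0) sums F (x0, v))) \<and>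
     (\<forall>t\<in>real_part W. F (t, 0) = f0 t)"

text \<open>Again the condition off the domain only makes the total function unique.\<close>

definition GCK ::
    "complex set \<Rightarrow> (real \<Rightarrow> ('n::{finite,linorder}) clifford) \<Rightarrow> 'n paravector \<Rightarrow> 'n clifford"
where
  "GCK W f0 = (THE F. is_GCK W f0 F \<and> (\<forall>x. x \<notin> axial_set W \<longrightarrow> F x = 0))"

function dfact :: "int \<Rightarrow> nat" where
  "dfact n = (if n \<le> 0 then 1 else nat n * dfact (n - 2))"
  by auto
termination by (relation "Wellfounded.measure nat") auto
declare dfact.simps [simp del]

end

theory Submission
  imports Defs "HOL-Complex_Analysis.Complex_Analysis"
begin

text \<open>
  Write a point as \<open>x\<^sub>0 + v\<close> and put \<open>n = (m - 1) / 2\<close>. Near the real axis the slice extension of \<open>f\<close> is the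
  series \<open>\<Sum> v\<^sup>j f\<^bsup>(j)\<^esup>(x\<^sub>0) / j!\<close> (lemma \<open>slice_sums\<close>). Since \<open>\<Delta> v\<^sup>j\<close> is a multiple \<open>-\<mu>\<^sub>j v\<^bsup>j-2\<^esup>\<close> of a lower power, the
  Laplacian maps a series \<open>\<Sum> v\<^sup>j f\<^sub>j(x\<^sub>0)\<close> to the series with the coefficients \<open>f\<^sub>j'' - \<mu>\<^bsub>j+2\<^esub> f\<^bsub>j+2\<^esub>\<close>
  (\<open>vect_series_laplacian\<close>). On the slice extension this is a recursion for numbers only: after \<open>k\<close> steps the
  \<open>j\<close>-th coefficient is \<open>f\<^bsup>(j+2k)\<^esup>/j!\<close> times the explicit product \<open>lap_coeff\<close>. For \<open>k = n\<close> these numbers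
  satisfy the recursion that expresses the vanishing of the Dirac operator (\<open>lap_coeff_dirac_step\<close>), so
  \<open>\<Delta>\<^sup>n\<close> of the slice extension is monogenic near the axis, and its restriction to the axis is
  \<open>\<gamma>\<^sub>m f\<^bsup>(m-1)\<^esup>\<close>.

  The rest is propagation and uniqueness. Slice extensions are real analytic, also on the axis, and every
  slice of the domain is a copy of the connected set \<open>\<Omega>\<^sub>2\<close> that contains the real points. The identity
  theorem on slices (\<open>axial_identity\<close>) therefore carries the Dirac equation and the axial form from
  the axis to the whole domain (\<open>laplacian_slice_is_GCK\<close>). Conversely, the Dirac equation determines the
  coefficients of \<open>\<Sum> v\<^sup>j f\<^sub>j\<close> from \<open>f\<^sub>0\<close>, so generalized CK-extensions are unique (\<open>GCK_unique\<close>) and both sides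
  of the theorem coincide. The expression with the radial operator is the same initial function: \<open>\<alpha>(x\<^sub>0, r)\<close> is
  an even power series in \<open>r\<close> whose coefficients are derivatives of \<open>f\<close>, and \<open>(1/r) \<partial>\<^sub>r\<close> acts on it by lowering
  the powers by two (\<open>radial_deriv_iterate_zero\<close>).

  The analytic tool throughout is a power series calculus with majorants (\<open>maj\<close>): it gives the closure
  properties of real analytic functions, the identity theorem, and termwise differentiation of series of
  functions.
\<close>

section \<open>Normally convergent power series in several variables\<close>

definition multi_index :: "('a::euclidean_space \<Rightarrow> nat) set" where
  "multi_index = {k. \<forall>b. b \<notin> Basis \<longrightarrow> k b = 0}"

definition mdeg :: "('a::euclidean_space \<Rightarrow> nat) \<Rightarrow> nat" where
  "mdeg k = (\<Sum>b\<in>Basis. k b)"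

definition mpow :: "'a::euclidean_space \<Rightarrow> ('a \<Rightarrow> nat) \<Rightarrow> real" where
  "mpow h k = (\<Prod>b\<in>Basis. (h \<bullet> b) ^ k b)"

text \<open>
  Power series in several variables are studied on cubes, because on a cube of half-width \<open>\<rho>\<close> a
  monomial of degree \<open>d\<close> is bounded by exactly \<open>\<rho> ^ d\<close>, a bound attained at the corner
  \<open>(\<rho>, \<dots>, \<rho>)\<close>.
\<close>

definition cube :: "real \<Rightarrow> 'a::euclidean_space set" where
  "cube \<rho> = {h. \<forall>b\<in>Basis. \<bar>h \<bullet> b\<bar> \<le> \<rho>}"

definition has_expansion ::
    "real \<Rightarrow> ('a::euclidean_space \<Rightarrow> 'b::banach) \<Rightarrow> (('a \<Rightarrow> nat) \<Rightarrow> 'b) \<Rightarrow> bool" where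
  "has_expansion \<rho> F c \<longleftrightarrow>
     (\<lambda>k. \<rho> ^ mdeg k * norm (c k)) summable_on multi_index \<and>
     (\<forall>h\<in>cube \<rho>. ((\<lambda>k. mpow h k *\<^sub>R c k) has_sum F h) multi_index)"

text \<open>
  The least such \<open>M\<close> is the weighted \<open>l\<^sup>1\<close> norm of the coefficients. Keeping track of it, rather than
  of bare convergence, is what makes infinite sums, compositions and termwise differentiation
  routine estimates.
\<close>

definition maj :: "real \<Rightarrow> ('a::euclidean_space \<Rightarrow> 'b::banach) \<Rightarrow> real \<Rightarrow> bool" where
  "maj \<rho> F M \<longleftrightarrow> (\<exists>c. has_expansion \<rho> F c \<and>
     (\<Sum>\<^sub>\<infinity>k\<in>multi_index. \<rho> ^ mdeg k * norm (c k)) \<le> M)"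

lemma abs_mpow_le: "h \<in> cube \<rho> \<Longrightarrow> \<bar>mpow h k\<bar> \<le> \<rho> ^ mdeg k"
  unfolding mpow_def mdeg_def abs_prod power_sum
  by (intro prod_mono) (auto simp: cube_def power_abs intro!: power_mono)

lemma zero_in_cube: "0 \<le> \<rho> \<Longrightarrow> 0 \<in> cube \<rho>"
  by (simp add: cube_def)

lemma cube_mono: "\<rho> \<le> \<rho>' \<Longrightarrow> cube \<rho> \<subseteq> cube \<rho>'"
  by (auto simp: cube_def intro: order_trans)

lemma mdeg_add: "mdeg (\<lambda>b. k b + l b) = mdeg k + mdeg l"
  by (simp add: mdeg_def sum.distrib)

lemma mpow_add: "mpow h (\<lambda>b. k b + l b) = mpow h k * mpow h l"
  by (simp add: mpow_def power_add prod.distrib)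

lemma maj_mono: "maj \<rho> F M \<Longrightarrow> M \<le> N \<Longrightarrow> maj \<rho> F N"
  unfolding maj_def using order_trans by blast

lemma maj_cong: "maj \<rho> F M \<Longrightarrow> (\<And>h. h \<in> cube \<rho> \<Longrightarrow> G h = F h) \<Longrightarrow> maj \<rho> G M"
  unfolding maj_def has_expansion_def by auto

lemma maj_nonneg: "maj \<rho> F M \<Longrightarrow> 0 \<le> \<rho> \<Longrightarrow> 0 \<le> M"
  unfolding maj_def by (meson infsum_nonneg mult_nonneg_nonneg norm_ge_zero order_trans zero_le_power)

lemma maj_bound:
  assumes "maj \<rho> F M" and h: "h \<in> cube \<rho>"
  shows "norm (F h) \<le> M"
proof -
  obtain c where c: "has_expansion \<rho> F c"
    and M: "(\<Sum>\<^sub>\<infinity>k\<in>multi_index. \<rho> ^ mdeg k * norm (c k)) \<le> M"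
    using assms(1) unfolding maj_def by blast
  have "norm (F h) \<le> (\<Sum>\<^sub>\<infinity>k\<in>multi_index. \<rho> ^ mdeg k * norm (c k))"
  proof (rule norm_infsum_le)
    show "((\<lambda>k. \<rho> ^ mdeg k * norm (c k)) has_sum (\<Sum>\<^sub>\<infinity>k\<in>multi_index. \<rho> ^ mdeg k * norm (c k))) multi_index"
      using c by (simp add: has_expansion_def)
    show "((\<lambda>k. mpow h k *\<^sub>R c k) has_sum F h) multi_index"
      using c h by (simp add: has_expansion_def)
  qed (use abs_mpow_le[OF h] in \<open>auto intro: mult_right_mono\<close>)
  with M show ?thesis by simp
qed

text \<open>
  By absolute convergence the coefficients that belong to one monomial may be collected, so a series
  of monomials can be indexed by any set, with repetitions. Sums, products and substitutions then
  only require a suitable index set.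
\<close>

lemma maj_regroup:
  fixes e :: "'i \<Rightarrow> 'a::euclidean_space \<Rightarrow> nat" and d :: "'i \<Rightarrow> 'b::banach"
  assumes "\<rho> > 0" and e: "\<And>j. j \<in> J \<Longrightarrow> e j \<in> multi_index"
    and summ: "(\<lambda>j. \<rho> ^ mdeg (e j) * norm (d j)) summable_on J"
    and F: "\<And>h. h \<in> cube \<rho> \<Longrightarrow> ((\<lambda>j. mpow h (e j) *\<^sub>R d j) has_sum F h) J"
  shows "maj \<rho> F (\<Sum>\<^sub>\<infinity>j\<in>J. \<rho> ^ mdeg (e j) * norm (d j))"
proof -
  define fib where "fib = (\<lambda>k. {j\<in>J. e j = k})"
  define S where "S = Sigma multi_index fib"
  define c where "c = (\<lambda>k. infsum d (fib k))"
  have bij: "bij_betw snd S J"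
    by (rule bij_betwI[where g = "\<lambda>j. (e j, j)"]) (use e in \<open>auto simp: S_def fib_def\<close>)
  let ?w = "\<lambda>(k, j). \<rho> ^ mdeg k * norm (d j)"
  have weq: "?w p = \<rho> ^ mdeg (e (snd p)) * norm (d (snd p))" if "p \<in> S" for p
    using that by (auto simp: S_def fib_def)
  have W: "?w summable_on S"
    using summ summable_on_reindex_bij_betw[OF bij, of "\<lambda>j. \<rho> ^ mdeg (e j) * norm (d j)"]
    by (subst summable_on_cong[OF weq]) auto
  have Wsum: "infsum ?w S = (\<Sum>\<^sub>\<infinity>j\<in>J. \<rho> ^ mdeg (e j) * norm (d j))"
    using infsum_reindex_bij_betw[OF bij, of "\<lambda>j. \<rho> ^ mdeg (e j) * norm (d j)"]
    by (subst infsum_cong[OF weq]) auto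
  have inner: "(\<lambda>j. \<rho> ^ mdeg k * norm (d j)) summable_on fib k" if "k \<in> multi_index" for k
    using W that unfolding S_def by (rule summable_on_SigmaD1)
  have dabs: "(\<lambda>j. norm (d j)) summable_on fib k" if "k \<in> multi_index" for k
    using inner[OF that] \<open>\<rho> > 0\<close> by (subst (asm) summable_on_cmult_right') auto
  have dsum: "(d has_sum c k) (fib k)" if "k \<in> multi_index" for k
    unfolding c_def using abs_summable_summable[OF dabs[OF that]] by simp
  let ?v = "\<lambda>k. \<Sum>\<^sub>\<infinity>j\<in>fib k. \<rho> ^ mdeg k * norm (d j)"
  have v: "?v summable_on multi_index"
    using summable_on_Sigma_banach[of "\<lambda>k j. \<rho> ^ mdeg k * norm (d j)" multi_index fib] W
    unfolding S_def by simp
  have vsum: "infsum ?v multi_index = infsum ?w S"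
    using infsum_Sigma'_banach[of "\<lambda>k j. \<rho> ^ mdeg k * norm (d j)" multi_index fib] W
    unfolding S_def by simp
  have cv: "\<rho> ^ mdeg k * norm (c k) \<le> ?v k" if "k \<in> multi_index" for k
  proof -
    have "norm (c k) \<le> (\<Sum>\<^sub>\<infinity>j\<in>fib k. norm (d j))"
      unfolding c_def by (rule norm_infsum_bound[OF dabs[OF that]])
    then have "\<rho> ^ mdeg k * norm (c k) \<le> \<rho> ^ mdeg k * (\<Sum>\<^sub>\<infinity>j\<in>fib k. norm (d j))"
      using \<open>\<rho> > 0\<close> by (intro mult_left_mono) auto
    then show ?thesis by (simp add: infsum_cmult_right')
  qed
  have csumm: "(\<lambda>k. \<rho> ^ mdeg k * norm (c k)) summable_on multi_index"
    by (rule summable_on_comparison_test[OF v]) (use cv \<open>\<rho> > 0\<close> in auto)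
  have "has_expansion \<rho> F c"
    unfolding has_expansion_def
  proof (intro conjI ballI csumm)
    fix h :: 'a assume h: "h \<in> cube \<rho>"
    have eq: "(\<lambda>(k, j). mpow h k *\<^sub>R d j) p = mpow h (e (snd p)) *\<^sub>R d (snd p)" if "p \<in> S" for p
      using that by (auto simp: S_def fib_def)
    have "((\<lambda>p. mpow h (e (snd p)) *\<^sub>R d (snd p)) has_sum F h) S"
      using F[OF h] has_sum_reindex_bij_betw[OF bij, of "\<lambda>j. mpow h (e j) *\<^sub>R d j" "F h"] by simp
    then have "((\<lambda>(k, j). mpow h k *\<^sub>R d j) has_sum F h) S"
      by (subst has_sum_cong[OF eq]) auto
    then show "((\<lambda>k. mpow h k *\<^sub>R c k) has_sum F h) multi_index"
      unfolding S_def by (rule has_sum_SigmaD) (auto intro!: has_sum_scaleR dsum)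
  qed
  moreover have "(\<Sum>\<^sub>\<infinity>k\<in>multi_index. \<rho> ^ mdeg k * norm (c k)) \<le> (\<Sum>\<^sub>\<infinity>j\<in>J. \<rho> ^ mdeg (e j) * norm (d j))"
    unfolding Wsum[symmetric] vsum[symmetric] using cv by (intro infsum_mono csumm v) auto
  ultimately show ?thesis unfolding maj_def by blast
qed

lemma maj_has_sum:
  fixes Fi :: "'i \<Rightarrow> 'a::euclidean_space \<Rightarrow> 'b::banach"
  assumes \<rho>: "\<rho> > 0" and Fi: "\<And>i. i \<in> I \<Longrightarrow> maj \<rho> (Fi i) (M i)"
    and M: "M summable_on I"
    and F: "\<And>h. h \<in> cube \<rho> \<Longrightarrow> ((\<lambda>i. Fi i h) has_sum F h) I"
  shows "maj \<rho> F (infsum M I)"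
proof -
  let ?N = "\<lambda>c. \<Sum>\<^sub>\<infinity>k\<in>multi_index. \<rho> ^ mdeg k * norm (c k)"
  have "\<exists>c. \<forall>i\<in>I. has_expansion \<rho> (Fi i) (c i) \<and> ?N (c i) \<le> M i"
    by (rule bchoice) (use Fi in \<open>auto simp: maj_def\<close>)
  then obtain c where c: "\<And>i. i \<in> I \<Longrightarrow> has_expansion \<rho> (Fi i) (c i)"
    and N: "\<And>i. i \<in> I \<Longrightarrow> ?N (c i) \<le> M i" by blast
  define d where "d = (\<lambda>p. c (fst p) (snd p))"
  have N0: "0 \<le> ?N (c i)" for i
    using \<rho> by (intro infsum_nonneg) auto
  have Ns: "(\<lambda>i. ?N (c i)) summable_on I"
    by (rule summable_on_comparison_test[OF M]) (use N N0 in auto)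
  have inner: "((\<lambda>k. \<rho> ^ mdeg k * norm (c i k)) has_sum ?N (c i)) multi_index" if "i \<in> I" for i
    using c[OF that] by (simp add: has_expansion_def)
  have summ: "(\<lambda>p. \<rho> ^ mdeg (snd p) * norm (d p)) summable_on I \<times> multi_index"
    by (rule summable_on_SigmaI[where g = "\<lambda>i. ?N (c i)"])
       (use inner Ns \<rho> in \<open>auto simp: d_def\<close>)
  have "maj \<rho> F (\<Sum>\<^sub>\<infinity>p\<in>I \<times> multi_index. \<rho> ^ mdeg (snd p) * norm (d p))"
  proof (rule maj_regroup[OF \<rho> _ summ])
    fix h :: 'a assume h: "h \<in> cube \<rho>"
    show "((\<lambda>p. mpow h (snd p) *\<^sub>R d p) has_sum F h) (I \<times> multi_index)"
    proof (rule has_sum_SigmaI[OF _ F[OF h]])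
      fix i assume "i \<in> I"
      then show "((\<lambda>y. mpow h (snd (i, y)) *\<^sub>R d (i, y)) has_sum Fi i h) multi_index"
        using c h by (auto simp: has_expansion_def d_def)
    next
      show "(\<lambda>p. mpow h (snd p) *\<^sub>R d p) summable_on I \<times> multi_index"
        by (rule abs_summable_summable, rule Infinite_Sum.abs_summable_on_comparison_test'[OF summ])
           (use abs_mpow_le[OF h] in \<open>auto intro!: mult_right_mono\<close>)
    qed
  qed auto
  moreover have "(\<Sum>\<^sub>\<infinity>p\<in>I \<times> multi_index. \<rho> ^ mdeg (snd p) * norm (d p)) = (\<Sum>\<^sub>\<infinity>i\<in>I. ?N (c i))"
    using summ by (subst infsum_Sigma_banach[symmetric]) (auto simp: d_def)
  moreover have "(\<Sum>\<^sub>\<infinity>i\<in>I. ?N (c i)) \<le> infsum M I"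
    by (rule infsum_mono[OF Ns M]) (use N in auto)
  ultimately show ?thesis by (auto intro: maj_mono)
qed

lemma maj_monomial:
  assumes "\<rho> > 0" "k \<in> multi_index"
  shows "maj \<rho> (\<lambda>h. mpow h k *\<^sub>R x) (\<rho> ^ mdeg k * norm x)"
  using maj_regroup[of \<rho> "{()}" "\<lambda>_. k" "\<lambda>_. x" "\<lambda>h. mpow h k *\<^sub>R x"] assms
  by (simp add: has_sum_finiteI)

lemma maj_const: "\<rho> > 0 \<Longrightarrow> maj \<rho> (\<lambda>_. x) (norm x)"
  using maj_monomial[of \<rho> "\<lambda>_. 0" x] by (simp add: multi_index_def mpow_def mdeg_def)

lemma maj_coord:
  assumes "\<rho> > 0" "b \<in> Basis"
  shows "maj \<rho> (\<lambda>h. h \<bullet> b) \<rho>"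
  using maj_monomial[of \<rho> "\<lambda>b'. if b' = b then 1 else 0" "1::real"] assms
  by (simp add: multi_index_def mpow_def mdeg_def if_distrib cong: if_cong)

text \<open>
  The product of two series runs over pairs \<open>(k, l)\<close> of exponents. It is summed over \<open>l\<close> first, as the
  expansion of \<open>c k\<close> times the second factor, and then over \<open>k\<close>.
\<close>

lemma maj_bilinear:
  fixes F :: "'a::euclidean_space \<Rightarrow> 'b::banach" and G :: "'a \<Rightarrow> 'c::banach"
    and B :: "'b \<Rightarrow> 'c \<Rightarrow> 'd::banach"
  assumes \<rho>: "\<rho> > 0" and B: "bounded_bilinear B" and K: "\<And>x y. norm (B x y) \<le> K * norm x * norm y" "0 \<le> K"
    and F: "maj \<rho> F M" and G: "maj \<rho> G N"
  shows "maj \<rho> (\<lambda>h. B (F h) (G h)) (K * M * N)"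
proof -
  interpret B: bounded_bilinear B by fact
  let ?S = "\<lambda>c. \<Sum>\<^sub>\<infinity>k\<in>multi_index. \<rho> ^ mdeg k * norm (c k)"
  obtain c d where c: "has_expansion \<rho> F c" "?S c \<le> M" and d: "has_expansion \<rho> G d" "?S d \<le> N"
    using F G unfolding maj_def by blast
  have N: "0 \<le> N" using maj_nonneg[OF G] \<rho> by simp
  define F1 where "F1 = (\<lambda>k h. B (mpow h k *\<^sub>R c k) (G h))"
  have F1: "maj \<rho> (F1 k) (K * (\<rho> ^ mdeg k * norm (c k)) * N)" if k: "k \<in> multi_index" for k
  proof -
    let ?T = "\<lambda>l. \<rho> ^ mdeg (\<lambda>b. k b + l b) * norm (B (c k) (d l))"
    have T: "?T l \<le> (K * (\<rho> ^ mdeg k * norm (c k))) * (\<rho> ^ mdeg l * norm (d l))" for l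
    proof -
      have "?T l \<le> \<rho> ^ (mdeg k + mdeg l) * (K * norm (c k) * norm (d l))"
        unfolding mdeg_add using \<rho> K by (intro mult_left_mono) auto
      then show ?thesis by (simp add: power_add mult_ac)
    qed
    have ds: "(\<lambda>l. (K * (\<rho> ^ mdeg k * norm (c k))) * (\<rho> ^ mdeg l * norm (d l))) summable_on multi_index"
      using d by (intro summable_on_cmult_right) (simp add: has_expansion_def)
    have Ts: "?T summable_on multi_index"
      by (rule summable_on_comparison_test[OF ds]) (use T \<rho> in auto)
    have "maj \<rho> (F1 k) (infsum ?T multi_index)"
    proof (rule maj_regroup[OF \<rho> _ Ts])
      fix h :: 'a assume h: "h \<in> cube \<rho>"
      have "((\<lambda>l. B (mpow h k *\<^sub>R c k) (mpow h l *\<^sub>R d l)) has_sum F1 k h) multi_index"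
        unfolding F1_def
        using d h by (intro has_sum_bounded_linear[OF B.bounded_linear_right]) (auto simp: has_expansion_def)
      then show "((\<lambda>l. mpow h (\<lambda>b. k b + l b) *\<^sub>R B (c k) (d l)) has_sum F1 k h) multi_index"
        by (simp add: mpow_add B.scaleR_left B.scaleR_right mult.commute)
    qed (use k in \<open>auto simp: multi_index_def\<close>)
    moreover have "infsum ?T multi_index \<le> (K * (\<rho> ^ mdeg k * norm (c k))) * ?S d"
      using infsum_mono[OF Ts ds] T by (simp add: infsum_cmult_right')
    moreover have "(K * (\<rho> ^ mdeg k * norm (c k))) * ?S d \<le> (K * (\<rho> ^ mdeg k * norm (c k))) * N"
      using d K \<rho> by (intro mult_left_mono) auto
    ultimately show ?thesis by (auto intro: maj_mono)
  qed
  have s: "(\<lambda>k. K * (\<rho> ^ mdeg k * norm (c k)) * N) summable_on multi_index"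
    using c by (intro summable_on_cmult_left summable_on_cmult_right) (simp add: has_expansion_def)
  have "maj \<rho> (\<lambda>h. B (F h) (G h)) (\<Sum>\<^sub>\<infinity>k\<in>multi_index. K * (\<rho> ^ mdeg k * norm (c k)) * N)"
  proof (rule maj_has_sum[OF \<rho> F1 s])
    fix h :: 'a assume h: "h \<in> cube \<rho>"
    show "((\<lambda>k. F1 k h) has_sum B (F h) (G h)) multi_index"
      unfolding F1_def
      using c h by (intro has_sum_bounded_linear[OF B.bounded_linear_left]) (auto simp: has_expansion_def)
  qed
  moreover have "(\<Sum>\<^sub>\<infinity>k\<in>multi_index. K * (\<rho> ^ mdeg k * norm (c k)) * N) = K * ?S c * N"
    by (simp add: infsum_cmult_right' infsum_cmult_left')
  moreover have "K * ?S c * N \<le> K * M * N"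
    using c N K by (intro mult_right_mono mult_left_mono) auto
  ultimately show ?thesis by (auto intro: maj_mono)
qed

lemma maj_add:
  assumes "\<rho> > 0" "maj \<rho> F M" "maj \<rho> G N"
  shows "maj \<rho> (\<lambda>h. F h + G h) (M + N)"
  using maj_has_sum[of \<rho> "UNIV :: bool set" "\<lambda>i. if i then F else G" "\<lambda>i. if i then M else N" "\<lambda>h. F h + G h"]
    assms by (simp add: UNIV_bool has_sum_finiteI add.commute)

lemma maj_sum:
  assumes "\<rho> > 0" "finite I" "\<And>i. i \<in> I \<Longrightarrow> maj \<rho> (Fi i) (M i)"
  shows "maj \<rho> (\<lambda>h. \<Sum>i\<in>I. Fi i h) (\<Sum>i\<in>I. M i)"
  using maj_has_sum[of \<rho> I Fi M "\<lambda>h. \<Sum>i\<in>I. Fi i h"] assms by (simp add: has_sum_finiteI)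

lemma maj_linear:
  assumes \<rho>: "\<rho> > 0" and L: "bounded_linear L" and K: "\<And>x. norm (L x) \<le> K * norm x" "0 \<le> K" and F: "maj \<rho> F M"
  shows "maj \<rho> (\<lambda>h. L (F h)) (K * M)"
proof -
  interpret L: bounded_linear L by fact
  have B: "bounded_bilinear (\<lambda>(r::real) x. r *\<^sub>R L x)"
    using bounded_bilinear.comp[OF bounded_bilinear_scaleR bounded_linear_ident L] by simp
  \<comment> \<open>A linear map is treated as a bilinear one whose first argument is the constant 1.\<close>
  have "maj \<rho> (\<lambda>h. 1 *\<^sub>R L (F h)) (K * norm (1::real) * M)"
    by (rule maj_bilinear[OF \<rho> B _ K(2) maj_const[OF \<rho>] F])
       (simp, metis K(1) abs_ge_zero mult.assoc mult.left_commute mult_left_mono)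
  then show ?thesis by simp
qed

lemma maj_power:
  fixes F :: "'a::euclidean_space \<Rightarrow> 'b::{banach,real_normed_algebra_1}"
  assumes \<rho>: "\<rho> > 0" and F: "maj \<rho> F M"
  shows "maj \<rho> (\<lambda>h. F h ^ n) (M ^ n)"
proof (induction n)
  case 0
  then show ?case using maj_const[OF \<rho>, of "1::'b"] by simp
next
  case (Suc n)
  have "maj \<rho> (\<lambda>h. F h * F h ^ n) (1 * M * M ^ n)"
    by (rule maj_bilinear[OF \<rho> bounded_bilinear_mult _ _ F Suc]) (simp_all add: norm_mult_ineq)
  then show ?case by simp
qed

lemma maj_prod:
  fixes Fi :: "'i \<Rightarrow> 'a::euclidean_space \<Rightarrow> real"
  assumes \<rho>: "\<rho> > 0" and "finite I" and F: "\<And>i. i \<in> I \<Longrightarrow> maj \<rho> (Fi i) (M i)"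
  shows "maj \<rho> (\<lambda>h. \<Prod>i\<in>I. Fi i h) (\<Prod>i\<in>I. M i)"
  using \<open>finite I\<close> F
proof induction
  case empty
  then show ?case using maj_const[OF \<rho>, of "1::real"] by simp
next
  case (insert i I)
  then show ?case
    using maj_bilinear[OF \<rho> bounded_bilinear_mult, of 1 "Fi i" "M i" "\<lambda>h. \<Prod>i\<in>I. Fi i h" "\<Prod>i\<in>I. M i"]
    by (simp add: abs_mult)
qed

lemma maj_shrink:
  assumes c: "has_expansion \<rho> F c" and M: "(\<Sum>\<^sub>\<infinity>k\<in>multi_index. \<rho> ^ mdeg k * norm (c k)) \<le> M"
    and \<rho>': "0 < \<rho>'" "\<rho>' \<le> \<rho>" and "0 \<le> q"
    and le: "\<And>k. k \<in> multi_index \<Longrightarrow> \<rho>' ^ mdeg k * norm (c k) \<le> (\<rho> ^ mdeg k * norm (c k)) * q"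
  shows "maj \<rho>' F (M * q)"
proof -
  let ?S = "\<lambda>r. \<Sum>\<^sub>\<infinity>k\<in>multi_index. r ^ mdeg k * norm (c k)"
  have s: "(\<lambda>k. (\<rho> ^ mdeg k * norm (c k)) * q) summable_on multi_index"
    using c by (intro summable_on_cmult_left) (simp add: has_expansion_def)
  have s': "(\<lambda>k. \<rho>' ^ mdeg k * norm (c k)) summable_on multi_index"
    by (rule summable_on_comparison_test[OF s]) (use le \<rho>' in auto)
  have "has_expansion \<rho>' F c"
    using c s' cube_mono[OF \<rho>'(2)] by (auto simp: has_expansion_def)
  moreover have "?S \<rho>' \<le> ?S \<rho> * q"
    using infsum_mono[OF s' s le] unfolding infsum_cmult_left' by simp
  moreover have "?S \<rho> * q \<le> M * q"
    using M \<open>0 \<le> q\<close> by (rule mult_right_mono)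
  ultimately show ?thesis unfolding maj_def by (blast intro: order_trans)
qed

lemma maj_smaller_cube:
  assumes "maj \<rho> F M" and \<rho>': "0 < \<rho>'" "\<rho>' \<le> \<rho>"
  shows "maj \<rho>' F M"
proof -
  obtain c where c: "has_expansion \<rho> F c" "(\<Sum>\<^sub>\<infinity>k\<in>multi_index. \<rho> ^ mdeg k * norm (c k)) \<le> M"
    using assms(1) unfolding maj_def by blast
  have "maj \<rho>' F (M * 1)"
    using \<rho>' by (intro maj_shrink[OF c]) (auto intro!: mult_right_mono power_mono)
  then show ?thesis by simp
qed

lemma mpow_zero: "k \<in> multi_index \<Longrightarrow> mpow 0 k = (if k = (\<lambda>_. 0) then 1 else 0)"
  by (auto simp: mpow_def multi_index_def fun_eq_iff)

lemma has_expansion_at_zero: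
  assumes "has_expansion \<rho> F c" "0 \<le> \<rho>"
  shows "c (\<lambda>_. 0) = F 0"
proof -
  have "((\<lambda>k. mpow 0 k *\<^sub>R c k) has_sum F 0) multi_index"
    using assms zero_in_cube by (auto simp: has_expansion_def)
  moreover have "((\<lambda>k. mpow 0 k *\<^sub>R c k) has_sum c (\<lambda>_. 0)) multi_index"
  proof (rule has_sum_finite_neutralI[where B = "{\<lambda>_. 0}"])
    show "{\<lambda>_. 0} \<subseteq> (multi_index :: ('a \<Rightarrow> nat) set)" by (auto simp: multi_index_def)
    then show "c (\<lambda>_. 0) = (\<Sum>k\<in>{\<lambda>_. 0}. mpow 0 k *\<^sub>R c k)" by (simp add: mpow_zero)
  qed (auto simp: mpow_zero)
  ultimately show ?thesis using has_sum_unique by blast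
qed

text \<open>
  Every monomial that remains has degree at least one and gains a factor \<open>\<rho>' / \<rho>\<close> from the smaller
  cube. Hence the majorant of a function that vanishes at the centre can be made small, which is what
  compositions need.
\<close>

lemma maj_vanishing:
  assumes F: "maj \<rho> F M" and F0: "F 0 = 0" and \<rho>': "0 < \<rho>'" "\<rho>' \<le> \<rho>"
  shows "maj \<rho>' F (M * (\<rho>' / \<rho>))"
proof -
  obtain c where c: "has_expansion \<rho> F c" and M: "(\<Sum>\<^sub>\<infinity>k\<in>multi_index. \<rho> ^ mdeg k * norm (c k)) \<le> M"
    using F unfolding maj_def by blast
  have c0: "c (\<lambda>_. 0) = 0"
    using has_expansion_at_zero[OF c] F0 \<rho>' by simp
  have le: "\<rho>' ^ mdeg k * norm (c k) \<le> (\<rho> ^ mdeg k * norm (c k)) * (\<rho>' / \<rho>)" if "k \<in> multi_index" for k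
  proof (cases "mdeg k")
    case 0
    then have "k = (\<lambda>_. 0)" using that by (auto simp: mdeg_def multi_index_def fun_eq_iff)
    then show ?thesis using c0 by simp
  next
    case (Suc n)
    have "\<rho>' ^ n * (\<rho>' * norm (c k)) \<le> \<rho> ^ n * (\<rho>' * norm (c k))"
      using \<rho>' by (intro mult_right_mono power_mono) auto
    then show ?thesis using Suc \<rho>' by (simp add: field_simps)
  qed
  show ?thesis
    by (rule maj_shrink[OF c M \<rho>' _ le]) (use \<rho>' in auto)
qed

text \<open>
  A monomial in the components of \<open>g\<close> is a product of functions majorized by \<open>\<rho>\<close>, so it has the same
  majorant as the original monomial on the cube of half-width \<open>\<rho>\<close>.
\<close>

lemma maj_compose:
  fixes F :: "'a::euclidean_space \<Rightarrow> 'b::banach" and g :: "'c::euclidean_space \<Rightarrow> 'a"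
  assumes F: "maj \<rho> F M" and \<rho>': "0 < \<rho>'" and \<rho>: "0 < \<rho>"
    and g: "\<And>b. b \<in> Basis \<Longrightarrow> maj \<rho>' (\<lambda>h. g h \<bullet> b) \<rho>"
  shows "maj \<rho>' (\<lambda>h. F (g h)) M"
proof -
  obtain c where c: "has_expansion \<rho> F c" and M: "(\<Sum>\<^sub>\<infinity>k\<in>multi_index. \<rho> ^ mdeg k * norm (c k)) \<le> M"
    using F unfolding maj_def by blast
  have m: "maj \<rho>' (\<lambda>h. mpow (g h) k *\<^sub>R c k) (\<rho> ^ mdeg k * norm (c k))" for k
  proof -
    have "maj \<rho>' (\<lambda>h. mpow (g h) k) (\<rho> ^ mdeg k)"
      unfolding mpow_def mdeg_def power_sum by (intro maj_prod maj_power g \<rho>') auto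
    from maj_bilinear[OF \<rho>' bounded_bilinear_scaleR, of 1, OF _ _ this maj_const[OF \<rho>', of "c k"]]
    show ?thesis by simp
  qed
  have "maj \<rho>' (\<lambda>h. F (g h)) (\<Sum>\<^sub>\<infinity>k\<in>multi_index. \<rho> ^ mdeg k * norm (c k))"
  proof (rule maj_has_sum[OF \<rho>' m])
    fix h :: 'c assume "h \<in> cube \<rho>'"
    then have "g h \<in> cube \<rho>"
      using maj_bound[OF g] by (auto simp: cube_def)
    then show "((\<lambda>k. mpow (g h) k *\<^sub>R c k) has_sum F (g h)) multi_index"
      using c by (simp add: has_expansion_def)
  qed (use c in \<open>simp add: has_expansion_def\<close>)
  then show ?thesis using M by (rule maj_mono)
qed

section \<open>Termwise differentiation\<close>

text \<open>
  The second-order Taylor remainder of \<open>x ^ n\<close> is a polynomial with nonnegative coefficients, so it is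
  dominated, up to the factor \<open>(t / \<delta>)\<^sup>2\<close>, by the same remainder at \<open>r\<close> with increment \<open>\<delta>\<close>. The subtracted terms on the right
  cannot be dropped: they make the induction close.
\<close>

lemma power_remainder_bound:
  fixes x t r \<delta> :: real
  assumes "\<bar>x\<bar> \<le> r" "\<bar>t\<bar> \<le> \<delta>" "0 < \<delta>"
  shows "\<bar>(x + t) ^ n - x ^ n - real n * x ^ (n - 1) * t\<bar>
           \<le> (t / \<delta>)\<^sup>2 * ((r + \<delta>) ^ n - r ^ n - real n * r ^ (n - 1) * \<delta>)"
proof (induction n)
  case (Suc n)
  let ?E = "(x + t) ^ n - x ^ n - real n * x ^ (n - 1) * t"
  let ?R = "(r + \<delta>) ^ n - r ^ n - real n * r ^ (n - 1) * \<delta>"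
  have step: "(y + s) ^ Suc n - y ^ Suc n - real (Suc n) * y ^ (Suc n - 1) * s
      = (y + s) * ((y + s) ^ n - y ^ n - real n * y ^ (n - 1) * s) + real n * y ^ (n - 1) * s\<^sup>2"
    for y s :: real
    by (cases n) (simp_all add: algebra_simps power2_eq_square)
  have r: "0 \<le> r" using assms by linarith
  have "\<bar>(x + t) * ?E + real n * x ^ (n - 1) * t\<^sup>2\<bar>
      \<le> \<bar>x + t\<bar> * \<bar>?E\<bar> + real n * \<bar>x\<bar> ^ (n - 1) * t\<^sup>2"
    by (rule order_trans[OF abs_triangle_ineq]) (simp add: abs_mult power_abs)
  also have "\<dots> \<le> (r + \<delta>) * ((t / \<delta>)\<^sup>2 * ?R) + real n * r ^ (n - 1) * t\<^sup>2"
    using assms r Suc by (intro add_mono mult_mono power_mono mult_right_mono mult_left_mono) auto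
  also have "\<dots> = (t / \<delta>)\<^sup>2 * ((r + \<delta>) * ?R + real n * r ^ (n - 1) * \<delta>\<^sup>2)"
    using assms by (simp add: field_simps power2_eq_square)
  finally show ?case unfolding step .
qed simp

lemma power_deriv_bound:
  fixes r \<delta> :: real
  assumes "0 \<le> r" "0 < \<delta>"
  shows "real n * r ^ (n - 1) * \<delta> \<le> (r + \<delta>) ^ n"
proof -
  have "0 \<le> (r + \<delta>) ^ n - r ^ n - real n * r ^ (n - 1) * \<delta>"
    using power_remainder_bound[of r r \<delta> \<delta> n] assms by (simp add: order_trans[OF abs_ge_zero])
  moreover have "0 \<le> r ^ n" using assms by simp
  ultimately show ?thesis by linarith
qed

lemma has_sum_minus:
  fixes f :: "'a \<Rightarrow> 'b::real_normed_vector"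
  shows "(f has_sum S) A \<Longrightarrow> ((\<lambda>x. - f x) has_sum - S) A"
  by (simp add: has_sum_uminus)

definition raise_index :: "'a \<Rightarrow> ('a \<Rightarrow> nat) \<Rightarrow> 'a \<Rightarrow> nat" where
  "raise_index b k = k(b := Suc (k b))"

definition coeff_deriv :: "'a \<Rightarrow> (('a \<Rightarrow> nat) \<Rightarrow> 'b::real_vector) \<Rightarrow> ('a \<Rightarrow> nat) \<Rightarrow> 'b" where
  "coeff_deriv b c k = real (Suc (k b)) *\<^sub>R c (raise_index b k)"

lemma bij_raise_index:
  assumes "b \<in> Basis"
  shows "bij_betw (raise_index b) multi_index {k\<in>multi_index. k b > 0}"
  by (rule bij_betwI[where g = "\<lambda>k. k(b := k b - 1)"])
     (use assms in \<open>auto simp: multi_index_def raise_index_def\<close>)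

lemma mdeg_raise_index: "b \<in> Basis \<Longrightarrow> mdeg (raise_index b k) = Suc (mdeg k)"
  unfolding mdeg_def raise_index_def
  by (subst (1 2) sum.remove[of Basis b]) (auto intro!: sum.cong)

lemma mpow_split: "b \<in> Basis \<Longrightarrow> mpow h k = (h \<bullet> b) ^ k b * (\<Prod>b'\<in>Basis - {b}. (h \<bullet> b') ^ k b')"
  unfolding mpow_def by (subst prod.remove[of Basis b]) auto

text \<open>
  A quadratic bound on the remainder is used as the criterion for a derivative because such bounds can
  be added up over infinitely many terms.
\<close>

lemma dir_deriv_quadratic:
  fixes F :: "'a::real_normed_vector \<Rightarrow> 'b::real_normed_vector"
  assumes "\<delta> > 0" and rem: "\<And>t. \<bar>t\<bar> \<le> \<delta> \<Longrightarrow> norm (F (x + t *\<^sub>R b) - F x - t *\<^sub>R d) \<le> C * t\<^sup>2"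
  shows "((\<lambda>t. F (x + t *\<^sub>R b)) has_vector_derivative d) (at 0)" and "dir_deriv b F x = d"
proof -
  show *: "((\<lambda>t. F (x + t *\<^sub>R b)) has_vector_derivative d) (at 0)"
    unfolding has_vector_derivative_def has_derivative_at
  proof (intro conjI bounded_linear_scaleR_left)
    have ev: "\<forall>\<^sub>F t in at 0. norm (F (x + (0 + t) *\<^sub>R b) - F (x + 0 *\<^sub>R b) - t *\<^sub>R d) / norm t \<le> C * \<bar>t\<bar>"
    proof -
      have "norm (F (x + (0 + t) *\<^sub>R b) - F (x + 0 *\<^sub>R b) - t *\<^sub>R d) / norm t \<le> C * \<bar>t\<bar>"
        if "t \<noteq> 0" "\<bar>t\<bar> < \<delta>" for t :: real
        using rem[of t] that by (simp add: divide_le_eq power2_eq_square mult.assoc)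
      then show ?thesis
        unfolding eventually_at using \<open>\<delta> > 0\<close> by (intro exI[of _ \<delta>]) (auto simp: dist_real_def)
    qed
    have lim: "((\<lambda>t. C * \<bar>t\<bar>) \<longlongrightarrow> 0) (at (0::real))"
      by (rule tendsto_eq_intros | simp)+
    show "(\<lambda>t. norm (F (x + (0 + t) *\<^sub>R b) - F (x + 0 *\<^sub>R b) - t *\<^sub>R d) / norm t) \<midarrow>0\<rightarrow> 0"
      by (rule tendsto_sandwich[OF _ ev tendsto_const lim]) simp
  qed
  then show "dir_deriv b F x = d"
    unfolding dir_deriv_def by (rule vector_derivative_at)
qed

text \<open>
  The remainder of the monomial with exponent \<open>k\<close> is at most \<open>(t / \<delta>)\<^sup>2 \<rho>\<^bsup>mdeg k\<^esup>\<close>. The sum of these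
  bounds is a quadratic bound for the remainder of the whole series, so the termwise derivative is the
  derivative.
\<close>

lemma has_expansion_dir_deriv:
  fixes F :: "'a::euclidean_space \<Rightarrow> 'b::banach"
  assumes F: "has_expansion \<rho> F c" and \<delta>: "0 < \<delta>" "\<delta> < \<rho>" and b: "b \<in> Basis"
  defines "N \<equiv> \<Sum>\<^sub>\<infinity>k\<in>multi_index. \<rho> ^ mdeg k * norm (c k)"
  shows "has_expansion (\<rho> - \<delta>) (dir_deriv b F) (coeff_deriv b c)"
    and "(\<Sum>\<^sub>\<infinity>k\<in>multi_index. (\<rho> - \<delta>) ^ mdeg k * norm (coeff_deriv b c k)) \<le> N / \<delta>"
    and "\<And>h t. h \<in> cube (\<rho> - \<delta>) \<Longrightarrow> \<bar>t\<bar> \<le> \<delta> \<Longrightarrow>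
       norm (F (h + t *\<^sub>R b) - F h - t *\<^sub>R dir_deriv b F h) \<le> (t / \<delta>)\<^sup>2 * N"
proof -
  define r where "r = \<rho> - \<delta>"
  have r: "0 < r" "\<rho> = r + \<delta>" using \<delta> by (auto simp: r_def)
  let ?P = "{k\<in>multi_index. k b > 0}"
  let ?c = "\<lambda>k. \<rho> ^ mdeg k * norm (c k)"
  note bij = bij_raise_index[OF b]
  have cs: "?c summable_on multi_index" using F by (simp add: has_expansion_def)
  have cP: "?c summable_on ?P" by (rule summable_on_subset_banach[OF cs]) auto
  have cP': "(\<lambda>k. ?c (raise_index b k)) summable_on multi_index"
    using cP summable_on_reindex_bij_betw[OF bij, of ?c] by simp
  have le: "r ^ mdeg k * norm (coeff_deriv b c k) \<le> ?c (raise_index b k) * (1 / \<delta>)" for k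
  proof -
    have kb: "k b \<le> mdeg k" unfolding mdeg_def using b by (simp add: member_le_sum)
    have "real (Suc (k b)) * r ^ mdeg k * \<delta> \<le> real (Suc (mdeg k)) * r ^ (Suc (mdeg k) - 1) * \<delta>"
      using kb r \<delta> by (intro mult_right_mono) auto
    also have "\<dots> \<le> \<rho> ^ Suc (mdeg k)"
      unfolding r(2) by (rule power_deriv_bound) (use r \<delta> in auto)
    finally have "real (Suc (k b)) * r ^ mdeg k * \<delta> * norm (c (raise_index b k))
        \<le> \<rho> ^ Suc (mdeg k) * norm (c (raise_index b k))"
      by (rule mult_right_mono) simp
    moreover have "norm (coeff_deriv b c k) = real (Suc (k b)) * norm (c (raise_index b k))"
      by (simp add: coeff_deriv_def del: of_nat_Suc)
    ultimately show ?thesis using \<delta> by (simp add: mdeg_raise_index[OF b] field_simps)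
  qed
  have s1: "(\<lambda>k. ?c (raise_index b k) * (1 / \<delta>)) summable_on multi_index"
    using cP' by (rule summable_on_cmult_left)
  have s2: "(\<lambda>k. r ^ mdeg k * norm (coeff_deriv b c k)) summable_on multi_index"
    by (rule summable_on_comparison_test[OF s1]) (use le r in auto)
  have "(\<Sum>\<^sub>\<infinity>k\<in>multi_index. r ^ mdeg k * norm (coeff_deriv b c k))
      \<le> (\<Sum>\<^sub>\<infinity>k\<in>multi_index. ?c (raise_index b k) * (1 / \<delta>))"
    by (rule infsum_mono[OF s2 s1 le])
  also have "\<dots> = infsum ?c ?P / \<delta>"
    unfolding infsum_cmult_left' using infsum_reindex_bij_betw[OF bij, of ?c] by simp
  also have "\<dots> \<le> N / \<delta>"
    unfolding N_def using \<delta> r by (intro divide_right_mono infsum_mono2 cs cP) auto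
  finally have bound: "(\<Sum>\<^sub>\<infinity>k\<in>multi_index. r ^ mdeg k * norm (coeff_deriv b c k)) \<le> N / \<delta>" .
  define F' where "F' = (\<lambda>h. \<Sum>\<^sub>\<infinity>k\<in>multi_index. mpow h k *\<^sub>R coeff_deriv b c k)"
  have F': "((\<lambda>k. mpow h k *\<^sub>R coeff_deriv b c k) has_sum F' h) multi_index" if h: "h \<in> cube r" for h
  proof -
    have "(\<lambda>k. mpow h k *\<^sub>R coeff_deriv b c k) summable_on multi_index"
      by (rule abs_summable_summable, rule Infinite_Sum.abs_summable_on_comparison_test'[OF s2])
         (use abs_mpow_le[OF h] in \<open>auto intro!: mult_right_mono\<close>)
    then show ?thesis unfolding F'_def by simp
  qed
  have rem: "norm (F (h + t *\<^sub>R b) - F h - t *\<^sub>R F' h) \<le> (t / \<delta>)\<^sup>2 * N"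
    if h: "h \<in> cube r" and t: "\<bar>t\<bar> \<le> \<delta>" for h t
  proof -
    let ?rest = "\<lambda>k. \<Prod>b'\<in>Basis - {b}. (h \<bullet> b') ^ k b'"
    let ?d = "\<lambda>k. real (k b) * (h \<bullet> b) ^ (k b - 1) * ?rest k"
    have inn: "(h + t *\<^sub>R b) \<bullet> b' = (if b' = b then h \<bullet> b + t else h \<bullet> b')" if "b' \<in> Basis" for b'
      using that b by (auto simp: inner_add_left inner_Basis)
    have hr: "\<bar>h \<bullet> b'\<bar> \<le> r" if "b' \<in> Basis" for b' using h that by (simp add: cube_def)
    have h1: "h + t *\<^sub>R b \<in> cube \<rho>" and h2: "h \<in> cube \<rho>"
      using hr t r \<delta> b by (fastforce simp: cube_def inn)+
    have mp: "mpow (h + t *\<^sub>R b) k = (h \<bullet> b + t) ^ k b * ?rest k" for k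
    proof -
      have "(\<Prod>b'\<in>Basis - {b}. ((h + t *\<^sub>R b) \<bullet> b') ^ k b') = ?rest k"
        by (rule prod.cong) (auto simp: inn)
      then show ?thesis unfolding mpow_split[OF b] using b by (simp add: inn)
    qed
    have dsum: "((\<lambda>k. ?d k *\<^sub>R c k) has_sum F' h) multi_index"
    proof -
      have eq: "?d (raise_index b k) = real (Suc (k b)) * mpow h k" for k
        unfolding mpow_split[OF b] by (auto simp: raise_index_def intro!: prod.cong)
      have "((\<lambda>k. ?d (raise_index b k) *\<^sub>R c (raise_index b k)) has_sum F' h) multi_index"
        using F'[OF h] unfolding eq coeff_deriv_def by (simp add: mult.commute)
      then have "((\<lambda>k. ?d k *\<^sub>R c k) has_sum F' h) ?P"
        using has_sum_reindex_bij_betw[OF bij, of "\<lambda>k. ?d k *\<^sub>R c k"] by simp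
      then show ?thesis
        by (subst has_sum_cong_neutral[where T = ?P and g = "\<lambda>k. ?d k *\<^sub>R c k"]) auto
    qed
    have "((\<lambda>k. mpow (h + t *\<^sub>R b) k *\<^sub>R c k + - (mpow h k *\<^sub>R c k) + - (t *\<^sub>R (?d k *\<^sub>R c k)))
        has_sum F (h + t *\<^sub>R b) + - F h + - (t *\<^sub>R F' h)) multi_index"
      using F h1 h2
      by (intro has_sum_add has_sum_minus has_sum_scaleR dsum) (auto simp: has_expansion_def)
    then have hs: "((\<lambda>k. (mpow (h + t *\<^sub>R b) k - mpow h k - t * ?d k) *\<^sub>R c k)
        has_sum F (h + t *\<^sub>R b) - F h - t *\<^sub>R F' h) multi_index"
      by (simp add: algebra_simps)
    have "norm (F (h + t *\<^sub>R b) - F h - t *\<^sub>R F' h) \<le> (\<Sum>\<^sub>\<infinity>k\<in>multi_index. (t / \<delta>)\<^sup>2 * ?c k)"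
    proof (rule norm_infsum_le[OF hs])
      show "((\<lambda>k. (t / \<delta>)\<^sup>2 * ?c k) has_sum (\<Sum>\<^sub>\<infinity>k\<in>multi_index. (t / \<delta>)\<^sup>2 * ?c k)) multi_index"
        by (rule has_sum_infsum, rule summable_on_cmult_right[OF cs])
    next
      fix k :: "'a \<Rightarrow> nat"
      have "\<bar>?rest k\<bar> \<le> (\<Prod>b'\<in>Basis - {b}. \<rho> ^ k b')"
        unfolding abs_prod using h2
        by (intro prod_mono) (auto simp: power_abs cube_def intro!: power_mono)
      moreover have "\<bar>(h \<bullet> b + t) ^ k b - (h \<bullet> b) ^ k b - real (k b) * (h \<bullet> b) ^ (k b - 1) * t\<bar>
          \<le> (t / \<delta>)\<^sup>2 * \<rho> ^ k b"
      proof -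
        have "(r + \<delta>) ^ k b - r ^ k b - real (k b) * r ^ (k b - 1) * \<delta> \<le> \<rho> ^ k b"
        proof -
          have "0 \<le> r ^ k b" "0 \<le> real (k b) * r ^ (k b - 1) * \<delta>" using r \<delta> by auto
          then show ?thesis unfolding r(2) by linarith
        qed
        then show ?thesis
          using power_remainder_bound[OF hr[OF b] t \<delta>(1), of "k b"]
          by (meson mult_left_mono order_trans zero_le_power2)
      qed
      ultimately have "\<bar>(h \<bullet> b + t) ^ k b - (h \<bullet> b) ^ k b - real (k b) * (h \<bullet> b) ^ (k b - 1) * t\<bar> * \<bar>?rest k\<bar>
          \<le> ((t / \<delta>)\<^sup>2 * \<rho> ^ k b) * (\<Prod>b'\<in>Basis - {b}. \<rho> ^ k b')"
        using r \<delta> by (intro mult_mono) auto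
      also have "\<dots> = (t / \<delta>)\<^sup>2 * \<rho> ^ mdeg k"
        unfolding mdeg_def power_sum by (subst prod.remove[of Basis b]) (use b in auto)
      also have "\<bar>(h \<bullet> b + t) ^ k b - (h \<bullet> b) ^ k b - real (k b) * (h \<bullet> b) ^ (k b - 1) * t\<bar> * \<bar>?rest k\<bar>
          = \<bar>mpow (h + t *\<^sub>R b) k - mpow h k - t * ?d k\<bar>"
        unfolding mp mpow_split[OF b, of h] abs_mult[symmetric] by (simp add: algebra_simps)
      finally show "norm ((mpow (h + t *\<^sub>R b) k - mpow h k - t * ?d k) *\<^sub>R c k) \<le> (t / \<delta>)\<^sup>2 * ?c k"
        by (simp add: mult_right_mono flip: mult.assoc)
    qed
    then show ?thesis by (simp add: infsum_cmult_right' N_def)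
  qed
  have eq: "dir_deriv b F h = F' h" if "h \<in> cube r" for h
  proof (rule dir_deriv_quadratic(2)[OF \<delta>(1)])
    fix t :: real assume "\<bar>t\<bar> \<le> \<delta>"
    from rem[OF that this] show "norm (F (h + t *\<^sub>R b) - F h - t *\<^sub>R F' h) \<le> (N / \<delta>\<^sup>2) * t\<^sup>2"
      by (simp add: power_divide mult.commute)
  qed
  show "has_expansion (\<rho> - \<delta>) (dir_deriv b F) (coeff_deriv b c)"
    using F' s2 unfolding has_expansion_def r_def[symmetric] by (simp add: eq)
  show "(\<Sum>\<^sub>\<infinity>k\<in>multi_index. (\<rho> - \<delta>) ^ mdeg k * norm (coeff_deriv b c k)) \<le> N / \<delta>"
    using bound unfolding r_def .
  show "norm (F (h + t *\<^sub>R b) - F h - t *\<^sub>R dir_deriv b F h) \<le> (t / \<delta>)\<^sup>2 * N"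
    if "h \<in> cube (\<rho> - \<delta>)" "\<bar>t\<bar> \<le> \<delta>" for h t
    using rem[of h t] eq[of h] that unfolding r_def by simp
qed

lemma maj_dir_deriv:
  fixes F :: "'a::euclidean_space \<Rightarrow> 'b::banach"
  assumes F: "maj \<rho> F M" and \<delta>: "0 < \<delta>" "\<delta> < \<rho>" and b: "b \<in> Basis"
  shows "maj (\<rho> - \<delta>) (dir_deriv b F) (M / \<delta>)"
    and "\<And>h t. h \<in> cube (\<rho> - \<delta>) \<Longrightarrow> \<bar>t\<bar> \<le> \<delta> \<Longrightarrow>
       norm (F (h + t *\<^sub>R b) - F h - t *\<^sub>R dir_deriv b F h) \<le> (t / \<delta>)\<^sup>2 * M"
proof -
  let ?N = "\<lambda>c. \<Sum>\<^sub>\<infinity>k\<in>multi_index. \<rho> ^ mdeg k * norm (c k)"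
  obtain c where c: "has_expansion \<rho> F c" and M: "?N c \<le> M"
    using F unfolding maj_def by blast
  note D = has_expansion_dir_deriv[OF c \<delta> b]
  have "?N c / \<delta> \<le> M / \<delta>" using M \<delta> by (intro divide_right_mono) auto
  with D(1,2) show "maj (\<rho> - \<delta>) (dir_deriv b F) (M / \<delta>)"
    unfolding maj_def by (blast intro: order_trans)
  fix h :: 'a and t :: real assume "h \<in> cube (\<rho> - \<delta>)" "\<bar>t\<bar> \<le> \<delta>"
  from D(3)[OF this] show "norm (F (h + t *\<^sub>R b) - F h - t *\<^sub>R dir_deriv b F h) \<le> (t / \<delta>)\<^sup>2 * M"
    using M by (meson mult_left_mono order_trans zero_le_power2)
qed

lemma dir_deriv_shift: "dir_deriv b (\<lambda>h. F (a + h)) h = dir_deriv b F (a + h)"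
  by (simp add: dir_deriv_def add.assoc)

text \<open>
  Convergence of a series of functions near \<open>a\<close> with summable majorants. In contrast to pointwise
  convergence it is inherited by the termwise derivatives.
\<close>

definition maj_series :: "'a::euclidean_space \<Rightarrow> real \<Rightarrow> ('a \<Rightarrow> 'b::banach) \<Rightarrow> (nat \<Rightarrow> 'a \<Rightarrow> 'b) \<Rightarrow> bool" where
  "maj_series a \<rho> F Fi \<longleftrightarrow> \<rho> > 0 \<and> (\<exists>M. (\<forall>i. maj \<rho> (\<lambda>h. Fi i (a + h)) (M i)) \<and> M summable_on UNIV) \<and>
     (\<forall>h\<in>cube \<rho>. ((\<lambda>i. Fi i (a + h)) has_sum F (a + h)) UNIV)"

lemma maj_series_maj:
  assumes "maj_series a \<rho> F Fi"
  shows "\<exists>M. maj \<rho> (\<lambda>h. F (a + h)) M"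
proof -
  obtain M where "\<And>i. maj \<rho> (\<lambda>h. Fi i (a + h)) (M i)" "M summable_on UNIV"
    using assms unfolding maj_series_def by auto
  then show ?thesis
    using maj_has_sum[of \<rho> UNIV "\<lambda>i h. Fi i (a + h)" M "\<lambda>h. F (a + h)"] assms
    unfolding maj_series_def by auto
qed

lemma maj_series_dir_deriv:
  fixes F :: "'a::euclidean_space \<Rightarrow> 'b::banach"
  assumes F: "maj_series a \<rho> F Fi" and \<rho>': "0 < \<rho>'" "\<rho>' < \<rho>" and b: "b \<in> Basis"
  shows "maj_series a \<rho>' (dir_deriv b F) (\<lambda>i. dir_deriv b (Fi i))"
proof -
  obtain M where Fi: "\<And>i. maj \<rho> (\<lambda>h. Fi i (a + h)) (M i)" and M: "M summable_on UNIV"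
    and sums: "\<And>h. h \<in> cube \<rho> \<Longrightarrow> ((\<lambda>i. Fi i (a + h)) has_sum F (a + h)) UNIV"
    using F unfolding maj_series_def by auto
  define \<delta> where "\<delta> = \<rho> - \<rho>'"
  have \<delta>: "0 < \<delta>" "\<delta> < \<rho>" "\<rho> - \<delta> = \<rho>'" using \<rho>' by (auto simp: \<delta>_def)
  note D = maj_dir_deriv[OF Fi \<delta>(1,2) b, unfolded \<delta>(3) dir_deriv_shift]
  have M': "(\<lambda>i. M i / \<delta>) summable_on UNIV"
    using summable_on_cmult_left[OF M, of "1 / \<delta>"] by simp
  have "((\<lambda>i. dir_deriv b (Fi i) (a + h)) has_sum dir_deriv b F (a + h)) UNIV" if h: "h \<in> cube \<rho>'" for h
  proof -
    have "(\<lambda>i. dir_deriv b (Fi i) (a + h)) summable_on UNIV"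
      by (rule abs_summable_summable, rule Infinite_Sum.abs_summable_on_comparison_test'[OF M'])
         (use maj_bound[OF D(1) h] in simp)
    then obtain d where d: "((\<lambda>i. dir_deriv b (Fi i) (a + h)) has_sum d) UNIV"
      unfolding summable_on_def by blast
    have "dir_deriv b F (a + h) = d"
    proof (rule dir_deriv_quadratic(2)[OF \<delta>(1)])
      fix t :: real assume t: "\<bar>t\<bar> \<le> \<delta>"
      have h1: "h + t *\<^sub>R b \<in> cube \<rho>" and h2: "h \<in> cube \<rho>"
      proof -
        have "\<bar>h \<bullet> b' + t * (b \<bullet> b')\<bar> \<le> \<rho>" "\<bar>h \<bullet> b'\<bar> \<le> \<rho>" if "b' \<in> Basis" for b'
        proof -
          have "\<bar>h \<bullet> b'\<bar> \<le> \<rho>'" using h that by (simp add: cube_def)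
          moreover have "\<bar>t * (b \<bullet> b')\<bar> \<le> \<delta>" using that b t by (auto simp: inner_Basis)
          ultimately show "\<bar>h \<bullet> b' + t * (b \<bullet> b')\<bar> \<le> \<rho>" "\<bar>h \<bullet> b'\<bar> \<le> \<rho>"
            unfolding \<delta>_def using \<rho>' by linarith+
        qed
        then show "h + t *\<^sub>R b \<in> cube \<rho>" "h \<in> cube \<rho>"
          by (auto simp: cube_def inner_add_left)
      qed
      have "((\<lambda>i. Fi i (a + (h + t *\<^sub>R b)) + - Fi i (a + h) + - (t *\<^sub>R dir_deriv b (Fi i) (a + h)))
          has_sum F (a + (h + t *\<^sub>R b)) + - F (a + h) + - (t *\<^sub>R d)) UNIV"
        by (intro has_sum_add has_sum_minus has_sum_scaleR d sums h1 h2)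
      then have "norm (F (a + (h + t *\<^sub>R b)) + - F (a + h) + - (t *\<^sub>R d)) \<le> (\<Sum>\<^sub>\<infinity>i. (t / \<delta>)\<^sup>2 * M i)"
      proof (rule norm_infsum_le)
        show "((\<lambda>i. (t / \<delta>)\<^sup>2 * M i) has_sum (\<Sum>\<^sub>\<infinity>i. (t / \<delta>)\<^sup>2 * M i)) UNIV"
          by (rule has_sum_infsum, rule summable_on_cmult_right[OF M])
      qed (use D(2)[OF h t] in simp)
      then show "norm (F (a + h + t *\<^sub>R b) - F (a + h) - t *\<^sub>R d) \<le> (infsum M UNIV / \<delta>\<^sup>2) * t\<^sup>2"
        unfolding infsum_cmult_right' by (simp add: add.assoc power_divide mult.commute)
    qed
    with d show ?thesis by simp
  qed
  then show ?thesis
    unfolding maj_series_def using \<rho>' D(1) M' by (auto intro!: exI[of _ "\<lambda>i. M i / \<delta>"])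
qed

lemma maj_series_add:
  assumes F: "maj_series a \<rho> F Fi" and G: "maj_series a \<rho> G Gi"
  shows "maj_series a \<rho> (\<lambda>x. F x + G x) (\<lambda>i x. Fi i x + Gi i x)"
proof -
  obtain M N where "\<And>i. maj \<rho> (\<lambda>h. Fi i (a + h)) (M i)" "M summable_on UNIV"
      "\<And>i. maj \<rho> (\<lambda>h. Gi i (a + h)) (N i)" "N summable_on UNIV"
    using assms unfolding maj_series_def by auto
  then show ?thesis
    using assms unfolding maj_series_def
    by (auto intro!: exI[of _ "\<lambda>i. M i + N i"] maj_add summable_on_add has_sum_add)
qed

lemma maj_series_zero: "\<rho> > 0 \<Longrightarrow> maj_series a \<rho> (\<lambda>_. 0) (\<lambda>_ _. 0)"
  unfolding maj_series_def using maj_const[of \<rho> 0] by (auto intro!: exI[of _ "\<lambda>_. 0"])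

lemma maj_series_sum:
  assumes "\<rho> > 0" "finite I" "\<And>l. l \<in> I \<Longrightarrow> maj_series a \<rho> (F l) (Fi l)"
  shows "maj_series a \<rho> (\<lambda>x. \<Sum>l\<in>I. F l x) (\<lambda>i x. \<Sum>l\<in>I. Fi l i x)"
  using assms(2,3)
  by induction (simp_all add: maj_series_zero maj_series_add assms(1))

lemma maj_series_linear:
  assumes F: "maj_series a \<rho> F Fi" and L: "bounded_linear L"
  shows "maj_series a \<rho> (\<lambda>x. L (F x)) (\<lambda>i x. L (Fi i x))"
proof -
  obtain M where M: "\<And>i. maj \<rho> (\<lambda>h. Fi i (a + h)) (M i)" "M summable_on UNIV"
    using assms unfolding maj_series_def by auto
  obtain K where K: "0 \<le> K" "\<And>x. norm (L x) \<le> K * norm x"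
    using bounded_linear.nonneg_bounded[OF L] by (metis mult.commute)
  show ?thesis
    using F M K unfolding maj_series_def
    by (auto intro!: exI[of _ "\<lambda>i. K * M i"] maj_linear[OF _ L] summable_on_cmult_right
        has_sum_bounded_linear[OF L])
qed

lemma maj_series_cong:
  assumes F: "maj_series a \<rho> F Fi"
    and "\<And>h. h \<in> cube \<rho> \<Longrightarrow> G (a + h) = F (a + h)"
    and "\<And>i h. h \<in> cube \<rho> \<Longrightarrow> Gi i (a + h) = Fi i (a + h)"
  shows "maj_series a \<rho> G Gi"
proof -
  obtain M where M: "\<And>i. maj \<rho> (\<lambda>h. Fi i (a + h)) (M i)" "M summable_on UNIV"
    using assms unfolding maj_series_def by auto
  have "maj \<rho> (\<lambda>h. Gi i (a + h)) (M i)" for i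
    by (rule maj_cong[OF M(1)]) (use assms in auto)
  then show ?thesis
    using assms M unfolding maj_series_def by auto
qed

lemma maj_series_shift:
  assumes F: "maj_series a \<rho> F Fi" and zero: "\<And>i h. i < n \<Longrightarrow> h \<in> cube \<rho> \<Longrightarrow> Fi i (a + h) = 0"
  shows "maj_series a \<rho> F (\<lambda>i. Fi (i + n))"
proof -
  obtain M where M: "\<And>i. maj \<rho> (\<lambda>h. Fi i (a + h)) (M i)" "M summable_on UNIV"
    using assms unfolding maj_series_def by auto
  have bij: "bij_betw (\<lambda>i. i + n) UNIV {n..}"
    by (rule bij_betwI[where g = "\<lambda>i. i - n"]) auto
  have "M summable_on {n..}" by (rule summable_on_subset_banach[OF M(2)]) auto
  then have "(\<lambda>i. M (i + n)) summable_on UNIV"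
    using summable_on_reindex_bij_betw[OF bij, of M] by simp
  moreover have "((\<lambda>i. Fi (i + n) (a + h)) has_sum F (a + h)) UNIV" if h: "h \<in> cube \<rho>" for h
  proof -
    have "((\<lambda>i. Fi i (a + h)) has_sum F (a + h)) UNIV"
      using F h by (simp add: maj_series_def)
    then have "((\<lambda>i. Fi i (a + h)) has_sum F (a + h)) {n..}"
      by (subst (asm) has_sum_cong_neutral[where T = "{n..}" and g = "\<lambda>i. Fi i (a + h)"])
         (use zero h in auto)
    then show ?thesis
      using has_sum_reindex_bij_betw[OF bij, of "\<lambda>i. Fi i (a + h)"] by simp
  qed
  ultimately show ?thesis
    using F M unfolding maj_series_def by (auto intro!: exI[of _ "\<lambda>i. M (i + n)"])
qed

section \<open>Real analytic functions\<close>

text \<open>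
  In finite dimension unordered summability is absolute summability, since this holds for each
  component.
\<close>

lemma norm_summable_euclidean:
  fixes f :: "'i \<Rightarrow> 'b::euclidean_space"
  assumes "f summable_on A"
  shows "(\<lambda>k. norm (f k)) summable_on A"
proof -
  have comp: "(\<lambda>k. \<bar>f k \<bullet> i\<bar>) summable_on A" for i
  proof -
    have "(\<lambda>k. f k \<bullet> i) summable_on A"
      using summable_on_bounded_linear[OF bounded_linear_inner_left assms] .
    then show ?thesis
      using summable_on_iff_abs_summable_on_real by fastforce
  qed
  have "finite I \<Longrightarrow> (\<lambda>k. \<Sum>i\<in>I. \<bar>f k \<bullet> i\<bar>) summable_on A" for I
    by (induction I rule: finite_induct) (use comp in \<open>auto intro: summable_on_add\<close>)
  then have "(\<lambda>k. \<Sum>i\<in>Basis. \<bar>f k \<bullet> i\<bar>) summable_on A" by simp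
  then show ?thesis
    by (rule Infinite_Sum.abs_summable_on_comparison_test') (rule norm_le_l1)
qed

lemma norm_le_cube: "h \<in> cube \<rho> \<Longrightarrow> norm (h :: 'a::euclidean_space) \<le> real DIM('a) * \<rho>"
  using norm_le_l1[of h] sum_bounded_above[of Basis "\<lambda>b. \<bar>h \<bullet> b\<bar>" \<rho>] by (auto simp: cube_def)

lemma cball_subset_cube: "norm h \<le> \<rho> \<Longrightarrow> h \<in> cube \<rho>"
  unfolding cube_def using Basis_le_norm order_trans by blast

text \<open>
  At the corner \<open>(\<rho>, \<dots>, \<rho>)\<close> of the cube every monomial equals \<open>\<rho>\<^bsup>mdeg k\<^esup>\<close>. Convergence of the power series
  at this one point is therefore the finiteness of the majorant.
\<close>

lemma real_analytic_on_iff_maj: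
  fixes F :: "'a::euclidean_space \<Rightarrow> 'b::euclidean_space"
  shows "real_analytic_on F U \<longleftrightarrow> open U \<and> (\<forall>a\<in>U. \<exists>\<rho>>0. \<exists>M. maj \<rho> (\<lambda>h. F (a + h)) M)"
proof (intro iffI conjI ballI)
  assume F: "real_analytic_on F U"
  show "open U"
    unfolding open_contains_ball using F by (auto simp: real_analytic_on_def)
  fix a assume "a \<in> U"
  then obtain \<epsilon> c where \<epsilon>: "\<epsilon> > 0"
    and c: "\<And>x. x \<in> ball a \<epsilon> \<Longrightarrow> ((\<lambda>k. mpow (x - a) k *\<^sub>R c k) has_sum F x) multi_index"
    using F unfolding real_analytic_on_def mpow_def multi_index_def by blast
  define D where "D = real DIM('a)"
  have D: "D > 0" by (simp add: D_def)
  define \<rho> where "\<rho> = \<epsilon> / (2 * D)"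
  have \<rho>: "\<rho> > 0" "D * \<rho> < \<epsilon>" using \<epsilon> D by (auto simp: \<rho>_def)
  have ball: "a + h \<in> ball a \<epsilon>" if "h \<in> cube \<rho>" for h
    using norm_le_cube[OF that] \<rho> by (simp add: dist_norm D_def)
  define p where "p = (\<Sum>b\<in>Basis. \<rho> *\<^sub>R b :: 'a)"
  have pb: "p \<bullet> b = \<rho>" if "b \<in> Basis" for b
    using that by (simp add: p_def inner_sum_left inner_Basis if_distrib sum.delta cong: if_cong)
  have mp: "mpow p k = \<rho> ^ mdeg k" for k
    unfolding mpow_def mdeg_def power_sum by (intro prod.cong) (auto simp: pb)
  have "p \<in> cube \<rho>" using pb \<rho> by (simp add: cube_def)
  then have "(\<lambda>k. \<rho> ^ mdeg k *\<^sub>R c k) summable_on multi_index"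
    using c[OF ball, of p] mp by (auto simp: summable_on_def)
  then have "(\<lambda>k. norm (\<rho> ^ mdeg k *\<^sub>R c k)) summable_on multi_index"
    by (rule norm_summable_euclidean)
  then have "has_expansion \<rho> (\<lambda>h. F (a + h)) c"
    unfolding has_expansion_def using c[OF ball] \<rho> by auto
  then show "\<exists>\<rho>>0. \<exists>M. maj \<rho> (\<lambda>h. F (a + h)) M"
    using \<rho>(1) unfolding maj_def by blast
next
  assume R: "open U \<and> (\<forall>a\<in>U. \<exists>\<rho>>0. \<exists>M. maj \<rho> (\<lambda>h. F (a + h)) M)"
  show "real_analytic_on F U"
    unfolding real_analytic_on_def
  proof
    fix a assume a: "a \<in> U"
    obtain e where e: "e > 0" "ball a e \<subseteq> U" using R a openE by blast
    obtain \<rho> c where \<rho>: "\<rho> > 0" and c: "has_expansion \<rho> (\<lambda>h. F (a + h)) c"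
      using R a unfolding maj_def by blast
    have "((\<lambda>k. mpow (x - a) k *\<^sub>R c k) has_sum F x) multi_index" if "x \<in> ball a (min e \<rho>)" for x
    proof -
      have "x - a \<in> cube \<rho>"
        using that by (intro cball_subset_cube) (simp add: dist_norm norm_minus_commute)
      then show ?thesis using c by (fastforce simp: has_expansion_def)
    qed
    then show "\<exists>\<epsilon>>0. \<exists>c. ball a \<epsilon> \<subseteq> U \<and> (\<forall>x\<in>ball a \<epsilon>.
        ((\<lambda>k. (\<Prod>b\<in>Basis. ((x - a) \<bullet> b) ^ k b) *\<^sub>R c k) has_sum F x) {k. \<forall>b. b \<notin> Basis \<longrightarrow> k b = 0})"
      using e \<rho> unfolding mpow_def multi_index_def
      by (intro exI[of _ "min e \<rho>"] conjI exI[of _ c]) auto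
  qed
qed

lemma real_analytic_onI:
  fixes F :: "'a::euclidean_space \<Rightarrow> 'b::euclidean_space"
  assumes "open U" "\<And>a. a \<in> U \<Longrightarrow> \<exists>\<rho>>0. \<exists>M. maj \<rho> (\<lambda>h. F (a + h)) M"
  shows "real_analytic_on F U"
  using assms by (simp add: real_analytic_on_iff_maj)

lemma real_analytic_onE:
  fixes F :: "'a::euclidean_space \<Rightarrow> 'b::euclidean_space"
  assumes "real_analytic_on F U" "a \<in> U"
  obtains \<rho> M where "\<rho> > 0" "maj \<rho> (\<lambda>h. F (a + h)) M"
  using assms unfolding real_analytic_on_iff_maj by blast

lemma real_analytic_onE2:
  fixes F :: "'a::euclidean_space \<Rightarrow> 'b::euclidean_space" and G :: "'a \<Rightarrow> 'c::euclidean_space"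
  assumes F: "real_analytic_on F U" and G: "real_analytic_on G U" and a: "a \<in> U"
  obtains \<rho> M N where "\<rho> > 0" "maj \<rho> (\<lambda>h. F (a + h)) M" "maj \<rho> (\<lambda>h. G (a + h)) N"
proof -
  obtain \<rho>1 M where 1: "\<rho>1 > 0" "maj \<rho>1 (\<lambda>h. F (a + h)) M" using a by (rule real_analytic_onE[OF F])
  obtain \<rho>2 N where 2: "\<rho>2 > 0" "maj \<rho>2 (\<lambda>h. G (a + h)) N" using a by (rule real_analytic_onE[OF G])
  show thesis
    by (rule that[OF _ maj_smaller_cube[OF 1(2)] maj_smaller_cube[OF 2(2)], of "min \<rho>1 \<rho>2"]) (use 1 2 in auto)
qed

lemma real_analytic_on_open:
  fixes F :: "'a::euclidean_space \<Rightarrow> 'b::euclidean_space"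
  shows "real_analytic_on F U \<Longrightarrow> open U"
  by (simp add: real_analytic_on_iff_maj)

lemma real_analytic_on_cong:
  assumes "real_analytic_on F U" "\<And>x. x \<in> U \<Longrightarrow> G x = F x"
  shows "real_analytic_on G U"
  unfolding real_analytic_on_def
proof
  fix a assume "a \<in> U"
  then obtain \<epsilon> c where \<epsilon>: "\<epsilon> > 0" "ball a \<epsilon> \<subseteq> U" "\<forall>x\<in>ball a \<epsilon>.
      ((\<lambda>k. (\<Prod>b\<in>Basis. ((x - a) \<bullet> b) ^ k b) *\<^sub>R c k) has_sum F x) {k. \<forall>b. b \<notin> Basis \<longrightarrow> k b = 0}"
    using assms(1) unfolding real_analytic_on_def by blast
  moreover have "\<forall>x\<in>ball a \<epsilon>. G x = F x" using \<epsilon>(2) assms(2) by blast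
  ultimately show "\<exists>\<epsilon>>0. \<exists>c. ball a \<epsilon> \<subseteq> U \<and> (\<forall>x\<in>ball a \<epsilon>.
      ((\<lambda>k. (\<Prod>b\<in>Basis. ((x - a) \<bullet> b) ^ k b) *\<^sub>R c k) has_sum G x) {k. \<forall>b. b \<notin> Basis \<longrightarrow> k b = 0})"
    by (intro exI[of _ \<epsilon>] conjI exI[of _ c]) simp_all
qed

lemma real_analytic_on_const:
  "open U \<Longrightarrow> real_analytic_on (\<lambda>_ :: 'a::euclidean_space. c :: 'b::euclidean_space) U"
  by (intro real_analytic_onI exI[of _ 1] conjI exI[of _ "norm c"] maj_const) auto

lemma real_analytic_on_linear:
  fixes F :: "'a::euclidean_space \<Rightarrow> 'b::euclidean_space" and L :: "'b \<Rightarrow> 'c::euclidean_space"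
  assumes F: "real_analytic_on F U" and L: "bounded_linear L"
  shows "real_analytic_on (\<lambda>x. L (F x)) U"
proof (rule real_analytic_onI)
  show "open U" by (rule real_analytic_on_open[OF F])
  fix a assume "a \<in> U"
  then obtain \<rho> M where "\<rho> > 0" "maj \<rho> (\<lambda>h. F (a + h)) M"
    by (rule real_analytic_onE[OF F])
  moreover obtain K where "0 \<le> K" "\<And>x. norm (L x) \<le> K * norm x"
    using bounded_linear.nonneg_bounded[OF L] by (metis mult.commute)
  ultimately show "\<exists>\<rho>>0. \<exists>M. maj \<rho> (\<lambda>h. L (F (a + h))) M"
    using maj_linear[OF _ L] by blast
qed

lemma real_analytic_on_bilinear:
  fixes F :: "'a::euclidean_space \<Rightarrow> 'b::euclidean_space" and G :: "'a \<Rightarrow> 'c::euclidean_space"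
    and B :: "'b \<Rightarrow> 'c \<Rightarrow> 'd::euclidean_space"
  assumes B: "bounded_bilinear B" and F: "real_analytic_on F U" and G: "real_analytic_on G U"
  shows "real_analytic_on (\<lambda>x. B (F x) (G x)) U"
proof (rule real_analytic_onI)
  show "open U" by (rule real_analytic_on_open[OF F])
  fix a assume a: "a \<in> U"
  obtain \<rho> M N where \<rho>: "\<rho> > 0" and F': "maj \<rho> (\<lambda>h. F (a + h)) M" and G': "maj \<rho> (\<lambda>h. G (a + h)) N"
    using a by (rule real_analytic_onE2[OF F G])
  obtain K where K: "0 \<le> K" "\<And>x y. norm (B x y) \<le> norm x * norm y * K"
    using bounded_bilinear.nonneg_bounded[OF B] by blast
  have "norm (B x y) \<le> K * norm x * norm y" for x y
    using K(2)[of x y] by (simp add: mult_ac)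
  from maj_bilinear[OF \<rho> B this K(1) F' G']
  have "maj \<rho> (\<lambda>h. B (F (a + h)) (G (a + h))) (K * M * N)" .
  then show "\<exists>\<rho>>0. \<exists>M. maj \<rho> (\<lambda>h. B (F (a + h)) (G (a + h))) M"
    using \<rho> by blast
qed

lemma real_analytic_on_add:
  fixes F G :: "'a::euclidean_space \<Rightarrow> 'b::euclidean_space"
  assumes F: "real_analytic_on F U" and G: "real_analytic_on G U"
  shows "real_analytic_on (\<lambda>x. F x + G x) U"
proof (rule real_analytic_onI)
  show "open U" by (rule real_analytic_on_open[OF F])
  fix a assume a: "a \<in> U"
  obtain \<rho> M N where \<rho>: "\<rho> > 0" and F': "maj \<rho> (\<lambda>h. F (a + h)) M" and G': "maj \<rho> (\<lambda>h. G (a + h)) N"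
    using a by (rule real_analytic_onE2[OF F G])
  show "\<exists>\<rho>>0. \<exists>M. maj \<rho> (\<lambda>h. F (a + h) + G (a + h)) M"
    using \<rho> maj_add[OF \<rho> F' G'] by blast
qed

lemma real_analytic_on_scaleR:
  fixes F :: "'a::euclidean_space \<Rightarrow> 'b::euclidean_space"
  shows "real_analytic_on F U \<Longrightarrow> real_analytic_on (\<lambda>x. r *\<^sub>R F x) U"
  by (rule real_analytic_on_linear[OF _ bounded_linear_scaleR_right])

lemma real_analytic_on_diff:
  fixes F G :: "'a::euclidean_space \<Rightarrow> 'b::euclidean_space"
  assumes F: "real_analytic_on F U" and G: "real_analytic_on G U"
  shows "real_analytic_on (\<lambda>x. F x - G x) U"
  using real_analytic_on_add[OF F real_analytic_on_scaleR[OF G, of "-1"]] by simp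

lemma real_analytic_on_sum:
  fixes F :: "'i \<Rightarrow> 'a::euclidean_space \<Rightarrow> 'b::euclidean_space"
  assumes "finite I" "open U" "\<And>i. i \<in> I \<Longrightarrow> real_analytic_on (F i) U"
  shows "real_analytic_on (\<lambda>x. \<Sum>i\<in>I. F i x) U"
  using assms(1,3)
  by induction (simp_all add: real_analytic_on_const real_analytic_on_add assms(2))

lemma maj_bounded_linear:
  fixes L :: "'a::euclidean_space \<Rightarrow> 'b::euclidean_space"
  assumes L: "bounded_linear L" and \<rho>: "\<rho> > 0"
  shows "maj \<rho> L (\<Sum>b\<in>Basis. \<rho> * norm (L b))"
proof -
  have "maj \<rho> (\<lambda>h. (h \<bullet> b) *\<^sub>R L b) (1 * \<rho> * norm (L b))" if "b \<in> Basis" for b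
    by (rule maj_bilinear[OF \<rho> bounded_bilinear_scaleR _ _ maj_coord[OF \<rho> that] maj_const[OF \<rho>]]) auto
  then have "maj \<rho> (\<lambda>h. \<Sum>b\<in>Basis. (h \<bullet> b) *\<^sub>R L b) (\<Sum>b\<in>Basis. \<rho> * norm (L b))"
    by (intro maj_sum[OF \<rho>]) auto
  moreover have "(\<Sum>b\<in>Basis. (h \<bullet> b) *\<^sub>R L b) = L h" for h
  proof -
    interpret L: bounded_linear L by fact
    have "L h = L (\<Sum>b\<in>Basis. (h \<bullet> b) *\<^sub>R b)" by (simp only: euclidean_representation)
    then show ?thesis by (simp only: L.sum L.scaleR)
  qed
  ultimately show ?thesis by simp
qed

lemma real_analytic_on_bounded_linear:
  fixes L :: "'a::euclidean_space \<Rightarrow> 'b::euclidean_space"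
  assumes L: "bounded_linear L" and "open U"
  shows "real_analytic_on L U"
proof (rule real_analytic_onI[OF \<open>open U\<close>])
  fix a
  have "maj 1 (\<lambda>h. L a + L h) (norm (L a) + (\<Sum>b\<in>Basis. 1 * norm (L b)))"
    by (rule maj_add[OF _ maj_const maj_bounded_linear[OF L]]) auto
  moreover have "(\<lambda>h. L (a + h)) = (\<lambda>h. L a + L h)"
    by (simp add: bounded_linear.linear[OF L] linear_add)
  ultimately show "\<exists>\<rho>>0. \<exists>M. maj \<rho> (\<lambda>h. L (a + h)) M"
    by (intro exI[of _ 1]) auto
qed

lemma maj_small:
  assumes F: "maj \<rho> F M" and F0: "F 0 = 0" and "\<rho> > 0" "\<epsilon> > 0"
  obtains \<rho>' where "\<rho>' > 0" "\<And>\<rho>''. 0 < \<rho>'' \<Longrightarrow> \<rho>'' \<le> \<rho>' \<Longrightarrow> maj \<rho>'' F \<epsilon>"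
proof
  have M: "0 \<le> M" using maj_nonneg[OF F] assms by simp
  show "min \<rho> (\<rho> * \<epsilon> / (M + 1)) > 0" using assms M by auto
  fix \<rho>'' assume r: "0 < \<rho>''" "\<rho>'' \<le> min \<rho> (\<rho> * \<epsilon> / (M + 1))"
  then have "\<rho>'' * (M + 1) \<le> \<rho> * \<epsilon>" using M by (simp add: pos_le_divide_eq)
  then have "M * \<rho>'' \<le> \<rho> * \<epsilon>" using r by (simp add: algebra_simps)
  then have "M * (\<rho>'' / \<rho>) \<le> \<epsilon>" using assms by (simp add: field_simps)
  then show "maj \<rho>'' F \<epsilon>"
    using maj_vanishing[OF F F0 r(1)] r maj_mono by auto
qed

text \<open>
  The components of \<open>g - g p\<close> vanish at \<open>p\<close>, so on a small cube their majorants are below the radius of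
  the expansion of the outer function.
\<close>

lemma real_analytic_on_compose:
  fixes F :: "'a::euclidean_space \<Rightarrow> 'b::euclidean_space" and g :: "'c::euclidean_space \<Rightarrow> 'a"
  assumes F: "real_analytic_on F U" and g: "real_analytic_on g T" and sub: "g ` T \<subseteq> U"
  shows "real_analytic_on (\<lambda>x. F (g x)) T"
proof (rule real_analytic_onI)
  show "open T" by (rule real_analytic_on_open[OF g])
  fix p assume p: "p \<in> T"
  have "g p \<in> U" using sub p by blast
  then obtain \<rho> M where \<rho>: "\<rho> > 0" and M: "maj \<rho> (\<lambda>h. F (g p + h)) M"
    by (rule real_analytic_onE[OF F])
  have "\<exists>\<rho>'>0. \<forall>\<rho>''. 0 < \<rho>'' \<longrightarrow> \<rho>'' \<le> \<rho>' \<longrightarrow> maj \<rho>'' (\<lambda>h. (g (p + h) - g p) \<bullet> b) \<rho>" for b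
  proof -
    have "real_analytic_on (\<lambda>x. (g x - g p) \<bullet> b) T"
      by (rule real_analytic_on_linear[OF real_analytic_on_diff[OF g real_analytic_on_const] bounded_linear_inner_left])
         (rule real_analytic_on_open[OF g])
    then obtain r N where "r > 0" "maj r (\<lambda>h. (g (p + h) - g p) \<bullet> b) N"
      using p by (rule real_analytic_onE)
    from maj_small[OF this(2) _ this(1) \<rho>]
    obtain \<rho>' where "\<rho>' > 0" "\<And>\<rho>''. 0 < \<rho>'' \<Longrightarrow> \<rho>'' \<le> \<rho>' \<Longrightarrow> maj \<rho>'' (\<lambda>h. (g (p + h) - g p) \<bullet> b) \<rho>"
      by auto
    then show ?thesis by blast
  qed
  then obtain r where r: "\<And>b. r b > 0"
      "\<And>b \<rho>''. 0 < \<rho>'' \<Longrightarrow> \<rho>'' \<le> r b \<Longrightarrow> maj \<rho>'' (\<lambda>h. (g (p + h) - g p) \<bullet> b) \<rho>"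
    by metis
  define \<rho>' where "\<rho>' = Min (r ` Basis)"
  have \<rho>': "\<rho>' > 0" "\<And>b. b \<in> Basis \<Longrightarrow> \<rho>' \<le> r b"
    using r(1) by (auto simp: \<rho>'_def)
  have "maj \<rho>' (\<lambda>h. F (g p + (g (p + h) - g p))) M"
    by (rule maj_compose[OF M \<rho>'(1) \<rho> r(2)[OF \<rho>'(1) \<rho>'(2)]])
  then show "\<exists>\<rho>>0. \<exists>M. maj \<rho> (\<lambda>h. F (g (p + h))) M"
    using \<rho>'(1) by auto
qed

lemma real_analytic_on_dir_deriv:
  fixes F :: "'a::euclidean_space \<Rightarrow> 'b::euclidean_space"
  assumes F: "real_analytic_on F U" and b: "b \<in> Basis"
  shows "real_analytic_on (dir_deriv b F) U"
proof (rule real_analytic_onI)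
  show "open U" by (rule real_analytic_on_open[OF F])
  fix a assume "a \<in> U"
  then obtain \<rho> M where \<rho>: "\<rho> > 0" and M: "maj \<rho> (\<lambda>h. F (a + h)) M"
    by (rule real_analytic_onE[OF F])
  have "maj (\<rho> - \<rho> / 2) (dir_deriv b (\<lambda>h. F (a + h))) (M / (\<rho> / 2))"
    by (rule maj_dir_deriv(1)[OF M _ _ b]) (use \<rho> in auto)
  moreover have "dir_deriv b (\<lambda>h. F (a + h)) = (\<lambda>h. dir_deriv b F (a + h))"
    by (rule ext) (rule dir_deriv_shift)
  ultimately show "\<exists>\<rho>>0. \<exists>M. maj \<rho> (\<lambda>h. dir_deriv b F (a + h)) M"
    using \<rho> by (intro exI[of _ "\<rho> - \<rho> / 2"]) auto
qed

lemma real_analytic_on_has_vector_derivative: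
  fixes F :: "'a::euclidean_space \<Rightarrow> 'b::euclidean_space"
  assumes F: "real_analytic_on F U" and b: "b \<in> Basis" and "a \<in> U"
  shows "((\<lambda>t. F (a + t *\<^sub>R b)) has_vector_derivative dir_deriv b F a) (at 0)"
proof -
  obtain \<rho> M where \<rho>: "\<rho> > 0" and M: "maj \<rho> (\<lambda>h. F (a + h)) M"
    using \<open>a \<in> U\<close> by (rule real_analytic_onE[OF F])
  have *: "0 < \<rho> / 2" "\<rho> / 2 < \<rho>" using \<rho> by auto
  show ?thesis
  proof (rule dir_deriv_quadratic(1)[OF *(1)])
    fix t :: real assume t: "\<bar>t\<bar> \<le> \<rho> / 2"
    have "norm (F (a + (0 + t *\<^sub>R b)) - F (a + 0) - t *\<^sub>R dir_deriv b (\<lambda>h. F (a + h)) 0) \<le> (t / (\<rho> / 2))\<^sup>2 * M"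
      by (rule maj_dir_deriv(2)[OF M * b zero_in_cube t]) (use \<rho> in auto)
    then show "norm (F (a + t *\<^sub>R b) - F a - t *\<^sub>R dir_deriv b F a) \<le> (M / (\<rho> / 2)\<^sup>2) * t\<^sup>2"
      by (simp add: dir_deriv_shift power_divide mult_ac)
  qed
qed

lemma real_analytic_on_imp_continuous_on:
  fixes F :: "'a::euclidean_space \<Rightarrow> 'b::euclidean_space"
  assumes F: "real_analytic_on F U"
  shows "continuous_on U F"
  unfolding continuous_on_iff
proof (intro ballI allI impI)
  fix a and e :: real assume a: "a \<in> U" and e: "e > 0"
  have "real_analytic_on (\<lambda>x. F x - F a) U"
    by (intro real_analytic_on_diff F real_analytic_on_const real_analytic_on_open[OF F])
  then obtain \<rho> M where \<rho>: "\<rho> > 0" "maj \<rho> (\<lambda>h. F (a + h) - F a) M"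
    using a by (rule real_analytic_onE)
  obtain \<rho>' where \<rho>': "\<rho>' > 0" "maj \<rho>' (\<lambda>h. F (a + h) - F a) (e / 2)"
    using maj_small[OF \<rho>(2) _ \<rho>(1), of "e / 2"] e by auto
  have "dist (F x) (F a) < e" if "dist x a < \<rho>'" for x
  proof -
    have "x - a \<in> cube \<rho>'"
      using that by (intro cball_subset_cube) (simp add: dist_norm)
    from maj_bound[OF \<rho>'(2) this] show ?thesis using e by (simp add: dist_norm)
  qed
  then show "\<exists>d>0. \<forall>x'\<in>U. dist x' a < d \<longrightarrow> dist (F x') (F a) < e"
    using \<rho>'(1) by blast
qed

text \<open>
  A complex power series becomes a real one in two variables by majorizing \<open>h\<^sup>n\<close>, where the identity
  \<open>h = Re h + \<i> Im h\<close> has majorant \<open>2 \<rho>\<close>.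
\<close>

lemma real_analytic_on_holomorphic:
  assumes f: "f holomorphic_on W" and W: "open W"
  shows "real_analytic_on f W"
proof (rule real_analytic_onI[OF W])
  fix a assume "a \<in> W"
  then obtain r where r: "r > 0" "ball a r \<subseteq> W" using W openE by blast
  define c where "c = (\<lambda>n. (deriv ^^ n) f a / fact n)"
  have ps: "(\<lambda>n. c n * (z - a) ^ n) sums f z" if "z \<in> ball a r" for z
    unfolding c_def by (rule holomorphic_power_series[OF holomorphic_on_subset[OF f r(2)] that])
  define \<rho> where "\<rho> = r / 8"
  have \<rho>: "\<rho> > 0" using r by (simp add: \<rho>_def)
  have id: "maj \<rho> (\<lambda>h :: complex. h) (2 * \<rho>)"
    using maj_bounded_linear[of "\<lambda>h :: complex. h", OF bounded_linear_ident \<rho>]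
    by (simp add: Basis_complex_def)
  have m: "maj \<rho> (\<lambda>h. c n * h ^ n) (norm (c n) * (2 * \<rho>) ^ n)" for n
    using maj_bilinear[OF \<rho> bounded_bilinear_mult, of 1, OF _ _ maj_const[OF \<rho>] maj_power[OF \<rho> id]]
    by (simp add: norm_mult)
  have abs: "summable (\<lambda>n. norm (c n * z ^ n))" if "norm z < r / 2" for z
  proof -
    have "a + of_real (r / 2) \<in> ball a r" using r by (simp add: dist_norm)
    from ps[OF this] have "summable (\<lambda>n. c n * of_real (r / 2) ^ n)"
      by (auto simp: sums_iff)
    then show ?thesis by (rule powser_insidea) (use that r in simp)
  qed
  have "(\<lambda>n. norm (c n) * (2 * \<rho>) ^ n) summable_on UNIV"
  proof -
    have "summable (\<lambda>n. norm (c n * of_real (2 * \<rho>) ^ n))"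
      by (rule abs) (use r in \<open>simp add: \<rho>_def\<close>)
    then have "summable (\<lambda>n. norm (c n) * (2 * \<rho>) ^ n)"
      using \<rho> by (simp add: norm_mult norm_power)
    then show ?thesis by (rule summable_nonneg_imp_summable_on) (use \<rho> in simp)
  qed
  then have "maj \<rho> (\<lambda>h. f (a + h)) (\<Sum>\<^sub>\<infinity>n. norm (c n) * (2 * \<rho>) ^ n)"
  proof (rule maj_has_sum[OF \<rho> m])
    fix h :: complex assume "h \<in> cube \<rho>"
    then have h: "norm h \<le> 2 * \<rho>" using norm_le_cube[of h \<rho>] by simp
    show "((\<lambda>n. c n * h ^ n) has_sum f (a + h)) UNIV"
    proof (rule norm_summable_imp_has_sum[OF abs])
      show "norm h < r / 2" using h \<rho> by (simp add: \<rho>_def)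
      show "(\<lambda>n. c n * h ^ n) sums f (a + h)"
        using ps[of "a + h"] h r by (simp add: dist_norm \<rho>_def)
    qed
  qed
  then show "\<exists>\<rho>>0. \<exists>M. maj \<rho> (\<lambda>h. f (a + h)) M" using \<rho> by blast
qed

lemma dir_deriv_cong:
  assumes "open U" "x \<in> U" "\<And>y. y \<in> U \<Longrightarrow> F y = G y"
  shows "dir_deriv b F x = dir_deriv b G x"
proof -
  have "isCont (\<lambda>t. x + t *\<^sub>R b) (0::real)"
    by (intro continuous_intros)
  then have "((\<lambda>t. x + t *\<^sub>R b) \<longlongrightarrow> x + 0 *\<^sub>R b) (nhds (0::real))"
    by (simp add: continuous_within tendsto_nhds_iff)
  then have "\<forall>\<^sub>F t in nhds (0::real). x + t *\<^sub>R b \<in> U"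
    using assms(1,2) by (simp add: tendsto_def)
  then have "\<forall>\<^sub>F t in nhds (0::real). F (x + t *\<^sub>R b) = G (x + t *\<^sub>R b)"
    by eventually_elim (rule assms(3))
  then show ?thesis
    unfolding dir_deriv_def by (intro vector_derivative_cong_eq) simp_all
qed

text \<open>
  Up to a positive factor, a coefficient of degree \<open>n + 1\<close> is a coefficient of degree \<open>n\<close> of a
  derivative. The constant coefficient is the value at the centre.
\<close>

lemma expansion_zero_of_flat:
  assumes "has_expansion \<rho> (\<lambda>h. F (a + h)) c" "\<rho> > 0"
    and "\<And>bs. set bs \<subseteq> Basis \<Longrightarrow> foldr dir_deriv bs F a = 0"
    and "k \<in> multi_index" "mdeg k = n"
  shows "c k = 0"
  using assms
proof (induction n arbitrary: \<rho> F c k)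
  case 0
  then have "k = (\<lambda>_. 0)" by (auto simp: mdeg_def multi_index_def fun_eq_iff)
  then show ?case using has_expansion_at_zero[OF 0(1)] 0(2) 0(3)[of "[]"] by simp
next
  case (Suc n)
  then obtain b where b: "b \<in> Basis" "k b > 0"
    by (metis gr0I mdeg_def nat.distinct(1) sum.neutral)
  define k' where "k' = k(b := k b - 1)"
  have kk: "raise_index b k' = k" using b by (auto simp: k'_def raise_index_def)
  have k': "k' \<in> multi_index" "mdeg k' = n"
    using Suc.prems(4,5) mdeg_raise_index[OF b(1), of k'] b
    by (auto simp: kk) (auto simp: k'_def multi_index_def)
  have "has_expansion (\<rho> - \<rho> / 2) (dir_deriv b (\<lambda>h. F (a + h))) (coeff_deriv b c)"
    by (rule has_expansion_dir_deriv(1)[OF Suc.prems(1) _ _ b(1)]) (use Suc.prems in auto)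
  then have "has_expansion (\<rho> / 2) (\<lambda>h. dir_deriv b F (a + h)) (coeff_deriv b c)"
    by (simp add: dir_deriv_shift[abs_def])
  then have "coeff_deriv b c k' = 0"
  proof (rule Suc.IH)
    fix bs :: "'a list" assume "set bs \<subseteq> Basis"
    then show "foldr dir_deriv bs (dir_deriv b F) a = 0"
      using Suc.prems(3)[of "bs @ [b]"] b by simp
  qed (use Suc.prems k' in auto)
  then show ?case by (simp add: coeff_deriv_def kk)
qed

lemma real_analytic_on_iterated_deriv:
  fixes F :: "'a::euclidean_space \<Rightarrow> 'b::euclidean_space"
  assumes "real_analytic_on F U" "set bs \<subseteq> Basis"
  shows "real_analytic_on (foldr dir_deriv bs F) U"
  using assms(2) by (induction bs) (auto intro: assms(1) real_analytic_on_dir_deriv)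

lemma iterated_deriv_zero:
  assumes "open U" "\<And>x. x \<in> U \<Longrightarrow> F x = 0" "x \<in> U"
  shows "foldr dir_deriv bs F x = 0"
  using assms(3)
proof (induction bs arbitrary: x)
  case (Cons b bs)
  have "dir_deriv b (foldr dir_deriv bs F) x = dir_deriv b (\<lambda>_. 0) x"
    by (rule dir_deriv_cong[OF assms(1) Cons.prems Cons.IH])
  moreover have "dir_deriv b (\<lambda>_. 0) x = 0" by (simp add: dir_deriv_def)
  ultimately show ?case by simp
qed (use assms in auto)

text \<open>
  The set of points where all iterated derivatives vanish is closed because these derivatives are
  continuous, and open because the power series at such a point is zero.
\<close>

theorem real_analytic_identity:
  fixes F :: "'a::euclidean_space \<Rightarrow> 'b::euclidean_space"
  assumes F: "real_analytic_on F U" and U: "connected U"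
    and S: "open S" "S \<subseteq> U" "S \<noteq> {}" "\<And>x. x \<in> S \<Longrightarrow> F x = 0" and x: "x \<in> U"
  shows "F x = 0"
proof -
  define Z where "Z = {x\<in>U. \<forall>bs. set bs \<subseteq> Basis \<longrightarrow> foldr dir_deriv bs F x = 0}"
  have "open U" by (rule real_analytic_on_open[OF F])
  have op: "open Z"
    unfolding open_contains_ball
  proof
    fix a assume a: "a \<in> Z"
    then have aU: "a \<in> U" by (simp add: Z_def)
    obtain e where e: "e > 0" "ball a e \<subseteq> U" using \<open>open U\<close> aU openE by blast
    obtain \<rho> c where \<rho>: "\<rho> > 0" and c: "has_expansion \<rho> (\<lambda>h. F (a + h)) c"
      using aU by (rule real_analytic_onE[OF F]) (auto simp: maj_def)
    have c0: "c k = 0" if "k \<in> multi_index" for k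
      using expansion_zero_of_flat[OF c \<rho> _ that refl] a by (simp add: Z_def)
    have F0: "F y = 0" if "y \<in> ball a (min e \<rho>)" for y
    proof -
      have "y - a \<in> cube \<rho>"
        using that by (intro cball_subset_cube) (simp add: dist_norm norm_minus_commute)
      then have "((\<lambda>k. mpow (y - a) k *\<^sub>R c k) has_sum F (a + (y - a))) multi_index"
        using c unfolding has_expansion_def by blast
      then have "((\<lambda>k. 0) has_sum F (a + (y - a))) (multi_index :: ('a \<Rightarrow> nat) set)"
        by (subst (asm) has_sum_cong[where g = "\<lambda>_. 0"]) (simp_all add: c0)
      from has_sum_unique[OF this has_sum_0_simp] show ?thesis by simp
    qed
    have "ball a (min e \<rho>) \<subseteq> Z"
    proof
      fix y assume y: "y \<in> ball a (min e \<rho>)"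
      then have "y \<in> U" using e by auto
      with iterated_deriv_zero[OF open_ball F0 y] show "y \<in> Z" by (simp add: Z_def)
    qed
    then show "\<exists>e>0. ball a e \<subseteq> Z" using e \<rho> by (intro exI[of _ "min e \<rho>"]) auto
  qed
  have cl: "closedin (top_of_set U) Z"
  proof -
    let ?L = "{bs :: 'a list. set bs \<subseteq> Basis}"
    have ne: "[] \<in> ?L" by simp
    have "closedin (top_of_set U) {x\<in>U. foldr dir_deriv bs F x = 0}" if "bs \<in> ?L" for bs
      using that real_analytic_on_iterated_deriv[OF F, of bs]
      by (intro continuous_closedin_preimage_constant real_analytic_on_imp_continuous_on) simp
    then have "closedin (top_of_set U) (\<Inter>bs\<in>?L. {x\<in>U. foldr dir_deriv bs F x = 0})"
      using ne by (intro closedin_INT) blast+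
    moreover have "(\<Inter>bs\<in>?L. {x\<in>U. foldr dir_deriv bs F x = 0}) = Z"
    proof -
      have "(\<Inter>bs\<in>?L. {x\<in>U. foldr dir_deriv bs F x = 0}) = {x. \<forall>bs\<in>?L. x \<in> U \<and> foldr dir_deriv bs F x = 0}"
        by blast
      also have "\<dots> = Z" unfolding Z_def using ne by blast
      finally show ?thesis .
    qed
    ultimately show ?thesis by simp
  qed
  have "openin (top_of_set U) Z"
    using op by (simp add: openin_open_eq \<open>open U\<close> Z_def)
  with cl have "Z = {} \<or> Z = U"
    using U connected_clopen by blast
  moreover have "S \<subseteq> Z"
  proof
    fix y assume "y \<in> S"
    with iterated_deriv_zero[OF S(1,4) this] S(2) show "y \<in> Z" by (auto simp: Z_def)
  qed
  ultimately have "x \<in> Z" using S x by blast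
  then have "set [] \<subseteq> (Basis :: 'a set) \<longrightarrow> foldr dir_deriv [] F x = 0"
    unfolding Z_def by blast
  then show ?thesis by simp
qed

section \<open>Powers of a vector in the Clifford algebra\<close>

lemma bounded_bilinear_clifford_mult:
  "bounded_bilinear ((*) :: 'n::{finite,linorder} clifford \<Rightarrow> 'n clifford \<Rightarrow> 'n clifford)"
proof -
  have "bilinear ((*) :: 'n clifford \<Rightarrow> 'n clifford \<Rightarrow> 'n clifford)"
    by (auto simp: bilinear_def linear_iff algebra_simps)
  then show ?thesis by (simp add: bilinear_conv_bounded_bilinear)
qed

lemma bounded_linear_clifford_mult_right:
  "bounded_linear (\<lambda>x :: 'n::{finite,linorder} clifford. c * x)"
  by (rule bounded_bilinear.bounded_linear_right[OF bounded_bilinear_clifford_mult])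

lemma bounded_linear_clifford_mult_left:
  "bounded_linear (\<lambda>x :: 'n::{finite,linorder} clifford. x * c)"
  by (rule bounded_bilinear.bounded_linear_left[OF bounded_bilinear_clifford_mult])

lemma linear_vect: "linear (vect :: real ^ 'n \<Rightarrow> 'n::finite clifford)"
  by (auto simp: linear_iff vect_def scaleR_left_distrib sum.distrib scaleR_sum_right)

lemma bounded_linear_vect: "bounded_linear (vect :: real ^ 'n \<Rightarrow> 'n::finite clifford)"
  by (rule linear_conv_bounded_linear[THEN iffD1, OF linear_vect])

lemma vect_add: "vect (v + w) = vect v + vect w"
  by (rule linear_add[OF linear_vect])

lemma vect_scaleR: "vect (r *\<^sub>R v) = r *\<^sub>R vect v"
  by (rule linear_scale[OF linear_vect])

lemma vect_zero [simp]: "vect 0 = 0"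
  by (rule linear_0[OF linear_vect])

lemma vect_uminus: "vect (- v) = - vect v"
  by (rule linear_neg[OF linear_vect])

lemma vect_axis: "vect (axis l 1) = gen l"
proof -
  have "(axis l 1 $ j) *\<^sub>R gen j = (if j = l then gen l else 0)" for j
    by (simp add: axis_def)
  then show ?thesis by (simp add: vect_def)
qed

text \<open>
  Adding the double sum to its transpose turns the products of generators into anticommutators.
\<close>

lemma vect_square:
  fixes v :: "real ^ 'n::{finite,linorder}"
  shows "vect v * vect v = of_real (- (v \<bullet> v))"
proof -
  let ?p = "\<lambda>j l. (v $ j * v $ l) *\<^sub>R (gen j * gen l :: 'n clifford)"
  have vv: "vect v * vect v = (\<Sum>j\<in>UNIV. \<Sum>l\<in>UNIV. ?p j l)"
    by (simp add: vect_def sum_product mult.commute)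
  have "2 *\<^sub>R (vect v * vect v) = (\<Sum>j\<in>UNIV. \<Sum>l\<in>UNIV. ?p j l) + (\<Sum>l\<in>UNIV. \<Sum>j\<in>UNIV. ?p j l)"
    unfolding vv using sum.swap[of ?p UNIV UNIV] by (simp add: scaleR_2)
  also have "\<dots> = (\<Sum>j\<in>UNIV. \<Sum>l\<in>UNIV. (v $ j * v $ l) *\<^sub>R (gen j * gen l + gen l * gen j))"
    by (simp add: sum.distrib scaleR_right_distrib mult.commute)
  also have "\<dots> = (\<Sum>j\<in>UNIV. \<Sum>l\<in>UNIV. if l = j then (- 2 * (v $ j * v $ j)) *\<^sub>R 1 else 0)"
  proof (intro sum.cong refl)
    fix j l :: 'n
    have "(- 2 :: 'n clifford) = (- 2) *\<^sub>R 1"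
      by (metis of_real_def of_real_minus of_real_numeral)
    then have "x *\<^sub>R (- 2 :: 'n clifford) = (- 2 * x) *\<^sub>R 1" for x
      by (simp only: scaleR_scaleR mult.commute)
    then show "(v $ j * v $ l) *\<^sub>R (gen j * gen l + gen l * gen j :: 'n clifford)
        = (if l = j then (- 2 * (v $ j * v $ j)) *\<^sub>R 1 else 0)"
      unfolding gen_anticommute by (cases "j = l") auto
  qed
  also have "\<dots> = (\<Sum>j\<in>UNIV. (- 2 * (v $ j * v $ j)) *\<^sub>R 1)" by simp
  also have "\<dots> = (\<Sum>j\<in>UNIV. - 2 * (v $ j * v $ j)) *\<^sub>R 1" by (simp only: scaleR_sum_left)
  also have "\<dots> = 2 *\<^sub>R of_real (- (v \<bullet> v))"
    by (simp add: inner_vec_def of_real_def sum_negf sum_distrib_left)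
  finally have "2 *\<^sub>R (vect v * vect v) = 2 *\<^sub>R of_real (- (v \<bullet> v))" .
  then show ?thesis unfolding scaleR_cancel_left by simp
qed

lemma gen_square: "gen l * gen l = - (1 :: 'n::{finite,linorder} clifford)"
  using vect_square[of "axis l 1"] by (simp add: vect_axis inner_axis_axis)

text \<open>
  The first and second partial derivatives of \<open>v\<^sup>j\<close> in the direction of the generator \<open>l\<close>, computed from
  \<open>v\<^bsup>2i\<^esup> = (-\<bar>v\<bar>\<^sup>2)\<^sup>i\<close> and \<open>v\<^bsup>2i+1\<^esup> = (-\<bar>v\<bar>\<^sup>2)\<^sup>i v\<close>. For \<open>i < 2\<close> the truncated exponents are harmless, because
  the numerical factors in front of the powers vanish.
\<close>

definition vect_pow1 :: "'n::{finite,linorder} \<Rightarrow> nat \<Rightarrow> (real, 'n) vec \<Rightarrow> 'n clifford" where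
  "vect_pow1 l j v = (let i = j div 2; Q = - (v \<bullet> v); D = - 2 * real i * v $ l * Q ^ (i - 1) in
     if even j then D *\<^sub>R 1 else Q ^ i *\<^sub>R gen l + D *\<^sub>R vect v)"

definition vect_pow2 :: "'n::{finite,linorder} \<Rightarrow> nat \<Rightarrow> (real, 'n) vec \<Rightarrow> 'n clifford" where
  "vect_pow2 l j v = (let i = j div 2; Q = - (v \<bullet> v); D = - 2 * real i * v $ l * Q ^ (i - 1);
       E = 4 * real i * real (i - 1) * (v $ l)\<^sup>2 * Q ^ (i - 2) - 2 * real i * Q ^ (i - 1) in
     if even j then E *\<^sub>R 1 else (2 * D) *\<^sub>R gen l + E *\<^sub>R vect v)"

lemma vect_pow1_even:
    "vect_pow1 l (2 * i) v = (- 2 * real i * v $ l * (- (v \<bullet> v)) ^ (i - 1)) *\<^sub>R 1"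
  and vect_pow1_odd:
    "vect_pow1 l (Suc (2 * i)) v = (- (v \<bullet> v)) ^ i *\<^sub>R gen l
       + (- 2 * real i * v $ l * (- (v \<bullet> v)) ^ (i - 1)) *\<^sub>R vect v"
  by (simp_all add: vect_pow1_def Let_def)

lemma vect_pow2_even:
    "vect_pow2 l (2 * i) v = (4 * real i * real (i - 1) * (v $ l)\<^sup>2 * (- (v \<bullet> v)) ^ (i - 2)
       - 2 * real i * (- (v \<bullet> v)) ^ (i - 1)) *\<^sub>R 1"
  and vect_pow2_odd:
    "vect_pow2 l (Suc (2 * i)) v = (2 * (- 2 * real i * v $ l * (- (v \<bullet> v)) ^ (i - 1))) *\<^sub>R gen l
       + (4 * real i * real (i - 1) * (v $ l)\<^sup>2 * (- (v \<bullet> v)) ^ (i - 2)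
          - 2 * real i * (- (v \<bullet> v)) ^ (i - 1)) *\<^sub>R vect v"
  by (simp_all add: vect_pow2_def Let_def)

lemma vect_pow_even: "vect v ^ (2 * i) = (- (v \<bullet> v)) ^ i *\<^sub>R 1"
  by (simp only: power_mult power2_eq_square vect_square of_real_power[symmetric]) (simp only: of_real_def)

lemma vect_pow_odd: "vect v ^ (Suc (2 * i)) = (- (v \<bullet> v)) ^ i *\<^sub>R vect v"
  by (simp only: power_Suc2 vect_pow_even) simp

lemma quadratic_on_line:
  fixes v :: "real ^ 'n"
  shows "((v + t *\<^sub>R axis l 1) \<bullet> (v + t *\<^sub>R axis l 1)) = v \<bullet> v + 2 * t * v $ l + t\<^sup>2"
  by (simp add: inner_add_left inner_add_right inner_axis inner_axis' algebra_simps power2_eq_square inner_axis_axis)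

lemma vect_pow_has_derivative:
  fixes v :: "real ^ 'n::{finite,linorder}"
  shows "((\<lambda>t. vect (v + t *\<^sub>R axis l 1) ^ j) has_vector_derivative vect_pow1 l j v) (at 0)"
proof -
  define i where "i = j div 2"
  have Q: "((\<lambda>t. (- ((v + t *\<^sub>R axis l 1) \<bullet> (v + t *\<^sub>R axis l 1))) ^ i) has_real_derivative
      - 2 * real i * v $ l * (- (v \<bullet> v)) ^ (i - 1)) (at 0)"
    unfolding quadratic_on_line by (auto intro!: derivative_eq_intros)
  show ?thesis
  proof (cases "even j")
    case True
    then have j: "j = 2 * i" by (simp add: i_def)
    show ?thesis
      unfolding j vect_pow_even vect_pow1_even
      using has_vector_derivative_scaleR[OF Q has_vector_derivative_const] by simp
  next
    case False
    then have j: "j = Suc (2 * i)" by (simp add: i_def)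
    have "((\<lambda>t. vect (v + t *\<^sub>R axis l 1)) has_vector_derivative gen l) (at 0)"
      unfolding vect_add vect_scaleR vect_axis by (auto intro!: derivative_eq_intros)
    from has_vector_derivative_scaleR[OF Q this] show ?thesis
      unfolding j vect_pow_odd vect_pow1_odd by simp
  qed
qed

lemma vect_pow1_has_derivative:
  fixes v :: "real ^ 'n::{finite,linorder}"
  shows "((\<lambda>t. vect_pow1 l j (v + t *\<^sub>R axis l 1)) has_vector_derivative vect_pow2 l j v) (at 0)"
proof -
  define i where "i = j div 2"
  let ?w = "\<lambda>t. v + t *\<^sub>R axis l 1"
  have Q: "((\<lambda>t. (- (?w t \<bullet> ?w t)) ^ i) has_real_derivative
      - 2 * real i * v $ l * (- (v \<bullet> v)) ^ (i - 1)) (at 0)"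
    unfolding quadratic_on_line by (auto intro!: derivative_eq_intros)
  have wl: "?w t $ l = v $ l + t" for t by simp
  have D: "((\<lambda>t. - 2 * real i * ?w t $ l * (- (?w t \<bullet> ?w t)) ^ (i - 1)) has_real_derivative
      4 * real i * real (i - 1) * (v $ l)\<^sup>2 * (- (v \<bullet> v)) ^ (i - 2) - 2 * real i * (- (v \<bullet> v)) ^ (i - 1)) (at 0)"
    unfolding quadratic_on_line wl
    by (auto intro!: derivative_eq_intros simp: power2_eq_square numeral_2_eq_2 algebra_simps)
  have V: "((\<lambda>t. vect (?w t)) has_vector_derivative gen l) (at 0)"
    unfolding vect_add vect_scaleR vect_axis by (auto intro!: derivative_eq_intros)
  show ?thesis
  proof (cases "even j")
    case True
    then have j: "j = 2 * i" by (simp add: i_def)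
    show ?thesis
      unfolding j vect_pow1_even vect_pow2_even
      using has_vector_derivative_scaleR[OF D has_vector_derivative_const] by simp
  next
    case False
    then have j: "j = Suc (2 * i)" by (simp add: i_def)
    have "((\<lambda>t. (- (?w t \<bullet> ?w t)) ^ i *\<^sub>R gen l
          + (- 2 * real i * ?w t $ l * (- (?w t \<bullet> ?w t)) ^ (i - 1)) *\<^sub>R vect (?w t))
        has_vector_derivative
          ((- (?w 0 \<bullet> ?w 0)) ^ i *\<^sub>R 0 + (- 2 * real i * v $ l * (- (v \<bullet> v)) ^ (i - 1)) *\<^sub>R gen l)
          + ((- 2 * real i * ?w 0 $ l * (- (?w 0 \<bullet> ?w 0)) ^ (i - 1)) *\<^sub>R gen l
            + (4 * real i * real (i - 1) * (v $ l)\<^sup>2 * (- (v \<bullet> v)) ^ (i - 2) - 2 * real i * (- (v \<bullet> v)) ^ (i - 1))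
                *\<^sub>R vect (?w 0))) (at 0)"
      by (intro has_vector_derivative_add has_vector_derivative_scaleR Q D V has_vector_derivative_const)
    moreover have "((- (?w 0 \<bullet> ?w 0)) ^ i *\<^sub>R 0 + (- 2 * real i * v $ l * (- (v \<bullet> v)) ^ (i - 1)) *\<^sub>R gen l)
          + ((- 2 * real i * ?w 0 $ l * (- (?w 0 \<bullet> ?w 0)) ^ (i - 1)) *\<^sub>R gen l
            + (4 * real i * real (i - 1) * (v $ l)\<^sup>2 * (- (v \<bullet> v)) ^ (i - 2) - 2 * real i * (- (v \<bullet> v)) ^ (i - 1))
                *\<^sub>R vect (?w 0)) = vect_pow2 l j v"
    proof -
      have *: "(2 * x) *\<^sub>R gen l = x *\<^sub>R gen l + x *\<^sub>R gen l" for x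
        by (simp flip: scaleR_left_distrib)
      show ?thesis unfolding j vect_pow2_odd * by simp
    qed
    ultimately show ?thesis unfolding j vect_pow1_odd by simp
  qed
qed

text \<open>
  The numbers for which \<open>\<Delta> v\<^sup>j = - lap_factor m j v\<^bsup>j-2\<^esup>\<close> and
  \<open>\<Sum> e\<^sub>l \<partial>\<^sub>l v\<^sup>j = - dirac_factor m j v\<^bsup>j-1\<^esup>\<close>.
\<close>

definition lap_factor :: "nat \<Rightarrow> nat \<Rightarrow> real" where
  "lap_factor m j = (let p = real (2 * (j div 2)) in p * (if even j then p + m - 2 else p + m))"

definition dirac_factor :: "nat \<Rightarrow> nat \<Rightarrow> real" where
  "dirac_factor m j = (if even j then real j else real (j - 1) + m)"

lemma sum_component_squares: "(\<Sum>l\<in>UNIV. (v $ l)\<^sup>2) = v \<bullet> (v :: real ^ 'n::finite)"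
  by (simp add: inner_vec_def power2_eq_square)

lemma sum_vect_pow2:
  fixes v :: "real ^ 'n::{finite,linorder}"
  shows "(\<Sum>l\<in>UNIV. vect_pow2 l j v) = - lap_factor CARD('n) j *\<^sub>R vect v ^ (j - 2)"
proof -
  define i where "i = j div 2"
  define Q where "Q = - (v \<bullet> v)"
  let ?m = "real CARD('n)"
  let ?E = "\<lambda>l. 4 * real i * real (i - 1) * (v $ l)\<^sup>2 * Q ^ (i - 2) - 2 * real i * Q ^ (i - 1)"
  let ?D = "\<lambda>l. - 2 * real i * v $ l * Q ^ (i - 1)"
  have E: "(\<Sum>l\<in>UNIV. ?E l) = - (2 * real i * (2 * real i + ?m - 2)) * Q ^ (i - 1)"
  proof -
    have "(\<Sum>l\<in>UNIV. ?E l) = 4 * real i * real (i - 1) * (\<Sum>l\<in>UNIV. (v $ l)\<^sup>2) * Q ^ (i - 2) - 2 * real i * ?m * Q ^ (i - 1)"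
      by (simp add: sum_subtractf sum_distrib_left sum_distrib_right)
    also have "\<dots> = - 4 * real i * real (i - 1) * (Q * Q ^ (i - 2)) - 2 * real i * ?m * Q ^ (i - 1)"
      by (simp add: sum_component_squares Q_def)
    also have "\<dots> = - (2 * real i * (2 * real i + ?m - 2)) * Q ^ (i - 1)"
    proof (cases "i \<le> 1")
      case True
      then have "i = 0 \<or> i = 1" by linarith
      then show ?thesis by (auto simp: algebra_simps)
    next
      case False
      then obtain i' where "i = Suc (Suc i')" by (metis One_nat_def not_less_eq_eq old.nat.exhaust zero_le)
      then show ?thesis by (simp add: algebra_simps)
    qed
    finally show ?thesis .
  qed
  have D: "(\<Sum>l\<in>UNIV. ?D l *\<^sub>R gen l) = (- 2 * real i * Q ^ (i - 1)) *\<^sub>R vect v"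
    by (simp add: vect_def scaleR_sum_right mult_ac)
  show ?thesis
  proof (cases "even j")
    case True
    then have j: "j = 2 * i" by (simp add: i_def)
    have "(\<Sum>l\<in>UNIV. vect_pow2 l j v) = (\<Sum>l\<in>UNIV. ?E l) *\<^sub>R 1"
      by (simp only: vect_pow2_even j Q_def scaleR_sum_left)
    also have "\<dots> = - lap_factor CARD('n) j *\<^sub>R vect v ^ (2 * (i - 1))"
      unfolding E vect_pow_even by (simp add: lap_factor_def j Q_def Let_def)
    finally show ?thesis by (simp add: j right_diff_distrib')
  next
    case False
    then have j: "j = Suc (2 * i)" by (simp add: i_def)
    have "(\<Sum>l\<in>UNIV. vect_pow2 l j v) = 2 *\<^sub>R (\<Sum>l\<in>UNIV. ?D l *\<^sub>R gen l) + (\<Sum>l\<in>UNIV. ?E l) *\<^sub>R vect v"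
      by (simp only: vect_pow2_odd j Q_def scaleR_sum_left scaleR_sum_right sum.distrib scaleR_scaleR)
    also have "\<dots> = (- (2 * real i * (2 * real i + ?m)) * Q ^ (i - 1)) *\<^sub>R vect v"
      unfolding E D by (simp add: algebra_simps flip: scaleR_left_distrib scaleR_left_diff_distrib)
    also have "\<dots> = - lap_factor CARD('n) j *\<^sub>R vect v ^ (j - 2)"
    proof (cases i)
      case 0
      then show ?thesis by (simp add: lap_factor_def j)
    next
      case (Suc i')
      then have "j - 2 = Suc (2 * (i - 1))" by (simp add: j)
      then show ?thesis by (simp only: vect_pow_odd) (simp add: lap_factor_def j Q_def Let_def)
    qed
    finally show ?thesis .
  qed
qed

lemma sum_gen_square: "(\<Sum>l\<in>UNIV. gen l * gen l) = - real CARD('n) *\<^sub>R (1 :: 'n::{finite,linorder} clifford)"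
  by (simp add: gen_square sum_negf scaleR_conv_of_real)

lemma sum_gen_vect_pow1:
  fixes v :: "real ^ 'n::{finite,linorder}"
  shows "(\<Sum>l\<in>UNIV. gen l * vect_pow1 l j v) = - dirac_factor CARD('n) j *\<^sub>R vect v ^ (j - 1)"
proof -
  define i where "i = j div 2"
  define Q where "Q = - (v \<bullet> v)"
  let ?D = "\<lambda>l. - 2 * real i * v $ l * Q ^ (i - 1)"
  have D: "(\<Sum>l\<in>UNIV. ?D l *\<^sub>R gen l) = (- 2 * real i * Q ^ (i - 1)) *\<^sub>R vect v"
    by (simp add: vect_def scaleR_sum_right mult_ac)
  show ?thesis
  proof (cases "even j")
    case True
    then have j: "j = 2 * i" by (simp add: i_def)
    have "(\<Sum>l\<in>UNIV. gen l * vect_pow1 l j v) = (\<Sum>l\<in>UNIV. ?D l *\<^sub>R gen l)"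
      by (simp only: vect_pow1_even j Q_def) simp
    also have "\<dots> = - dirac_factor CARD('n) j *\<^sub>R vect v ^ (j - 1)"
    proof (cases i)
      case 0
      then show ?thesis unfolding D by (simp add: dirac_factor_def j)
    next
      case (Suc i')
      then have "j - 1 = Suc (2 * (i - 1))" by (simp add: j)
      then show ?thesis unfolding D by (simp only: vect_pow_odd) (simp add: dirac_factor_def j Q_def)
    qed
    finally show ?thesis .
  next
    case False
    then have j: "j = Suc (2 * i)" by (simp add: i_def)
    have "(\<Sum>l\<in>UNIV. gen l * vect_pow1 l j v)
        = Q ^ i *\<^sub>R (\<Sum>l\<in>UNIV. gen l * gen l) + (\<Sum>l\<in>UNIV. ?D l *\<^sub>R gen l) * vect v"
      by (simp only: vect_pow1_odd j Q_def scaleR_sum_right sum.distrib sum_distrib_right distrib_left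
          mult_scaleR_left mult_scaleR_right)
    also have "\<dots> = (- real CARD('n) * Q ^ i - 2 * real i * (Q ^ (i - 1) * Q)) *\<^sub>R 1"
      unfolding sum_gen_square D
      by (simp add: vect_square Q_def of_real_def scaleR_left_diff_distrib scaleR_left_distrib mult_ac)
    also have "\<dots> = (- (2 * real i + real CARD('n)) * Q ^ i) *\<^sub>R 1"
      by (cases i) (auto simp: algebra_simps)
    also have "\<dots> = - dirac_factor CARD('n) j *\<^sub>R vect v ^ (j - 1)"
      by (simp add: j vect_pow_even dirac_factor_def Q_def)
    finally show ?thesis .
  qed
qed

lemma Basis_paravector:
  "(Basis :: ('n::finite) paravector set) = insert (1, 0) (range (\<lambda>l. (0, axis l 1)))"
  by (auto simp: Basis_prod_def Basis_vec_def)

lemma laplacian_paravector: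
  fixes F :: "('n::finite) paravector \<Rightarrow> 'b::real_normed_vector"
  shows "laplacian F x = dir_deriv (1, 0) (dir_deriv (1, 0) F) x
     + (\<Sum>l\<in>UNIV. dir_deriv (0, axis l 1) (dir_deriv (0, axis l 1) F) x)"
proof -
  have inj: "inj (\<lambda>l :: 'n. (0 :: real, axis l (1::real)))"
    by (auto simp: inj_def axis_eq_axis)
  show ?thesis
    unfolding laplacian_def Basis_paravector
    by (subst sum.insert) (auto simp: sum.reindex[OF inj] axis_eq_axis)
qed

section \<open>Series in powers of the vector variable\<close>

definition vect_term :: "(real \<Rightarrow> 'n::{finite,linorder} clifford) \<Rightarrow> nat \<Rightarrow> 'n paravector \<Rightarrow> 'n clifford" where
  "vect_term g j x = vect (snd x) ^ j * g (fst x)"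

text \<open>
  Near the real point \<open>t\<close> the function is the series \<open>\<Sum> v\<^sup>j f\<^sub>j(x\<^sub>0)\<close> in the vector variable, normally
  convergent. Both the Laplacian and the Dirac operator act on such series through their coefficients.
\<close>

definition vect_series ::
    "real \<Rightarrow> real \<Rightarrow> ('n::{finite,linorder} paravector \<Rightarrow> 'n clifford) \<Rightarrow> (nat \<Rightarrow> real \<Rightarrow> 'n clifford) \<Rightarrow> bool" where
  "vect_series t \<rho> F f \<longleftrightarrow> maj_series (t, 0) \<rho> F (\<lambda>j. vect_term (f j) j)"

lemma in_cube_paravector:
  "(h0, v) \<in> (cube \<rho> :: ('n::finite) paravector set) \<longleftrightarrow> \<bar>h0\<bar> \<le> \<rho> \<and> (\<forall>l. \<bar>v $ l\<bar> \<le> \<rho>)"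
  by (simp add: cube_def Basis_paravector inner_axis)

lemma small_cube_paravector:
  assumes "e > 0"
  obtains \<rho> where "\<rho> > 0"
    "\<And>h0 v. (h0, v) \<in> (cube \<rho> :: ('n::finite) paravector set) \<Longrightarrow> \<bar>h0\<bar> < e \<and> norm v < e"
proof -
  define d where "d = real DIM('n paravector)"
  have d: "d > 0" by (simp add: d_def)
  show thesis
  proof (rule that)
    show "e / (2 * d) > 0" using assms d by simp
    fix h0 :: real and v :: "(real, 'n) vec" assume "(h0, v) \<in> cube (e / (2 * d))"
    then have "norm (h0, v) \<le> d * (e / (2 * d))" unfolding d_def by (rule norm_le_cube)
    also have "\<dots> = e / 2" using d by simp
    finally show "\<bar>h0\<bar> < e \<and> norm v < e"
      using norm_fst_le[of h0 v] norm_snd_le[of v h0] assms by auto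
  qed
qed

lemma dir_deriv_vect_term_real:
  fixes g :: "real \<Rightarrow> 'n::{finite,linorder} clifford"
  assumes "(g has_vector_derivative g') (at (fst x))"
  shows "dir_deriv (1, 0) (vect_term g j) x = vect (snd x) ^ j * g'"
proof -
  have "((\<lambda>t. fst x + t) has_vector_derivative 1) (at 0)"
    by (auto intro!: derivative_eq_intros simp flip: has_real_derivative_iff_has_vector_derivative)
  then have "((\<lambda>t. g (fst x + t)) has_vector_derivative g') (at 0)"
    using vector_diff_chain_at[of "\<lambda>t. fst x + t" 1 0 g g'] assms by (simp add: o_def)
  then have "((\<lambda>t. vect (snd x) ^ j * g (fst x + t)) has_vector_derivative vect (snd x) ^ j * g') (at 0)"
    by (rule bounded_linear.has_vector_derivative[OF bounded_linear_clifford_mult_right])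
  then show ?thesis
    unfolding dir_deriv_def vect_term_def by (intro vector_derivative_at) simp
qed

lemma dir_deriv_vect_term_axis:
  fixes g :: "real \<Rightarrow> 'n::{finite,linorder} clifford"
  shows "dir_deriv (0, axis l 1) (vect_term g j) x = vect_pow1 l j (snd x) * g (fst x)"
  unfolding dir_deriv_def vect_term_def
  by (intro vector_derivative_at)
     (use bounded_linear.has_vector_derivative[OF bounded_linear_clifford_mult_left vect_pow_has_derivative] in simp)

lemma dir_deriv2_vect_term_axis:
  fixes g :: "real \<Rightarrow> 'n::{finite,linorder} clifford"
  shows "dir_deriv (0, axis l 1) (dir_deriv (0, axis l 1) (vect_term g j)) x = vect_pow2 l j (snd x) * g (fst x)"
  unfolding dir_deriv_vect_term_axis[abs_def] unfolding dir_deriv_def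
  by (intro vector_derivative_at)
     (use bounded_linear.has_vector_derivative[OF bounded_linear_clifford_mult_left vect_pow1_has_derivative] in simp)

lemma basis_paravector_mem [simp]:
  "(1, 0) \<in> (Basis :: ('n::finite) paravector set)" "(0, axis l 1) \<in> (Basis :: ('n::finite) paravector set)"
  by (auto simp: Basis_paravector)

text \<open>
  The second derivative in \<open>x\<^sub>0\<close> acts on the coefficients, and the Laplacian in \<open>v\<close> lowers the power of
  \<open>v\<close> by two. The two lowest terms are annihilated, so the second series can be shifted.
\<close>

lemma vect_series_laplacian:
  fixes F :: "'n::{finite,linorder} paravector \<Rightarrow> 'n clifford"
  assumes F: "vect_series t \<rho> F f" and R: "open R" "{t - \<rho>..t + \<rho>} \<subseteq> R"
    and f': "\<And>j s. s \<in> R \<Longrightarrow> (f j has_vector_derivative f' j s) (at s)"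
    and f'': "\<And>j s. s \<in> R \<Longrightarrow> (f' j has_vector_derivative f'' j s) (at s)"
    and \<rho>': "0 < \<rho>'" "\<rho>' < \<rho>"
  shows "vect_series t \<rho>' (laplacian F)
           (\<lambda>j s. f'' j s - lap_factor CARD('n) (j + 2) *\<^sub>R f (j + 2) s)"
proof -
  let ?Fj = "\<lambda>j. vect_term (f j) j"
  define \<rho>1 where "\<rho>1 = (\<rho> + \<rho>') / 2"
  have \<rho>1: "0 < \<rho>1" "\<rho>1 < \<rho>" "\<rho>' < \<rho>1" using \<rho>' by (auto simp: \<rho>1_def)
  have D2: "maj_series (t, 0) \<rho>' (dir_deriv b (dir_deriv b F)) (\<lambda>j. dir_deriv b (dir_deriv b (?Fj j)))"
    if "b \<in> Basis" for b
    by (rule maj_series_dir_deriv[OF maj_series_dir_deriv[OF F[unfolded vect_series_def] \<rho>1(1,2) that]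
          \<rho>'(1) \<rho>1(3) that])
  have inR: "fst ((t, 0) + h) \<in> R" if "h \<in> cube \<rho>'" for h :: "'n paravector"
    using that R(2) \<rho>' by (cases h) (auto simp: in_cube_paravector abs_le_iff)
  have "maj_series (t, 0) \<rho>' (dir_deriv (1, 0) (dir_deriv (1, 0) F)) (\<lambda>j. vect_term (f'' j) j)"
  proof (rule maj_series_cong[OF D2])
    fix j and h :: "'n paravector" assume h: "h \<in> cube \<rho>'"
    let ?U = "R \<times> (UNIV :: (real, 'n) vec set)"
    have "dir_deriv (1, 0) (dir_deriv (1, 0) (?Fj j)) ((t, 0) + h) = dir_deriv (1, 0) (vect_term (f' j) j) ((t, 0) + h)"
    proof (rule dir_deriv_cong[of ?U])
      show "open ?U" using R(1) by (intro open_Times open_UNIV)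
      show "(t, 0) + h \<in> ?U" using inR[OF h] by (cases h) auto
      fix y assume "y \<in> ?U"
      then show "dir_deriv (1, 0) (?Fj j) y = vect_term (f' j) j y"
        using dir_deriv_vect_term_real[OF f'[of "fst y" j]] by (auto simp: vect_term_def)
    qed
    also have "\<dots> = vect_term (f'' j) j ((t, 0) + h)"
      using dir_deriv_vect_term_real[OF f''[OF inR[OF h]]] by (simp only: vect_term_def)
    finally show "vect_term (f'' j) j ((t, 0) + h) = dir_deriv (1, 0) (dir_deriv (1, 0) (?Fj j)) ((t, 0) + h)"
      by simp
  qed simp_all
  moreover have "maj_series (t, 0) \<rho>' (\<lambda>x. \<Sum>l\<in>UNIV. dir_deriv (0, axis l 1) (dir_deriv (0, axis l 1) F) x)
      (\<lambda>j. vect_term (\<lambda>s. - lap_factor CARD('n) (j + 2) *\<^sub>R f (j + 2) s) j)"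
  proof -
    have eq: "(\<Sum>l\<in>UNIV. dir_deriv (0, axis l 1) (dir_deriv (0, axis l 1) (?Fj j)) x)
        = vect (snd x) ^ (j - 2) * (- lap_factor CARD('n) j *\<^sub>R f j (fst x))" for j x
      unfolding dir_deriv2_vect_term_axis sum_distrib_right[symmetric] sum_vect_pow2 by simp
    have "maj_series (t, 0) \<rho>' (\<lambda>x. \<Sum>l\<in>UNIV. dir_deriv (0, axis l 1) (dir_deriv (0, axis l 1) F) x)
       (\<lambda>j x. \<Sum>l\<in>UNIV. dir_deriv (0, axis l 1) (dir_deriv (0, axis l 1) (?Fj j)) x)"
      by (rule maj_series_sum[OF \<rho>'(1)]) (auto intro: D2)
    from maj_series_shift[OF this, of 2] show ?thesis
      unfolding eq by (simp add: lap_factor_def vect_term_def[abs_def] less_2_cases_iff)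
         
  qed
  ultimately have "maj_series (t, 0) \<rho>' (\<lambda>x. dir_deriv (1, 0) (dir_deriv (1, 0) F) x
       + (\<Sum>l\<in>UNIV. dir_deriv (0, axis l 1) (dir_deriv (0, axis l 1) F) x))
     (\<lambda>j x. vect_term (f'' j) j x + vect_term (\<lambda>s. - lap_factor CARD('n) (j + 2) *\<^sub>R f (j + 2) s) j x)"
    by (rule maj_series_add)
  then show ?thesis
    unfolding vect_series_def
    by (rule maj_series_cong) (simp_all add: laplacian_paravector vect_term_def algebra_simps)
qed

lemma vect_series_dirac:
  fixes F :: "'n::{finite,linorder} paravector \<Rightarrow> 'n clifford"
  assumes F: "vect_series t \<rho> F f" and R: "{t - \<rho>..t + \<rho>} \<subseteq> R"
    and f': "\<And>j s. s \<in> R \<Longrightarrow> (f j has_vector_derivative f' j s) (at s)"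
    and \<rho>': "0 < \<rho>'" "\<rho>' < \<rho>"
  shows "vect_series t \<rho>' (dirac_op F)
           (\<lambda>j s. f' j s - dirac_factor CARD('n) (j + 1) *\<^sub>R f (j + 1) s)"
proof -
  let ?Fj = "\<lambda>j. vect_term (f j) j"
  have D: "maj_series (t, 0) \<rho>' (dir_deriv b F) (\<lambda>j. dir_deriv b (?Fj j))" if "b \<in> Basis" for b
    by (rule maj_series_dir_deriv[OF F[unfolded vect_series_def] \<rho>' that])
  have inR: "fst ((t, 0) + h) \<in> R" if "h \<in> cube \<rho>'" for h :: "'n paravector"
    using that R \<rho>' by (cases h) (auto simp: in_cube_paravector abs_le_iff)
  have "maj_series (t, 0) \<rho>' (dir_deriv (1, 0) F) (\<lambda>j. vect_term (f' j) j)"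
  proof (rule maj_series_cong[OF D])
    fix j and h :: "'n paravector" assume h: "h \<in> cube \<rho>'"
    show "vect_term (f' j) j ((t, 0) + h) = dir_deriv (1, 0) (?Fj j) ((t, 0) + h)"
      using dir_deriv_vect_term_real[OF f'[OF inR[OF h]]] by (simp only: vect_term_def)
  qed simp_all
  moreover have "maj_series (t, 0) \<rho>' (\<lambda>x. \<Sum>l\<in>UNIV. gen l * dir_deriv (0, axis l 1) F x)
      (\<lambda>j. vect_term (\<lambda>s. - dirac_factor CARD('n) (j + 1) *\<^sub>R f (j + 1) s) j)"
  proof -
    have eq: "(\<Sum>l\<in>UNIV. gen l * dir_deriv (0, axis l 1) (?Fj j) x)
        = vect (snd x) ^ (j - 1) * (- dirac_factor CARD('n) j *\<^sub>R f j (fst x))" for j x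
      unfolding dir_deriv_vect_term_axis mult.assoc[symmetric] sum_distrib_right[symmetric] sum_gen_vect_pow1
      by simp
    have "maj_series (t, 0) \<rho>' (\<lambda>x. \<Sum>l\<in>UNIV. gen l * dir_deriv (0, axis l 1) F x)
       (\<lambda>j x. \<Sum>l\<in>UNIV. gen l * dir_deriv (0, axis l 1) (?Fj j) x)"
      by (rule maj_series_sum[OF \<rho>'(1)])
         (auto intro: maj_series_linear[OF D bounded_linear_clifford_mult_right])
    from maj_series_shift[OF this, of 1] show ?thesis
      unfolding eq by (simp add: dirac_factor_def vect_term_def[abs_def])
  qed
  ultimately have "maj_series (t, 0) \<rho>' (\<lambda>x. dir_deriv (1, 0) F x + (\<Sum>l\<in>UNIV. gen l * dir_deriv (0, axis l 1) F x))
     (\<lambda>j x. vect_term (f' j) j x + vect_term (\<lambda>s. - dirac_factor CARD('n) (j + 1) *\<^sub>R f (j + 1) s) j x)"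
    by (rule maj_series_add)
  then show ?thesis
    unfolding vect_series_def
    by (rule maj_series_cong) (simp_all add: dirac_op_def vect_term_def algebra_simps)
qed

lemma power_series_zero:
  fixes x :: "nat \<Rightarrow> 'b::euclidean_space"
  assumes "\<rho> > 0" and sums: "\<And>r. \<bar>r\<bar> < \<rho> \<Longrightarrow> (\<lambda>j. r ^ j *\<^sub>R x j) sums 0"
  shows "x j = 0"
proof (rule euclidean_eqI)
  fix b :: 'b assume "b \<in> Basis"
  define a where "a = (\<lambda>j. x j \<bullet> b)"
  have s: "(\<lambda>j. a j * (r - 0) ^ j) sums 0" if "norm (r - 0) < \<rho>" for r
    using bounded_linear.sums[OF bounded_linear_inner_left[of b] sums[of r]] that
    by (simp add: a_def mult.commute)
  have "a j = 0"
  proof (cases "j = 0")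
    case True
    then show ?thesis using s[of 0] \<open>\<rho> > 0\<close> by simp
  next
    case False
    show ?thesis
    proof (rule ccontr)
      assume "a j \<noteq> 0"
      from powser_0_nonzero[OF \<open>\<rho> > 0\<close> s refl this] False
      obtain \<epsilon> where "0 < \<epsilon>" "\<And>z. z \<in> cball 0 \<epsilon> - {0::real} \<Longrightarrow> (0::real) \<noteq> 0"
        by auto
      from this(2)[of \<epsilon>] this(1) show False by simp
    qed
  qed
  then show "x j \<bullet> b = 0 \<bullet> b" by (simp add: a_def)
qed

lemma vect_series_sums:
  fixes F :: "'n::{finite,linorder} paravector \<Rightarrow> 'n clifford"
  assumes "vect_series t \<rho> F f" "(s - t, v) \<in> (cube \<rho> :: 'n paravector set)"
  shows "(\<lambda>j. vect v ^ j * f j s) sums F (s, v)"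
proof -
  have "((\<lambda>j. vect_term (f j) j ((t, 0) + (s - t, v))) has_sum F ((t, 0) + (s - t, v))) UNIV"
    using assms unfolding vect_series_def maj_series_def by blast
  then show ?thesis by (auto simp: vect_term_def dest: has_sum_imp_sums)
qed

lemma vect_series_at_axis:
  fixes a :: "nat \<Rightarrow> 'n::{finite,linorder} clifford"
  shows "(\<lambda>j. vect 0 ^ j * a j) sums a 0"
proof -
  have "vect 0 ^ j * a j = 0" if "j \<notin> {0}" for j using that by (cases j) auto
  from sums_finite[of "{0}" "\<lambda>j. vect 0 ^ j * a j", OF _ this] show ?thesis by simp
qed

lemma power_of_scaleR: "(r *\<^sub>R x) ^ n = r ^ n *\<^sub>R x ^ n" for x :: "'a::real_algebra_1"
  by (induction n) (simp_all add: mult_ac)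

lemma gen_power_cancel:
  assumes "gen l ^ j * x = 0" shows "x = (0 :: 'n::{finite,linorder} clifford)"
proof -
  have c: "y = 0" if "gen l * y = 0" for y :: "'n clifford"
  proof -
    have "- y = (gen l * gen l) * y" by (simp add: gen_square)
    also have "\<dots> = gen l * (gen l * y)" by (simp only: mult.assoc)
    finally show ?thesis using that by simp
  qed
  show ?thesis using assms by (induction j) (simp_all add: mult.assoc c)
qed

text \<open>
  Along \<open>v = r e\<^sub>l\<close> the series is an ordinary power series in \<open>r\<close> with coefficients \<open>e\<^sub>l\<^sup>j f\<^sub>j(s)\<close>, and
  \<open>e\<^sub>l\<close> is invertible.
\<close>

lemma vect_series_zero:
  fixes F :: "'n::{finite,linorder} paravector \<Rightarrow> 'n clifford"
  assumes F: "vect_series t \<rho> F f" and "\<rho> > 0"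
    and zero: "\<And>h. h \<in> cube \<rho> \<Longrightarrow> F ((t, 0) + h) = 0" and s: "\<bar>s - t\<bar> \<le> \<rho>"
  shows "f j s = 0"
proof -
  obtain l :: 'n where True by blast
  have "gen l ^ j * f j s = 0"
  proof (rule power_series_zero[OF \<open>\<rho> > 0\<close>])
    fix r :: real assume "\<bar>r\<bar> < \<rho>"
    then have h: "(s - t, r *\<^sub>R axis l 1) \<in> (cube \<rho> :: 'n paravector set)"
      using s \<open>\<rho> > 0\<close> by (auto simp: in_cube_paravector axis_def)
    have "F (s, r *\<^sub>R axis l 1) = 0" using zero[OF h] by simp
    with vect_series_sums[OF F h] show "(\<lambda>j. r ^ j *\<^sub>R (gen l ^ j * f j s)) sums 0"
      by (simp add: vect_scaleR vect_axis power_of_scaleR)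
  qed
  then show ?thesis by (rule gen_power_cancel)
qed

definition plane_index :: "nat \<Rightarrow> nat \<Rightarrow> complex \<Rightarrow> nat" where
  "plane_index i j = (\<lambda>b. if b = 1 then i else if b = \<i> then j else 0)"

lemma bij_plane_index: "bij_betw (\<lambda>(j, i). plane_index i j) (UNIV \<times> UNIV) multi_index"
  by (rule bij_betwI[where g = "\<lambda>k. (k \<i>, k 1)"])
     (auto simp: multi_index_def plane_index_def Basis_complex_def fun_eq_iff)

lemma mdeg_plane_index: "mdeg (plane_index i j) = i + j"
  by (simp add: mdeg_def plane_index_def Basis_complex_def)

lemma mpow_plane_index: "mpow (Complex s r) (plane_index i j) = s ^ i * r ^ j"
  by (simp add: mpow_def plane_index_def Basis_complex_def)

text \<open>
  The monomials \<open>s\<^sup>i r\<^sup>j\<close> of a two-variable expansion are collected by the power of \<open>r\<close>. The coefficients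
  are then functions of \<open>s\<close> whose majorants are of order \<open>\<rho>\<^bsup>-j\<^esup>\<close>.
\<close>

lemma maj_slices:
  fixes \<Phi> :: "complex \<Rightarrow> 'b::banach"
  assumes \<Phi>: "maj \<rho> \<Phi> M" and \<rho>: "\<rho> > 0"
  obtains \<psi> N where "\<And>j. maj \<rho> (\<psi> j :: real \<Rightarrow> 'b) (N j)" "(\<lambda>j. N j * \<rho> ^ j) summable_on UNIV"
    "\<And>s r. \<bar>s\<bar> \<le> \<rho> \<Longrightarrow> \<bar>r\<bar> \<le> \<rho> \<Longrightarrow> ((\<lambda>j. r ^ j *\<^sub>R \<psi> j s) has_sum \<Phi> (Complex s r)) UNIV"
proof -
  obtain c where c: "has_expansion \<rho> \<Phi> c" using \<Phi> unfolding maj_def by blast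
  define D where "D = (\<lambda>j i. c (plane_index i j))"
  define N where "N = (\<lambda>j. \<Sum>\<^sub>\<infinity>i. \<rho> ^ i * norm (D j i))"
  define \<psi> where "\<psi> = (\<lambda>j (s::real). \<Sum>\<^sub>\<infinity>i. s ^ i *\<^sub>R D j i)"
  have W: "(\<lambda>(j, i). \<rho> ^ (i + j) * norm (D j i)) summable_on UNIV \<times> UNIV"
  proof -
    have "(\<lambda>k. \<rho> ^ mdeg k * norm (c k)) summable_on multi_index"
      using c by (simp add: has_expansion_def)
    then show ?thesis
      using summable_on_reindex_bij_betw[OF bij_plane_index, of "\<lambda>k. \<rho> ^ mdeg k * norm (c k)"]
      by (simp add: case_prod_unfold mdeg_plane_index D_def)
  qed
  have inner: "(\<lambda>i. \<rho> ^ i * norm (D j i)) summable_on UNIV" for j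
  proof -
    have "(\<lambda>i. \<rho> ^ j * (\<rho> ^ i * norm (D j i))) summable_on UNIV"
      using summable_on_SigmaD1[OF W, of j] by (simp add: power_add mult_ac)
    then show ?thesis using \<rho> by (subst (asm) summable_on_cmult_right') auto
  qed
  have N: "(\<lambda>j. N j * \<rho> ^ j) summable_on UNIV"
  proof -
    have "(\<lambda>j. \<Sum>\<^sub>\<infinity>i. \<rho> ^ (i + j) * norm (D j i)) summable_on UNIV"
      using summable_on_Sigma_banach[OF W] by simp
    moreover have "(\<Sum>\<^sub>\<infinity>i. \<rho> ^ (i + j) * norm (D j i)) = N j * \<rho> ^ j" for j
      unfolding N_def infsum_cmult_left'[symmetric] by (simp add: power_add mult_ac)
    ultimately show ?thesis by simp
  qed
  have \<psi>: "((\<lambda>i. s ^ i *\<^sub>R D j i) has_sum \<psi> j s) UNIV" if "\<bar>s\<bar> \<le> \<rho>" for j s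
  proof -
    have "(\<lambda>i. s ^ i *\<^sub>R D j i) summable_on UNIV"
      by (rule abs_summable_summable, rule Infinite_Sum.abs_summable_on_comparison_test'[OF inner])
         (use that in \<open>auto simp: power_abs intro!: mult_right_mono power_mono\<close>)
    then show ?thesis by (simp add: \<psi>_def)
  qed
  have "maj \<rho> (\<psi> j) (N j)" for j
    unfolding N_def
  proof (rule maj_has_sum[OF \<rho> _ inner])
    fix i
    have "maj \<rho> (\<lambda>h::real. h ^ i *\<^sub>R D j i) (1 * \<rho> ^ i * norm (D j i))"
      using maj_power[OF \<rho> maj_coord[OF \<rho>, of "1::real"]]
      by (intro maj_bilinear[OF \<rho> bounded_bilinear_scaleR] maj_const[OF \<rho>]) auto
    then show "maj \<rho> (\<lambda>h::real. h ^ i *\<^sub>R D j i) (\<rho> ^ i * norm (D j i))" by simp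
  qed (use \<psi> in \<open>auto simp: cube_def\<close>)
  moreover have "((\<lambda>j. r ^ j *\<^sub>R \<psi> j s) has_sum \<Phi> (Complex s r)) UNIV"
    if s: "\<bar>s\<bar> \<le> \<rho>" and r: "\<bar>r\<bar> \<le> \<rho>" for s r
  proof -
    have "Complex s r \<in> cube \<rho>" using s r by (simp add: cube_def Basis_complex_def)
    then have "((\<lambda>k. mpow (Complex s r) k *\<^sub>R c k) has_sum \<Phi> (Complex s r)) multi_index"
      using c by (simp add: has_expansion_def)
    then have "((\<lambda>(j, i). (s ^ i * r ^ j) *\<^sub>R D j i) has_sum \<Phi> (Complex s r)) (UNIV \<times> UNIV)"
      using has_sum_reindex_bij_betw[OF bij_plane_index, of "\<lambda>k. mpow (Complex s r) k *\<^sub>R c k"]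
      by (simp add: case_prod_unfold mpow_plane_index D_def)
    then show ?thesis
    proof (rule has_sum_SigmaD)
      fix j
      have "((\<lambda>i. r ^ j *\<^sub>R (s ^ i *\<^sub>R D j i)) has_sum r ^ j *\<^sub>R \<psi> j s) UNIV"
        by (rule has_sum_scaleR[OF \<psi>[OF s]])
      then show "((\<lambda>i. case (j, i) of (j, i) \<Rightarrow> (s ^ i * r ^ j) *\<^sub>R D j i) has_sum r ^ j *\<^sub>R \<psi> j s) UNIV"
        by (simp add: mult.commute)
    qed
  qed
  ultimately show thesis using that N by blast
qed

text \<open>
  On the cube of half-width \<open>\<rho>'\<close> the power \<open>v\<^sup>j\<close> is majorized by a constant times \<open>(K C \<rho>')\<^sup>j\<close>, where \<open>K\<close> bounds
  the Clifford product and \<open>C\<close> the embedding of vectors. Choosing \<open>\<rho>'\<close> with \<open>K C \<rho>' \<le> \<rho>\<close> turns pointwise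
  convergence into normal convergence.
\<close>

lemma vect_series_of_coefficients:
  fixes f :: "nat \<Rightarrow> real \<Rightarrow> 'n::{finite,linorder} clifford"
  assumes \<rho>: "\<rho> > 0" "\<rho>1 > 0" and f: "\<And>j. maj \<rho> (\<lambda>s. f j (t + s)) (N j)"
    and N: "(\<lambda>j. N j * \<rho> ^ j) summable_on UNIV"
    and F: "\<And>h0 v. (h0, v) \<in> (cube \<rho>1 :: 'n paravector set) \<Longrightarrow> (\<lambda>j. vect v ^ j * f j (t + h0)) sums F (t + h0, v)"
  obtains \<rho>' where "\<rho>' > 0" "\<rho>' \<le> \<rho>" "\<rho>' \<le> \<rho>1" "vect_series t \<rho>' F f"
proof -
  let ?mult = "(*) :: 'n clifford \<Rightarrow> 'n clifford \<Rightarrow> 'n clifford"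
  let ?L = "\<lambda>x :: 'n paravector. vect (snd x)"
  obtain K where K: "K > 0" and "\<And>x y :: 'n clifford. norm (x * y) \<le> norm x * norm y * K"
    using bounded_bilinear.pos_bounded[OF bounded_bilinear_clifford_mult] by blast
  then have Kn: "norm (x * y) \<le> K * norm x * norm y" for x y :: "'n clifford"
    by (simp add: mult_ac)
  define C where "C = (\<Sum>b\<in>Basis. norm (?L b))"
  have C: "C \<ge> 0" unfolding C_def by (intro sum_nonneg) auto
  define \<rho>' where "\<rho>' = min (min \<rho> \<rho>1) (\<rho> / (K * C + 1))"
  have \<rho>': "\<rho>' > 0" "\<rho>' \<le> \<rho>" "\<rho>' \<le> \<rho>1"
    using \<rho> K C by (auto simp: \<rho>'_def add_nonneg_pos)
  have small: "K * (\<rho>' * C) \<le> \<rho>"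
  proof -
    have "\<rho>' * (K * C + 1) \<le> \<rho>"
      using \<rho>'_def K C by (simp add: pos_le_divide_eq add_nonneg_pos flip: pos_le_divide_eq)
    then show ?thesis using \<rho>' by (simp add: algebra_simps)
  qed
  have "bounded_linear ?L"
    by (rule bounded_linear_compose[OF bounded_linear_vect bounded_linear_snd])
  from maj_bounded_linear[OF this \<rho>'(1)] have L: "maj \<rho>' ?L (\<rho>' * C)"
    by (simp add: C_def sum_distrib_left)
  have pow: "maj \<rho>' (\<lambda>h. ?L h ^ j) ((K * (\<rho>' * C)) ^ j * norm (1 :: 'n clifford))" for j
  proof (induction j)
    case 0
    show ?case using maj_const[OF \<rho>'(1), of "1 :: 'n clifford"] by simp
  next
    case (Suc j)
    from maj_bilinear[OF \<rho>'(1) bounded_bilinear_clifford_mult Kn _ L Suc] K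
    show ?case by (simp add: mult_ac)
  qed
  have fst: "maj \<rho>' (\<lambda>h :: 'n paravector. f j (t + fst h)) (N j)" for j
  proof (rule maj_compose[OF f \<rho>'(1) \<rho>(1)])
    fix b :: real assume "b \<in> Basis"
    then have "(\<lambda>h :: 'n paravector. fst h \<bullet> b) = (\<lambda>h. h \<bullet> (1, 0))" by (auto simp: fun_eq_iff)
    then show "maj \<rho>' (\<lambda>h :: 'n paravector. fst h \<bullet> b) \<rho>"
      using maj_mono[OF maj_coord[OF \<rho>'(1), of "(1, 0) :: 'n paravector"] \<rho>'(2)] by simp
  qed
  define M where "M = (\<lambda>j. (K * norm (1 :: 'n clifford)) * (N j * \<rho> ^ j))"
  have N0: "0 \<le> N j" for j using maj_nonneg[OF f] \<rho> by simp
  have m: "maj \<rho>' (\<lambda>h. ?L h ^ j * f j (t + fst h)) (M j)" for j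
  proof -
    have "maj \<rho>' (\<lambda>h. ?L h ^ j * f j (t + fst h)) (K * ((K * (\<rho>' * C)) ^ j * norm (1 :: 'n clifford)) * N j)"
      using maj_bilinear[OF \<rho>'(1) bounded_bilinear_clifford_mult Kn _ pow fst] K by simp
    moreover have "K * ((K * (\<rho>' * C)) ^ j * norm (1 :: 'n clifford)) * N j
        \<le> K * (\<rho> ^ j * norm (1 :: 'n clifford)) * N j"
      using K small C \<rho>' N0 by (intro mult_right_mono mult_left_mono power_mono) auto
    ultimately show ?thesis by (rule maj_mono[OF _ order_trans]) (simp add: M_def mult_ac)
  qed
  have M: "M summable_on UNIV" unfolding M_def by (rule summable_on_cmult_right[OF N])
  have "vect_series t \<rho>' F f"
    unfolding vect_series_def maj_series_def
  proof (intro conjI exI[of _ M] allI ballI \<rho>'(1) M)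
    fix j show "maj \<rho>' (\<lambda>h. vect_term (f j) j ((t, 0) + h)) (M j)"
      using m[of j] by (simp add: vect_term_def)
  next
    fix h :: "'n paravector" assume h: "h \<in> cube \<rho>'"
    show "((\<lambda>j. vect_term (f j) j ((t, 0) + h)) has_sum F ((t, 0) + h)) UNIV"
    proof (rule norm_summable_imp_has_sum)
      show "summable (\<lambda>j. norm (vect_term (f j) j ((t, 0) + h)))"
        by (rule summable_comparison_test'[OF summable_on_imp_summable[OF M], of 0])
           (use maj_bound[OF m h] in \<open>simp add: vect_term_def\<close>)
      have "h \<in> cube \<rho>1" using h cube_mono[OF \<rho>'(3)] by blast
      then show "(\<lambda>j. vect_term (f j) j ((t, 0) + h)) sums F ((t, 0) + h)"
        using F[of "fst h" "snd h"] by (cases h) (simp add: vect_term_def)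
    qed
  qed
  with \<rho>' show thesis by (rule that)
qed

section \<open>Slice functions\<close>

lemma real_part_iff [simp]: "t \<in> real_part W \<longleftrightarrow> complex_of_real t \<in> W"
  by (simp add: real_part_def)

lemma open_real_part: "open W \<Longrightarrow> open (real_part W)"
proof -
  assume "open W"
  moreover have "continuous_on UNIV complex_of_real" by (intro continuous_intros)
  ultimately have "open (complex_of_real -` W)" by (rule open_vimage)
  then show ?thesis by (simp add: real_part_def vimage_def)
qed

lemma mem_axial_set:
  fixes v :: "real ^ 'n"
  assumes "cnj_closed W"
  shows "(x0, v) \<in> axial_set W \<longleftrightarrow> Complex x0 (norm v) \<in> W"
proof
  assume "(x0, v) \<in> axial_set W"
  then obtain u \<omega> where "v = u *\<^sub>R \<omega>" "norm \<omega> = 1" "Complex x0 u \<in> W"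
    by (auto simp: axial_set_def)
  moreover have "cnj (Complex x0 u) = Complex x0 (- u)" by (simp add: complex_eq_iff)
  ultimately show "Complex x0 (norm v) \<in> W"
    using assms by (cases "u \<ge> 0") (auto simp: cnj_closed_def)
next
  assume *: "Complex x0 (norm v) \<in> W"
  obtain l :: 'n where True by blast
  show "(x0, v) \<in> axial_set W"
  proof (cases "v = 0")
    case True
    then have "(x0, v) = (x0, 0 *\<^sub>R axis l 1)" "Complex x0 0 \<in> W" using * by simp_all
    moreover have "norm (axis l 1 :: real ^ 'n) = 1" by simp
    ultimately show ?thesis
      unfolding axial_set_def by (intro CollectI exI conjI)
  next
    case False
    then have "(x0, v) = (x0, norm v *\<^sub>R (v /\<^sub>R norm v))" "norm (v /\<^sub>R norm v) = 1" by simp_all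
    with * show ?thesis
      unfolding axial_set_def by (intro CollectI exI conjI)
  qed
qed

lemma open_axial_set:
  assumes "open W" "cnj_closed W"
  shows "open (axial_set W :: ('n::finite) paravector set)"
proof -
  have "(axial_set W :: 'n paravector set) = (\<lambda>x. Complex (fst x) (norm (snd x))) -` W"
    by (auto simp: mem_axial_set[OF assms(2)])
  moreover have "continuous_on UNIV (\<lambda>x :: 'n paravector. Complex (fst x) (norm (snd x)))"
    unfolding Complex_eq by (intro continuous_intros)
  ultimately show ?thesis using assms(1) by (simp add: open_vimage)
qed

text \<open>
  The imaginary parts of the points of \<open>W\<close> form a connected set that is symmetric about 0.
\<close>

lemma intrinsic_domain_meets_reals:
  assumes "intrinsic_domain W"
  shows "real_part W \<noteq> {}"
proof
  assume "real_part W = {}"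
  then have ne: "Im z \<noteq> 0" if "z \<in> W" for z
    using that by (metis complex_is_Real_iff empty_iff Reals_cases real_part_iff)
  obtain z where z: "z \<in> W" using assms by (auto simp: intrinsic_domain_def)
  have "connected (Im ` W)"
    using assms by (intro connected_continuous_image continuous_intros) (auto simp: intrinsic_domain_def)
  moreover have "Im z \<in> Im ` W" using z by blast
  moreover have "cnj z \<in> W" using z assms by (simp add: intrinsic_domain_def cnj_closed_def)
  then have "Im (cnj z) \<in> Im ` W" by blast
  ultimately have "{Im z..- Im z} \<subseteq> Im ` W" "{- Im z..Im z} \<subseteq> Im ` W"
    by (auto intro: connected_contains_Icc[THEN subsetD])
  then have "0 \<in> Im ` W" by (cases "Im z \<ge> 0") auto
  then show False using ne by force
qed

lemma real_analytic_on_real_function: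
  assumes "f holomorphic_on T" "open T" "U \<subseteq> complex_of_real -` T" "open U" "\<And>s. s \<in> U \<Longrightarrow> \<phi> s = Re (f (of_real s))"
  shows "real_analytic_on \<phi> U"
proof (rule real_analytic_on_cong)
  have "real_analytic_on (\<lambda>s. f (complex_of_real s)) U"
    by (rule real_analytic_on_compose[OF real_analytic_on_holomorphic[OF assms(1,2)]
          real_analytic_on_bounded_linear[OF bounded_linear_of_real assms(4)]])
       (use assms(3) in auto)
  then show "real_analytic_on (\<lambda>s. Re (f (complex_of_real s))) U"
    by (rule real_analytic_on_linear[OF _ bounded_linear_Re])
qed (use assms in auto)

lemma real_analytic_on_sqrt: "real_analytic_on sqrt {0<..}"
proof (rule real_analytic_on_real_function[OF holomorphic_on_csqrt])
  show "open (- \<real>\<^sub>\<le>\<^sub>0 :: complex set)" by (simp add: open_Compl closed_nonpos_Reals_complex)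
  show "{0<..} \<subseteq> complex_of_real -` (- \<real>\<^sub>\<le>\<^sub>0)" by (auto simp: complex_nonpos_Reals_iff)
  show "sqrt s = Re (csqrt (complex_of_real s))" if "s \<in> {0<..}" for s
    using that of_real_sqrt[of s] by (metis Re_complex_of_real greaterThan_iff less_imp_le)
qed simp

lemma real_analytic_on_inverse: "real_analytic_on (inverse :: real \<Rightarrow> real) {0<..}"
proof (rule real_analytic_on_real_function)
  show "inverse holomorphic_on (- {0 :: complex})" by (intro holomorphic_intros) auto
  show "inverse s = Re (inverse (complex_of_real s))" for s
    unfolding of_real_inverse[symmetric] by (rule Re_complex_of_real[symmetric])
qed auto

lemma real_analytic_on_norm_snd:
  fixes U :: "('n::finite) paravector set"
  assumes "open U" "\<And>x. x \<in> U \<Longrightarrow> snd x \<noteq> 0"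
  shows "real_analytic_on (\<lambda>x. norm (snd x)) U"
proof -
  have s: "real_analytic_on (snd :: 'n paravector \<Rightarrow> _) U"
    by (rule real_analytic_on_bounded_linear[OF bounded_linear_snd assms(1)])
  show ?thesis
    unfolding norm_eq_sqrt_inner
    by (rule real_analytic_on_compose[OF real_analytic_on_sqrt real_analytic_on_bilinear[OF bounded_bilinear_inner s s]])
       (use assms(2) in auto)
qed

lemma Re_complex_of_real_mult: "Re (of_real x * z) = x * Re z"
  and Im_complex_of_real_mult: "Im (of_real x * z) = x * Im z"
  by simp_all

lemma ball_of_real_subset:
  "\<bar>s - t\<bar> + d \<le> e \<Longrightarrow> ball (complex_of_real s) d \<subseteq> ball (of_real t) e"
  by (simp add: ball_subset_ball_iff dist_complex_def norm_of_real flip: of_real_diff)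

text \<open>
  A slice function with values in the Clifford algebra has one intrinsic holomorphic function for each
  basis blade. A scalar slice function is the case in which only the function of the empty blade is
  nonzero.
\<close>

locale slice_family =
  fixes W :: "complex set" and g :: "'n::{finite,linorder} set \<Rightarrow> complex \<Rightarrow> complex"
  assumes domain: "intrinsic_domain W" and intrinsic: "\<And>A. intrinsic_holomorphic W (g A)"
begin

definition slice :: "'n paravector \<Rightarrow> 'n clifford" where
  "slice = axial_fun (\<lambda>z. \<Sum>A\<in>UNIV. Re (g A z) *\<^sub>R blade A) (\<lambda>z. \<Sum>A\<in>UNIV. Im (g A z) *\<^sub>R blade A)"

definition real_jet :: "nat \<Rightarrow> real \<Rightarrow> 'n clifford" where
  "real_jet i t = (\<Sum>A\<in>UNIV. Re ((deriv ^^ i) (g A) (of_real t)) *\<^sub>R blade A)"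

lemma open_W: "open W" and cnj_W: "cnj_closed W" and connected_W: "connected W"
  using domain by (auto simp: intrinsic_domain_def)

lemma holo: "(deriv ^^ i) (g A) holomorphic_on W"
proof -
  have "g A holomorphic_on W" using intrinsic[of A] by (simp add: intrinsic_holomorphic_def)
  then show ?thesis by (rule holomorphic_higher_deriv[OF _ open_W])
qed

lemma line_derivative:
  assumes "t \<in> real_part W"
  shows "((\<lambda>s. (deriv ^^ i) (g A) (complex_of_real s)) has_vector_derivative (deriv ^^ Suc i) (g A) (of_real t)) (at t)"
proof -
  have "((deriv ^^ i) (g A) has_field_derivative (deriv ^^ Suc i) (g A) (of_real t)) (at (of_real t))"
    using holomorphic_derivI[OF holo open_W] assms by simp
  with field_vector_diff_chain_at[of complex_of_real "of_real 1" t,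
      OF bounded_linear.has_vector_derivative[OF bounded_linear_of_real has_vector_derivative_id]]
  show ?thesis by (fastforce simp: o_def)
qed

lemma real_on_reals: "t \<in> real_part W \<Longrightarrow> Im ((deriv ^^ i) (g A) (of_real t)) = 0"
proof (induction i arbitrary: t)
  case 0
  then show ?case
    using intrinsic[of A] complex_cnj_complex_of_real[of t] unfolding intrinsic_holomorphic_def by force
next
  case (Suc i)
  have "((\<lambda>s. Im ((deriv ^^ i) (g A) (complex_of_real s))) has_vector_derivative Im ((deriv ^^ Suc i) (g A) (of_real t))) (at t)"
    by (rule bounded_linear.has_vector_derivative[OF bounded_linear_Im line_derivative[OF Suc.prems]])
  moreover have "((\<lambda>s. Im ((deriv ^^ i) (g A) (complex_of_real s))) has_vector_derivative 0) (at t)"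
    by (rule has_vector_derivative_transform_within_open[of "\<lambda>_. 0", OF _ open_real_part[OF open_W] Suc.prems])
       (use Suc.IH in auto)
  ultimately show ?case by (rule vector_derivative_unique_at)
qed

lemma real_jet_derivative:
  assumes t: "t \<in> real_part W"
  shows "(real_jet i has_vector_derivative real_jet (Suc i) t) (at t)"
  unfolding real_jet_def[abs_def]
proof (rule has_vector_derivative_sum)
  fix A
  show "((\<lambda>t. Re ((deriv ^^ i) (g A) (complex_of_real t)) *\<^sub>R (blade A :: 'n clifford))
      has_vector_derivative Re ((deriv ^^ Suc i) (g A) (complex_of_real t)) *\<^sub>R blade A) (at t)"
    by (rule bounded_linear.has_vector_derivative[OF bounded_linear_scaleR_left
          bounded_linear.has_vector_derivative[OF bounded_linear_Re line_derivative[OF t]]])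
qed

lemma real_analytic_on_real_jet: "real_analytic_on (real_jet i) (real_part W)"
  unfolding real_jet_def[abs_def]
proof (rule real_analytic_on_sum[OF finite open_real_part[OF open_W]])
  fix A
  have "real_analytic_on (\<lambda>t. Re ((deriv ^^ i) (g A) (complex_of_real t))) (real_part W)"
    by (rule real_analytic_on_real_function[OF holo open_W _ open_real_part[OF open_W] refl])
       (auto simp: real_part_def)
  then show "real_analytic_on (\<lambda>t. Re ((deriv ^^ i) (g A) (complex_of_real t)) *\<^sub>R (blade A :: 'n clifford)) (real_part W)"
    by (rule real_analytic_on_linear[OF _ bounded_linear_scaleR_left])
qed

lemma imaginary_taylor:
  assumes "ball (of_real s) e \<subseteq> W" "\<bar>r\<bar> < e"
  shows "(\<lambda>j. (deriv ^^ j) (g A) (of_real s) / fact j * (\<i> * of_real r) ^ j) sums g A (Complex s r)"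
proof -
  have "g A holomorphic_on ball (of_real s) e"
    using holo[of 0 A] assms(1) by (auto intro: holomorphic_on_subset)
  moreover have "Complex s r \<in> ball (of_real s) e"
    using assms(2) by (simp add: dist_norm Complex_eq norm_mult)
  ultimately show ?thesis
    using holomorphic_power_series[of "g A" "of_real s" e "Complex s r"] by (simp add: Complex_eq)
qed

text \<open>
  Expand each \<open>g A\<close> at \<open>t\<close> as a function of two real variables. Collected by powers of the imaginary part,
  the coefficients must be \<open>\<i>\<^sup>j\<close> times the Taylor coefficients of \<open>g A\<close> at the real points nearby, and so
  the latter have majorants of order \<open>\<rho>\<^bsup>-j\<^esup>\<close>.
\<close>

lemma maj_taylor_coefficients:
  assumes "t \<in> real_part W"
  obtains \<rho> N where "\<rho> > 0" "\<And>j. maj \<rho> (\<lambda>s. real_jet j (t + s) /\<^sub>R fact j) (N j)"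
    "(\<lambda>j. N j * \<rho> ^ j) summable_on UNIV"
proof -
  obtain e where e: "e > 0" "ball (of_real t) e \<subseteq> W"
    using open_W assms openE by (metis real_part_iff)
  \<comment> \<open>The bounds are stated for all smaller radii, so that the least radius over the finitely many blades serves all of them.\<close>
  define P where "P = (\<lambda>A \<rho> N. 0 < \<rho> \<and> (\<forall>\<rho>'. 0 < \<rho>' \<longrightarrow> \<rho>' \<le> \<rho> \<longrightarrow>
      (\<forall>j. maj \<rho>' (\<lambda>s. Re ((deriv ^^ j) (g A) (of_real (t + s))) /\<^sub>R fact j) (N j)) \<and>
      (\<lambda>j. N j * \<rho>' ^ j) summable_on UNIV))"
  have "\<exists>\<rho> N. P A \<rho> N" for A
  proof -
    have "real_analytic_on (g A) W" using real_analytic_on_holomorphic[OF holo[of 0] open_W] by simp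
    then obtain r M where r: "r > 0" "maj r (\<lambda>h. g A (of_real t + h)) M"
      using assms by (auto elim: real_analytic_onE)
    define \<rho> where "\<rho> = min r (e / 2)"
    have \<rho>: "\<rho> > 0" "\<rho> \<le> r" "\<rho> \<le> e / 2" using r e by (auto simp: \<rho>_def)
    obtain \<psi> N where \<psi>: "\<And>j. maj \<rho> (\<psi> j :: real \<Rightarrow> complex) (N j)" "(\<lambda>j. N j * \<rho> ^ j) summable_on UNIV"
      and sums: "\<And>s r. \<bar>s\<bar> \<le> \<rho> \<Longrightarrow> \<bar>r\<bar> \<le> \<rho> \<Longrightarrow>
         ((\<lambda>j. r ^ j *\<^sub>R \<psi> j s) has_sum g A (of_real t + Complex s r)) UNIV"
      using maj_slices[OF maj_smaller_cube[OF r(2) \<rho>(1,2)] \<rho>(1)] by blast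
    have coeff: "\<psi> j s = \<i> ^ j * ((deriv ^^ j) (g A) (of_real (t + s)) / fact j)" if s: "\<bar>s\<bar> \<le> \<rho>" for j s
    proof -
      have "\<psi> j s - \<i> ^ j * ((deriv ^^ j) (g A) (of_real (t + s)) / fact j) = 0"
      proof (rule power_series_zero[OF \<rho>(1), where x = "\<lambda>j. \<psi> j s - \<i> ^ j * ((deriv ^^ j) (g A) (of_real (t + s)) / fact j)"])
        fix y :: real assume y: "\<bar>y\<bar> < \<rho>"
        have "ball (complex_of_real (t + s)) (e / 2) \<subseteq> ball (of_real t) e"
          using s \<rho> by (intro ball_of_real_subset) auto
        then have "(\<lambda>j. (deriv ^^ j) (g A) (of_real (t + s)) / fact j * (\<i> * of_real y) ^ j) sums g A (Complex (t + s) y)"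
          using y \<rho> e by (intro imaginary_taylor[of _ "e / 2"]) auto
        moreover have "(\<lambda>j. y ^ j *\<^sub>R \<psi> j s) sums g A (Complex (t + s) y)"
          using has_sum_imp_sums[OF sums[OF s, of y]] y by (simp add: Complex_eq add.assoc)
        ultimately have "(\<lambda>j. y ^ j *\<^sub>R \<psi> j s - (deriv ^^ j) (g A) (of_real (t + s)) / fact j * (\<i> * of_real y) ^ j) sums 0"
          using sums_diff by fastforce
        then show "(\<lambda>j. y ^ j *\<^sub>R (\<psi> j s - \<i> ^ j * ((deriv ^^ j) (g A) (of_real (t + s)) / fact j))) sums 0"
          by (simp add: scaleR_conv_of_real algebra_simps power_mult_distrib)
      qed
      then show ?thesis by simp
    qed
    have m: "maj \<rho> (\<lambda>s. Re ((deriv ^^ j) (g A) (of_real (t + s))) /\<^sub>R fact j) (N j)" for j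
    proof -
      \<comment> \<open>Multiplication by \<open>(-\<i>)\<^sup>j\<close> undoes the factor \<open>\<i>\<^sup>j\<close> without changing the norm.\<close>
      have "bounded_linear (\<lambda>z. Re ((- \<i>) ^ j * z))"
        by (intro bounded_linear_compose[OF bounded_linear_Re bounded_linear_mult_right])
      moreover have "norm (Re ((- \<i>) ^ j * z)) \<le> 1 * norm z" for z
        using abs_Re_le_cmod[of "(- \<i>) ^ j * z"] by (simp only: norm_mult norm_power real_norm_def) simp
      ultimately have "maj \<rho> (\<lambda>s. Re ((- \<i>) ^ j * \<psi> j s)) (1 * N j)"
        by (rule maj_linear[OF \<rho>(1) _ _ _ \<psi>(1)]) simp
      moreover have "Re ((deriv ^^ j) (g A) (of_real (t + s))) /\<^sub>R fact j = Re ((- \<i>) ^ j * \<psi> j s)" if "s \<in> cube \<rho>" for s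
      proof -
        have "(- \<i>) ^ j * \<psi> j s = (deriv ^^ j) (g A) (of_real (t + s)) / fact j"
          using that by (subst coeff) (auto simp: cube_def simp flip: mult.assoc power_mult_distrib)
        moreover have "Re (z / fact j) = Re z /\<^sub>R fact j" for z
          using Re_divide_of_real[of z "fact j"] unfolding of_real_fact real_scaleR_def
          by (simp only: divide_inverse mult.commute)
        ultimately show ?thesis by simp
      qed
      ultimately show ?thesis by (simp only: mult_1 maj_cong)
    qed
    show ?thesis
      unfolding P_def
    proof (intro exI[of _ \<rho>] exI[of _ N] conjI \<rho>(1) allI impI)
      fix \<rho>' assume \<rho>': "0 < \<rho>'" "\<rho>' \<le> \<rho>"
      show "maj \<rho>' (\<lambda>s. Re ((deriv ^^ j) (g A) (of_real (t + s))) /\<^sub>R fact j) (N j)" for j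
        by (rule maj_smaller_cube[OF m \<rho>'])
      have "0 \<le> N j" for j using maj_nonneg[OF m] \<rho> by simp
      then show "(\<lambda>j. N j * \<rho>' ^ j) summable_on UNIV"
        by (intro summable_on_comparison_test[OF \<psi>(2)]) (use \<rho>' in \<open>auto intro!: mult_left_mono power_mono\<close>)
    qed
  qed
  then have "\<forall>A. \<exists>\<rho> N. P A \<rho> N" by blast
  from choice[OF this] obtain r where "\<forall>A. \<exists>N. P A (r A) N" by blast
  from choice[OF this] obtain N where PN: "\<And>A. P A (r A) (N A)" by blast
  have r: "r A > 0" for A using PN[of A] by (simp add: P_def)
  have rN: "maj \<rho>' (\<lambda>s. Re ((deriv ^^ j) (g A) (of_real (t + s))) /\<^sub>R fact j) (N A j)"
      "(\<lambda>j. N A j * \<rho>' ^ j) summable_on UNIV" if "0 < \<rho>'" "\<rho>' \<le> r A" for A \<rho>' j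
    using PN[of A] that by (simp_all add: P_def)
  define \<rho> where "\<rho> = Min (range r)"
  have \<rho>: "\<rho> > 0" "\<And>A. \<rho> \<le> r A" using r by (auto simp: \<rho>_def)
  let ?K = "\<lambda>A :: 'n set. norm (blade A :: 'n clifford)"
  have m: "maj \<rho> (\<lambda>s. real_jet j (t + s) /\<^sub>R fact j) (\<Sum>A\<in>UNIV. ?K A * N A j)" for j
  proof -
    have "maj \<rho> (\<lambda>s. (Re ((deriv ^^ j) (g A) (of_real (t + s))) /\<^sub>R fact j) *\<^sub>R (blade A :: 'n clifford)) (?K A * N A j)" for A
      by (rule maj_linear[OF \<rho>(1) bounded_linear_scaleR_left _ _ rN(1)[OF \<rho>]]) (auto simp: mult.commute)
    then have "maj \<rho> (\<lambda>s. \<Sum>A\<in>UNIV. (Re ((deriv ^^ j) (g A) (of_real (t + s))) /\<^sub>R fact j) *\<^sub>R (blade A :: 'n clifford))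
        (\<Sum>A\<in>UNIV. ?K A * N A j)"
      by (intro maj_sum[OF \<rho>(1)]) auto
    then show ?thesis by (simp add: real_jet_def scaleR_sum_right)
  qed
  have "(\<lambda>j. (\<Sum>A\<in>X. ?K A * N A j) * \<rho> ^ j) summable_on UNIV" if "finite X" for X
    using that
  proof induction
    case (insert A X)
    have "(\<lambda>j. ?K A * (N A j * \<rho> ^ j) + (\<Sum>A\<in>X. ?K A * N A j) * \<rho> ^ j) summable_on UNIV"
      by (intro summable_on_add summable_on_cmult_right rN(2)[OF \<rho>] insert.IH)
    then show ?case using insert.hyps by (simp add: algebra_simps)
  qed simp
  then show thesis using that[OF \<rho>(1) m] by simp
qed

lemma imaginary_taylor_term:
  assumes "t \<in> real_part W"
  shows "(deriv ^^ j) (g A) (of_real t) / fact j * (\<i> * of_real r) ^ j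
    = of_real (r ^ j * (Re ((deriv ^^ j) (g A) (of_real t)) / fact j)) * \<i> ^ j"
proof -
  have "(deriv ^^ j) (g A) (of_real t) = of_real (Re ((deriv ^^ j) (g A) (of_real t)))"
    using real_on_reals[OF assms] by (simp add: complex_eq_iff)
  then show ?thesis by (simp add: power_mult_distrib)
qed

text \<open>
  The unit vector \<open>u = v / \<bar>v\<bar>\<close> satisfies \<open>u\<^sup>2 = -1\<close>, so \<open>u\<^sup>j = Re (\<i>\<^sup>j) + Im (\<i>\<^sup>j) u\<close>. Replacing \<open>\<i>\<close> by \<open>u\<close> in
  the Taylor series at the real point \<open>x\<^sub>0\<close>, whose coefficients are real, gives the slice function.
\<close>

lemma slice_sums:
  assumes "ball (of_real x0) e \<subseteq> W" "norm v < e"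
  shows "(\<lambda>j. vect v ^ j * (real_jet j x0 /\<^sub>R fact j)) sums slice (x0, v)"
proof -
  have e: "e > 0" using assms(2) norm_ge_zero[of v] by linarith
  then have x0: "x0 \<in> real_part W" using assms(1) by auto
  show ?thesis
  proof (cases "v = 0")
    case True
    have "(\<lambda>j. vect v ^ j * (real_jet j x0 /\<^sub>R fact j)) sums (real_jet 0 x0 /\<^sub>R fact 0)"
      unfolding True by (rule vect_series_at_axis)
    then show ?thesis
      using True by (simp add: slice_def axial_fun_def real_jet_def complex_of_real_def)
  next
    case False
    define r where "r = norm v"
    define u where "u = vect v /\<^sub>R r"
    have r: "r > 0" "r < e" using False assms by (auto simp: r_def)
    have uu: "u * u = - 1"
    proof -
      have "v \<bullet> v = r * r" by (simp add: r_def flip: power2_norm_eq_inner power2_eq_square)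
      then have "u * u = (inverse r * inverse r) *\<^sub>R of_real (- (r * r))"
        by (simp add: u_def vect_square)
      also have "\<dots> = of_real (inverse r * inverse r * - (r * r))"
        by (simp only: scaleR_conv_of_real of_real_mult)
      also have "inverse r * inverse r * - (r * r) = - 1" using r by (simp add: field_simps)
      finally show ?thesis by simp
    qed
    have upow: "u ^ j = Re (\<i> ^ j) *\<^sub>R 1 + Im (\<i> ^ j) *\<^sub>R u" for j
    proof (induction j)
      case (Suc j)
      have "u ^ Suc j = u ^ j * u" by (rule power_Suc2)
      also have "\<dots> = Re (\<i> ^ j) *\<^sub>R u + Im (\<i> ^ j) *\<^sub>R (u * u)"
        unfolding Suc by (simp add: distrib_right)
      finally show ?case by (simp add: uu)
    qed simp
    let ?d = "\<lambda>A j. (deriv ^^ j) (g A) (of_real x0) / fact j * (\<i> * of_real r) ^ j"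
    note d = imaginary_taylor_term[OF x0]
    have s: "(\<lambda>j. ?d A j) sums g A (Complex x0 r)" for A
      by (rule imaginary_taylor[OF assms(1)]) (use r in simp)
    have "(\<lambda>j. (\<Sum>A\<in>UNIV. Re (?d A j) *\<^sub>R blade A) + u * (\<Sum>A\<in>UNIV. Im (?d A j) *\<^sub>R blade A))
        sums ((\<Sum>A\<in>UNIV. Re (g A (Complex x0 r)) *\<^sub>R blade A) + u * (\<Sum>A\<in>UNIV. Im (g A (Complex x0 r)) *\<^sub>R blade A))"
      by (intro sums_add sums_sum bounded_linear.sums[OF bounded_linear_clifford_mult_right]
          bounded_linear.sums[OF bounded_linear_scaleR_left] sums_Re sums_Im s)
    moreover have "(\<Sum>A\<in>UNIV. Re (?d A j) *\<^sub>R blade A) + u * (\<Sum>A\<in>UNIV. Im (?d A j) *\<^sub>R blade A)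
        = vect v ^ j * (real_jet j x0 /\<^sub>R fact j)" for j
    proof -
      have v: "vect v ^ j = r ^ j *\<^sub>R (Re (\<i> ^ j) *\<^sub>R 1 + Im (\<i> ^ j) *\<^sub>R u)"
        unfolding upow[symmetric] using r by (simp add: u_def flip: power_of_scaleR)
      let ?c = "\<lambda>A. r ^ j * (Re ((deriv ^^ j) (g A) (of_real x0)) / fact j)"
      define P where "P = (\<Sum>A\<in>UNIV. ?c A *\<^sub>R (blade A :: 'n clifford))"
      have P: "P = r ^ j *\<^sub>R (real_jet j x0 /\<^sub>R fact j)"
        by (simp add: P_def real_jet_def scaleR_sum_right divide_inverse mult_ac)
      have "(\<Sum>A\<in>UNIV. (?c A * a) *\<^sub>R (blade A :: 'n clifford)) = a *\<^sub>R P" for a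
        by (simp add: P_def scaleR_sum_right mult.commute)
      then have "(\<Sum>A\<in>UNIV. Re (?d A j) *\<^sub>R blade A) + u * (\<Sum>A\<in>UNIV. Im (?d A j) *\<^sub>R blade A)
          = Re (\<i> ^ j) *\<^sub>R P + u * (Im (\<i> ^ j) *\<^sub>R P)"
        unfolding d Re_complex_of_real_mult Im_complex_of_real_mult by simp
      also have "\<dots> = vect v ^ j * (real_jet j x0 /\<^sub>R fact j)"
        unfolding v P by (simp add: distrib_right scaleR_right_distrib mult_ac)
      finally show ?thesis .
    qed
    ultimately show ?thesis
      by (simp add: slice_def axial_fun_def u_def r_def)
  qed
qed

lemma slice_vect_series:
  assumes "t \<in> real_part W"
  obtains \<rho> where "\<rho> > 0" "{t - \<rho>..t + \<rho>} \<subseteq> real_part W" "vect_series t \<rho> slice (\<lambda>j s. real_jet j s /\<^sub>R fact j)"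
proof -
  obtain e where e: "e > 0" "ball (of_real t) e \<subseteq> W"
    using open_W assms openE by (metis real_part_iff)
  obtain \<rho> N where \<rho>: "\<rho> > 0" and N: "\<And>j. maj \<rho> (\<lambda>s. real_jet j (t + s) /\<^sub>R fact j) (N j)"
    "(\<lambda>j. N j * \<rho> ^ j) summable_on UNIV"
    using maj_taylor_coefficients[OF assms] by blast
  have "e / 2 > 0" using e by simp
  then obtain \<rho>1 where \<rho>1: "\<rho>1 > 0"
    and small: "\<And>h0 v. (h0, v) \<in> (cube \<rho>1 :: 'n paravector set) \<Longrightarrow> \<bar>h0\<bar> < e / 2 \<and> norm v < e / 2"
    using small_cube_paravector by blast
  obtain \<rho>' where \<rho>': "\<rho>' > 0" "\<rho>' \<le> \<rho>" "\<rho>' \<le> \<rho>1" "vect_series t \<rho>' slice (\<lambda>j s. real_jet j s /\<^sub>R fact j)"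
  proof (rule vect_series_of_coefficients[OF \<rho> \<rho>1 N])
    fix h0 :: real and v :: "(real, 'n) vec" assume h: "(h0, v) \<in> cube \<rho>1"
    note hv = small[OF h]
    have "ball (of_real (t + h0)) (e / 2) \<subseteq> ball (complex_of_real t) e"
      using hv e by (intro ball_of_real_subset) auto
    then show "(\<lambda>j. vect v ^ j * (real_jet j (t + h0) /\<^sub>R fact j)) sums slice (t + h0, v)"
      using e hv by (intro slice_sums[of _ "e / 2"]) auto
  qed
  moreover have "{t - \<rho>'..t + \<rho>'} \<subseteq> real_part W"
  proof
    fix s assume "s \<in> {t - \<rho>'..t + \<rho>'}"
    then have "(s - t, 0) \<in> (cube \<rho>1 :: 'n paravector set)"
      using \<rho>' by (auto simp: in_cube_paravector)
    then have "complex_of_real s \<in> ball (of_real t) e"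
      using small[of "s - t" 0] by (simp add: dist_complex_def abs_minus_commute[of t s] flip: of_real_diff)
    then show "s \<in> real_part W" using e by auto
  qed
  ultimately show thesis using that by blast
qed

end

section \<open>Uniqueness of the generalized CK-extension\<close>

lemma real_analytic_on_laplacian:
  fixes F :: "'a::euclidean_space \<Rightarrow> 'b::euclidean_space"
  assumes "real_analytic_on F U"
  shows "real_analytic_on (laplacian F) U"
  unfolding laplacian_def[abs_def]
  by (rule real_analytic_on_sum[OF finite_Basis real_analytic_on_open[OF assms]])
     (rule real_analytic_on_dir_deriv[OF real_analytic_on_dir_deriv[OF assms]])

lemma real_analytic_on_dirac_op:
  fixes F :: "'n::{finite,linorder} paravector \<Rightarrow> 'n clifford"
  assumes F: "real_analytic_on F U"
  shows "real_analytic_on (dirac_op F) U"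
  unfolding dirac_op_def[abs_def]
  by (rule real_analytic_on_add[OF real_analytic_on_dir_deriv[OF F]
        real_analytic_on_sum[OF finite real_analytic_on_open[OF F]
          real_analytic_on_linear[OF real_analytic_on_dir_deriv[OF F] bounded_linear_clifford_mult_right]]])
     simp_all

lemma dir_deriv_linear_combination:
  fixes F G :: "'a::euclidean_space \<Rightarrow> 'b::euclidean_space"
  assumes F: "real_analytic_on F U" and G: "real_analytic_on G U" and x: "x \<in> U" and b: "b \<in> Basis"
  shows "dir_deriv b (\<lambda>x. r *\<^sub>R F x + s *\<^sub>R G x) x = r *\<^sub>R dir_deriv b F x + s *\<^sub>R dir_deriv b G x"
proof -
  note D = bounded_linear.has_vector_derivative[OF bounded_linear_scaleR_right real_analytic_on_has_vector_derivative[OF _ b x]]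
  show ?thesis
    using has_vector_derivative_add[OF D[OF F] D[OF G]]
    unfolding dir_deriv_def[of b "\<lambda>x. r *\<^sub>R F x + s *\<^sub>R G x"] by (rule vector_derivative_at)
qed

lemma dirac_op_linear_combination:
  fixes F G :: "'n::{finite,linorder} paravector \<Rightarrow> 'n clifford"
  assumes "real_analytic_on F U" "real_analytic_on G U" "x \<in> U"
  shows "dirac_op (\<lambda>x. r *\<^sub>R F x + s *\<^sub>R G x) x = r *\<^sub>R dirac_op F x + s *\<^sub>R dirac_op G x"
  unfolding dirac_op_def dir_deriv_linear_combination[OF assms basis_paravector_mem(1)]
    dir_deriv_linear_combination[OF assms basis_paravector_mem(2)]
  by (simp add: distrib_left scaleR_right_distrib sum.distrib scaleR_sum_right)

lemma dirac_op_cong: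
  assumes "open U" "x \<in> U" "\<And>y. y \<in> U \<Longrightarrow> F y = G y"
  shows "dirac_op F x = dirac_op G x"
  unfolding dirac_op_def using dir_deriv_cong[OF assms] by simp

lemma slice_restriction_analytic:
  fixes F :: "'n::finite paravector \<Rightarrow> 'b::euclidean_space"
  assumes W: "open W" "cnj_closed W" and F: "real_analytic_on F (axial_set W)" and \<omega>: "norm \<omega> = 1"
  shows "real_analytic_on (\<lambda>z. F (Re z, Im z *\<^sub>R \<omega>)) W"
proof (rule real_analytic_on_compose[OF F real_analytic_on_bounded_linear[OF _ W(1)]])
  show "bounded_linear (\<lambda>z. (Re z, Im z *\<^sub>R \<omega>))"
    by (intro bounded_linear_Pair bounded_linear_Re bounded_linear_scaleR_const bounded_linear_Im)
  show "(\<lambda>z. (Re z, Im z *\<^sub>R \<omega>)) ` W \<subseteq> axial_set W"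
  proof (rule image_subsetI)
    fix z assume "z \<in> W"
    then have "Complex (Re z) (Im z) \<in> W" by simp
    with \<omega> show "(Re z, Im z *\<^sub>R \<omega>) \<in> axial_set W" unfolding axial_set_def by blast
  qed
qed

lemma slice_direction:
  fixes v :: "real ^ 'n::finite"
  obtains \<omega> where "norm \<omega> = 1" "v = norm v *\<^sub>R \<omega>"
proof (cases "v = 0")
  case True
  then show thesis using that[of "axis undefined 1"] by simp
next
  case False
  then show thesis using that[of "v /\<^sub>R norm v"] by simp
qed

lemma slice_point_in_cube:
  fixes \<omega> :: "real ^ 'n::finite"
  assumes "z \<in> ball (of_real t) \<rho>" "norm \<omega> = 1"
  shows "(Re z - t, Im z *\<^sub>R \<omega>) \<in> cube \<rho>"
proof -
  have z: "\<bar>Re z - t\<bar> \<le> \<rho>" "\<bar>Im z\<bar> \<le> \<rho>"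
    using assms abs_Re_le_cmod[of "z - of_real t"] abs_Im_le_cmod[of "z - of_real t"]
    by (auto simp: dist_norm norm_minus_commute)
  have "\<bar>Im z * \<omega> $ l\<bar> \<le> \<rho>" for l
  proof -
    have "\<bar>Im z\<bar> * \<bar>\<omega> $ l\<bar> \<le> \<bar>Im z\<bar> * 1"
      using component_le_norm_cart[of \<omega> l] assms(2) by (intro mult_left_mono) auto
    with z show ?thesis by (simp add: abs_mult)
  qed
  with z show ?thesis by (simp add: in_cube_paravector)
qed

text \<open>
  Every point lies on a slice \<open>{u + y \<omega>}\<close>, which is a copy of \<open>W\<close>, and every slice contains the real axis. The
  identity theorem on \<open>W\<close> thus spreads a zero from the axis to the whole axially symmetric domain.
\<close>

lemma axial_identity:
  fixes F :: "'n::finite paravector \<Rightarrow> 'b::euclidean_space"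
  assumes W: "intrinsic_domain W" and F: "real_analytic_on F (axial_set W)"
    and t: "t \<in> real_part W" and "\<rho> > 0" and zero: "\<And>h. h \<in> cube \<rho> \<Longrightarrow> F ((t, 0) + h) = 0"
    and x: "x \<in> axial_set W"
  shows "F x = 0"
proof -
  have W': "open W" "connected W" "cnj_closed W" using W by (auto simp: intrinsic_domain_def)
  obtain x0 v where xv: "x = (x0, v)" by (cases x)
  obtain \<omega> where \<omega>: "norm \<omega> = 1" "v = norm v *\<^sub>R \<omega>" by (rule slice_direction)
  have "F (Re z, Im z *\<^sub>R \<omega>) = 0" if "z \<in> W" for z
  proof (rule real_analytic_identity[OF slice_restriction_analytic[OF W'(1,3) F \<omega>(1)] W'(2)])
    show "open (W \<inter> ball (of_real t) \<rho>)" using W' by auto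
    show "W \<inter> ball (of_real t) \<rho> \<noteq> {}"
    proof -
      have "complex_of_real t \<in> W \<inter> ball (of_real t) \<rho>" using t \<open>\<rho> > 0\<close> by simp
      then show ?thesis by blast
    qed
    fix y assume "y \<in> W \<inter> ball (of_real t) \<rho>"
    then show "F (Re y, Im y *\<^sub>R \<omega>) = 0"
      using zero[OF slice_point_in_cube[OF _ \<omega>(1)], of y t] by simp
  qed (use that in auto)
  from this[of "Complex x0 (norm v)"] show ?thesis
    using x \<omega>(2) by (simp add: xv mem_axial_set[OF W'(3)])
qed

lemma unit_vect_pow:
  fixes \<omega> :: "real ^ 'n::{finite,linorder}"
  assumes "norm \<omega> = 1"
  shows "vect \<omega> ^ j = (if even j then (- 1) ^ (j div 2) *\<^sub>R 1 else (- 1) ^ (j div 2) *\<^sub>R vect \<omega>)"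
proof -
  have "\<omega> \<bullet> \<omega> = 1" using assms by (simp add: norm_eq_1)
  then have "vect \<omega> ^ (2 * i) = (- 1) ^ i *\<^sub>R 1" "vect \<omega> ^ Suc (2 * i) = (- 1) ^ i *\<^sub>R vect \<omega>" for i
    using vect_pow_even[of \<omega> i] vect_pow_odd[of \<omega> i] by simp_all
  note pow = this
  show ?thesis
  proof (cases "even j")
    case True
    then obtain i where "j = 2 * i" by (elim evenE)
    then show ?thesis using pow(1)[of i] by simp
  next
    case False
    then obtain i where "j = Suc (2 * i)" by (auto elim: oddE)
    then show ?thesis using pow(2)[of i] by simp
  qed
qed

text \<open>
  Near the axis the even powers of \<open>v = y \<omega>\<close> sum to a part independent of \<open>\<omega>\<close> and the odd powers to \<open>\<omega>\<close>
  times such a part. These parts are determined by two opposite directions, which defines \<open>A\<close> and \<open>B\<close> as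
  analytic functions on all of \<open>W\<close>. The formula for the other directions holds near the axis and
  spreads by the identity theorem.
\<close>

lemma axial_form_of_vect_series:
  fixes G :: "'n::{finite,linorder} paravector \<Rightarrow> 'n clifford"
  assumes W: "intrinsic_domain W" and G: "real_analytic_on G (axial_set W)"
    and t: "t \<in> real_part W" and "\<rho> > 0" and series: "vect_series t \<rho> G f"
  obtains A B where "real_analytic_on A W" "real_analytic_on B W"
    "\<And>z. z \<in> W \<Longrightarrow> A (cnj z) = A z \<and> B (cnj z) = - B z"
    "\<And>x. x \<in> axial_set W \<Longrightarrow> G x = axial_fun A B x"
proof -
  have W': "open W" "connected W" "cnj_closed W" using W by (auto simp: intrinsic_domain_def)
  define l :: 'n where "l = undefined"
  let ?\<omega> = "axis l 1 :: (real, 'n) vec"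
  define P where "P = (\<lambda>\<omega> z. G (Re z, Im z *\<^sub>R \<omega>))"
  define A where "A = (\<lambda>z. (1 / 2) *\<^sub>R (P ?\<omega> z + P (- ?\<omega>) z))"
  define B where "B = (\<lambda>z. - gen l * ((1 / 2) *\<^sub>R (P ?\<omega> z - P (- ?\<omega>) z)))"
  have P: "real_analytic_on (P \<omega>) W" if "norm \<omega> = 1" for \<omega>
    unfolding P_def by (rule slice_restriction_analytic[OF W'(1,3) G that])
  have nrm: "norm ?\<omega> = 1" "norm (- ?\<omega>) = 1" by simp_all
  have A: "real_analytic_on A W"
    unfolding A_def by (rule real_analytic_on_scaleR[OF real_analytic_on_add[OF P[OF nrm(1)] P[OF nrm(2)]]])
  have B: "real_analytic_on B W"
    unfolding B_def
    by (rule real_analytic_on_linear[OF real_analytic_on_scaleR[OF real_analytic_on_diff[OF P[OF nrm(1)] P[OF nrm(2)]]]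
          bounded_linear_clifford_mult_right])
  have near: "P \<omega> z = A z + vect \<omega> * B z" if \<omega>: "norm \<omega> = 1" and z: "z \<in> ball (of_real t) \<rho>" for \<omega> z
  proof -
    define a where "a = (\<lambda>j. if even j then (Im z ^ j * (- 1) ^ (j div 2)) *\<^sub>R f j (Re z) else 0)"
    define b where "b = (\<lambda>j. if odd j then (Im z ^ j * (- 1) ^ (j div 2)) *\<^sub>R f j (Re z) else 0)"
    have sums: "(\<lambda>j. a j + vect \<omega> * b j) sums P \<omega> z" if \<omega>: "norm \<omega> = 1" for \<omega>
    proof -
      have "vect (Im z *\<^sub>R \<omega>) ^ j * f j (Re z) = a j + vect \<omega> * b j" for j
        unfolding vect_scaleR power_of_scaleR unit_vect_pow[OF \<omega>] by (simp add: a_def b_def)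
      with vect_series_sums[OF series slice_point_in_cube[OF z \<omega>]] show ?thesis
        by (simp add: P_def)
    qed
    have "(\<lambda>j. (1 / 2) *\<^sub>R ((a j + gen l * b j) + (a j + - gen l * b j))) sums A z"
      unfolding A_def using sums[OF nrm(1)] sums[OF nrm(2)]
      by (intro bounded_linear.sums[OF bounded_linear_scaleR_right] sums_add) (simp_all add: vect_axis vect_uminus)
    moreover have "(1 / 2) *\<^sub>R ((a j + gen l * b j) + (a j + - gen l * b j)) = a j" for j
      by (simp flip: scaleR_2)
    ultimately have sa: "a sums A z" by simp
    have "(\<lambda>j. - gen l * ((1 / 2) *\<^sub>R ((a j + gen l * b j) - (a j + - gen l * b j)))) sums B z"
      unfolding B_def using sums[OF nrm(1)] sums[OF nrm(2)]
      by (intro bounded_linear.sums[OF bounded_linear_clifford_mult_right]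
            bounded_linear.sums[OF bounded_linear_scaleR_right] sums_diff) (simp_all add: vect_axis vect_uminus)
    moreover have "- gen l * ((1 / 2) *\<^sub>R ((a j + gen l * b j) - (a j + - gen l * b j))) = b j" for j
    proof -
      have "(1 / 2) *\<^sub>R ((a j + gen l * b j) - (a j + - gen l * b j)) = gen l * b j"
        by (simp flip: scaleR_2)
      then show ?thesis by (simp add: gen_square flip: mult.assoc)
    qed
    ultimately have sb: "b sums B z" by simp
    have "(\<lambda>j. a j + vect \<omega> * b j) sums (A z + vect \<omega> * B z)"
      by (intro sums_add sa bounded_linear.sums[OF bounded_linear_clifford_mult_right] sb)
    with sums[OF \<omega>] show ?thesis by (rule sums_unique2)
  qed
  have all: "P \<omega> z = A z + vect \<omega> * B z" if \<omega>: "norm \<omega> = 1" and z: "z \<in> W" for \<omega> z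
  proof -
    have "P \<omega> z - (A z + vect \<omega> * B z) = 0"
    proof (rule real_analytic_identity[OF _ W'(2) _ _ _ _ z])
      show "real_analytic_on (\<lambda>z. P \<omega> z - (A z + vect \<omega> * B z)) W"
        by (rule real_analytic_on_diff[OF P[OF \<omega>] real_analytic_on_add[OF A
              real_analytic_on_linear[OF B bounded_linear_clifford_mult_right]]])
      show "open (W \<inter> ball (of_real t) \<rho>)" using W' by auto
      have "complex_of_real t \<in> W \<inter> ball (of_real t) \<rho>" using t \<open>\<rho> > 0\<close> by simp
      then show "W \<inter> ball (of_real t) \<rho> \<noteq> {}" by blast
    qed (use near[OF \<omega>] in auto)
    then show ?thesis by simp
  qed
  show thesis
  proof (rule that[OF A B])
    fix z
    show "A (cnj z) = A z \<and> B (cnj z) = - B z"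
      by (simp add: A_def B_def P_def algebra_simps)
  next
    fix x :: "'n paravector" assume x: "x \<in> axial_set W"
    obtain x0 v where xv: "x = (x0, v)" by (cases x)
    let ?z = "Complex x0 (norm v)"
    have z: "?z \<in> W" using x by (simp add: xv mem_axial_set[OF W'(3)])
    show "G x = axial_fun A B x"
    proof (cases "v = 0")
      case True
      then show ?thesis by (simp add: xv axial_fun_def A_def P_def flip: scaleR_2)
    next
      case False
      then have "norm (v /\<^sub>R norm v) = 1" by simp
      from all[OF this z] show ?thesis
        using False by (simp add: xv axial_fun_def P_def vect_scaleR)
    qed
  qed
qed

lemma is_GCK_cong:
  assumes W: "open W" "cnj_closed W" and F: "is_GCK W f0 F"
    and "\<And>x. x \<in> axial_set W \<Longrightarrow> G x = F x" and "\<And>t. t \<in> real_part W \<Longrightarrow> g0 t = f0 t"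
  shows "is_GCK W g0 G"
proof -
  have sub: "axial_set V \<subseteq> (axial_set W :: 'a paravector set)" if "V \<subseteq> W" for V
    using that by (auto simp: axial_set_def)
  have line: "(t, 0) \<in> (axial_set W :: 'a paravector set)" if "t \<in> real_part W" for t
    using that by (simp add: mem_axial_set[OF W(2)] complex_of_real_def)
  have "dirac_op G x = dirac_op F x" if "x \<in> axial_set W" for x
    by (rule dirac_op_cong[OF open_axial_set[OF W] that assms(4)])
  then have "G \<in> axially_monogenic W"
    using F assms(4) unfolding is_GCK_def axially_monogenic_def
    by (auto intro: real_analytic_on_cong)
  moreover obtain V f where V: "open V \<and> cnj_closed V \<and> V \<subseteq> W \<and>
        (\<forall>t\<in>real_part W. of_real t \<in> V) \<and> (\<forall>z\<in>V. Re z \<in> real_part W) \<and>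
        (\<forall>j. real_analytic_on (f j) (real_part W)) \<and>
        (\<forall>(x0, v)\<in>axial_set V. (\<lambda>j. vect v ^ j * f j x0) sums F (x0, v))"
    using F unfolding is_GCK_def by blast
  then have "\<forall>(x0, v)\<in>axial_set V. (\<lambda>j. vect v ^ j * f j x0) sums G (x0, v)"
    using sub[of V] assms(4) by fastforce
  moreover have "\<forall>t\<in>real_part W. G (t, 0) = g0 t"
    using F assms(4,5) line unfolding is_GCK_def by simp
  ultimately show ?thesis using V unfolding is_GCK_def by blast
qed

lemma is_GCK_scaleR:
  assumes W: "open W" and F: "is_GCK W f0 F"
  shows "is_GCK W (\<lambda>t. c *\<^sub>R f0 t) (\<lambda>x. c *\<^sub>R F x)"
proof -
  obtain A B where M: "real_analytic_on F (axial_set W)" "\<forall>x\<in>axial_set W. dirac_op F x = 0"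
      "real_analytic_on A W" "real_analytic_on B W"
      "\<forall>z\<in>W. A (cnj z) = A z \<and> B (cnj z) = - B z" "\<forall>x\<in>axial_set W. F x = axial_fun A B x"
    using F unfolding is_GCK_def axially_monogenic_def by blast
  have "dirac_op (\<lambda>x. c *\<^sub>R F x) x = 0" if "x \<in> axial_set W" for x
    using dirac_op_linear_combination[OF M(1) M(1) that, of c 0] M(2) that by simp
  moreover have "\<forall>x\<in>axial_set W. c *\<^sub>R F x = axial_fun (\<lambda>z. c *\<^sub>R A z) (\<lambda>z. c *\<^sub>R B z) x"
    using M(6) by (auto simp: axial_fun_def scaleR_right_distrib mult.commute)
  moreover have "real_analytic_on (\<lambda>z. c *\<^sub>R A z) W" "real_analytic_on (\<lambda>z. c *\<^sub>R B z) W"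
      "real_analytic_on (\<lambda>x. c *\<^sub>R F x) (axial_set W)"
    using M by (auto intro: real_analytic_on_scaleR)
  ultimately have mono: "(\<lambda>x. c *\<^sub>R F x) \<in> axially_monogenic W"
    using M(5) unfolding axially_monogenic_def
    by (intro CollectI conjI ballI exI[of _ "\<lambda>z. c *\<^sub>R A z"] exI[of _ "\<lambda>z. c *\<^sub>R B z"]) auto
  obtain V f where V: "open V" "cnj_closed V" "V \<subseteq> W" "\<forall>t\<in>real_part W. of_real t \<in> V"
      "\<forall>z\<in>V. Re z \<in> real_part W" "\<forall>j. real_analytic_on (f j) (real_part W)"
      "\<forall>(x0, v)\<in>axial_set V. (\<lambda>j. vect v ^ j * f j x0) sums F (x0, v)"
    using F unfolding is_GCK_def by blast
  have "\<forall>(x0, v)\<in>axial_set V. (\<lambda>j. vect v ^ j * (c *\<^sub>R f j x0)) sums (c *\<^sub>R F (x0, v))"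
    using V(7) by (auto intro!: sums_scaleR_right)
  moreover have "\<forall>j. real_analytic_on (\<lambda>s. c *\<^sub>R f j s) (real_part W)"
    using V(6) by (auto intro: real_analytic_on_scaleR)
  moreover have "\<forall>t\<in>real_part W. c *\<^sub>R F (t, 0) = c *\<^sub>R f0 t"
    using F unfolding is_GCK_def by simp
  ultimately show ?thesis
    unfolding is_GCK_def using mono V(1-5)
    by (intro conjI exI[of _ V] exI[of _ "\<lambda>j s. c *\<^sub>R f j s"]) auto
qed

lemma real_analytic_on_line_derivative:
  fixes f :: "real \<Rightarrow> 'b::euclidean_space"
  assumes "real_analytic_on f U" "s \<in> U"
  shows "(f has_vector_derivative dir_deriv 1 f s) (at s)"
proof -
  have "((\<lambda>t. f (s + t *\<^sub>R 1)) has_vector_derivative dir_deriv 1 f s) (at (s - s))"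
    using real_analytic_on_has_vector_derivative[OF assms(1) _ assms(2)] by simp
  moreover have "((\<lambda>x. x - s) has_vector_derivative 1) (at s)"
    by (auto intro!: derivative_eq_intros simp flip: has_real_derivative_iff_has_vector_derivative)
  ultimately show ?thesis
    using vector_diff_chain_at[of "\<lambda>x. x - s" 1 s "\<lambda>t. f (s + t *\<^sub>R 1)"] by (simp add: o_def)
qed

text \<open>
  The vanishing of the Dirac operator is the recursion \<open>f\<^sub>j' = dirac_factor m (j + 1) f\<^bsub>j+1\<^esub>\<close> with positive
  factors, so all coefficients are determined by \<open>f\<^sub>0\<close>.
\<close>

lemma monogenic_series_zero:
  fixes F :: "'n::{finite,linorder} paravector \<Rightarrow> 'n clifford"
  assumes series: "vect_series t \<rho> F f" and "\<rho> > 0" and R: "{t - \<rho>..t + \<rho>} \<subseteq> R"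
    and f': "\<And>j s. s \<in> R \<Longrightarrow> (f j has_vector_derivative f' j s) (at s)"
    and dirac: "\<And>h. h \<in> cube \<rho> \<Longrightarrow> dirac_op F ((t, 0) + h) = 0"
    and f0: "\<And>s. s \<in> R \<Longrightarrow> f 0 s = 0" and s: "\<bar>s - t\<bar> < \<rho> / 2"
  shows "f j s = 0"
  using s
proof (induction j arbitrary: s)
  case 0
  then have "s \<in> {t - \<rho>..t + \<rho>}" using \<open>\<rho> > 0\<close> by (auto simp: abs_if split: if_splits)
  then show ?case using R by (intro f0) blast
next
  case (Suc j)
  have "vect_series t (\<rho> / 2) (dirac_op F) (\<lambda>j s. f' j s - dirac_factor CARD('n) (j + 1) *\<^sub>R f (j + 1) s)"
    by (rule vect_series_dirac[OF series R f']) (use \<open>\<rho> > 0\<close> in auto)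
  then have "f' j s - dirac_factor CARD('n) (j + 1) *\<^sub>R f (j + 1) s = 0"
    by (rule vect_series_zero) (use \<open>\<rho> > 0\<close> Suc.prems cube_mono[of "\<rho> / 2" \<rho>] dirac in auto)
  moreover have "f' j s = 0"
  proof (rule vector_derivative_unique_at)
    have "s \<in> {t - \<rho>..t + \<rho>}" using Suc.prems \<open>\<rho> > 0\<close> by (auto simp: abs_if split: if_splits)
    then have "s \<in> R" using R by blast
    then show "(f j has_vector_derivative f' j s) (at s)" by (rule f')
    show "(f j has_vector_derivative 0) (at s)"
      by (rule has_vector_derivative_transform_within_open[of "\<lambda>_. 0" _ _ "ball t (\<rho> / 2)"])
         (use Suc in \<open>auto simp: dist_real_def abs_minus_commute\<close>)
  qed
  moreover have "dirac_factor CARD('n) (j + 1) > 0"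
    by (auto simp: dirac_factor_def add_nonneg_pos)
  ultimately show ?case by simp
qed

text \<open>
  A generalized CK-extension comes with a series \<open>\<Sum> v\<^sup>j f\<^sub>j(x\<^sub>0)\<close> that converges only pointwise, which does not
  permit termwise differentiation. But \<open>F\<close> is analytic, and its two-variable expansion on the slice in
  direction \<open>e\<^sub>l\<close> has the coefficients \<open>e\<^sub>l\<^sup>j f\<^sub>j\<close>. Hence the convergence is normal, and the recursion for the
  coefficients applies.
\<close>

lemma GCK_difference_vanishes_nearby:
  fixes F :: "'n::{finite,linorder} paravector \<Rightarrow> 'n clifford"
  assumes W: "intrinsic_domain W" and F: "real_analytic_on F (axial_set W)"
    and dirac: "\<And>x. x \<in> axial_set W \<Longrightarrow> dirac_op F x = 0"
    and f: "\<And>j. real_analytic_on (f j) (real_part W)" and t: "t \<in> real_part W"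
    and e: "e > 0" "ball (of_real t) e \<subseteq> W"
    and sums: "\<And>x0 v. Complex x0 (norm v) \<in> ball (of_real t) e \<Longrightarrow> (\<lambda>j. vect v ^ j * f j x0) sums F (x0, v)"
    and zero: "\<And>s. s \<in> real_part W \<Longrightarrow> F (s, 0) = 0"
  obtains \<rho> where "\<rho> > 0" "\<And>h. h \<in> cube \<rho> \<Longrightarrow> F ((t, 0) + h) = 0"
proof -
  have W': "open W" "cnj_closed W" using W by (auto simp: intrinsic_domain_def)
  define l :: 'n where "l = undefined"
  let ?\<omega> = "axis l 1 :: (real, 'n) vec"
  have near: "(x0, v) \<in> axial_set W" "(\<lambda>j. vect v ^ j * f j x0) sums F (x0, v)"
    if "\<bar>x0 - t\<bar> < e / 2" "norm v < e / 2" for x0 and v :: "(real, 'n) vec"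
  proof -
    have "norm (Complex x0 (norm v) - of_real t) < e"
      using cmod_le[of "Complex x0 (norm v) - of_real t"] that by simp
    then have "Complex x0 (norm v) \<in> ball (of_real t) e" by (simp add: dist_norm norm_minus_commute)
    with e sums show "(x0, v) \<in> axial_set W" "(\<lambda>j. vect v ^ j * f j x0) sums F (x0, v)"
      by (auto simp: mem_axial_set[OF W'(2)])
  qed
  \<comment> \<open>The slice in the direction of a generator, as a function of two real variables.\<close>
  define \<Phi> where "\<Phi> = (\<lambda>z. F (Re z, Im z *\<^sub>R ?\<omega>))"
  have "real_analytic_on \<Phi> W"
    unfolding \<Phi>_def by (rule slice_restriction_analytic[OF W' F]) simp
  then obtain r M where r: "r > 0" "maj r (\<lambda>h. \<Phi> (of_real t + h)) M"
    using t by (auto elim: real_analytic_onE)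
  define \<rho> where "\<rho> = min r (e / 4)"
  have \<rho>: "\<rho> > 0" "\<rho> \<le> r" "\<rho> < e / 2" using r e by (auto simp: \<rho>_def)
  obtain \<psi> N where \<psi>: "\<And>j. maj \<rho> (\<psi> j :: real \<Rightarrow> 'n clifford) (N j)" "(\<lambda>j. N j * \<rho> ^ j) summable_on UNIV"
    and \<psi>_sum: "\<And>s r. \<bar>s\<bar> \<le> \<rho> \<Longrightarrow> \<bar>r\<bar> \<le> \<rho> \<Longrightarrow>
       ((\<lambda>j. r ^ j *\<^sub>R \<psi> j s) has_sum \<Phi> (of_real t + Complex s r)) UNIV"
    using maj_slices[OF maj_smaller_cube[OF r(2) \<rho>(1,2)] \<rho>(1)] by blast
  have coeff: "\<psi> j s = gen l ^ j * f j (t + s)" if s: "\<bar>s\<bar> \<le> \<rho>" for j s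
  proof -
    have "\<psi> j s - gen l ^ j * f j (t + s) = 0"
    proof (rule power_series_zero[OF \<rho>(1), of "\<lambda>j. \<psi> j s - gen l ^ j * f j (t + s)"])
      fix y :: real assume y: "\<bar>y\<bar> < \<rho>"
      have "(\<lambda>j. vect (y *\<^sub>R ?\<omega>) ^ j * f j (t + s)) sums F (t + s, y *\<^sub>R ?\<omega>)"
        using s y \<rho> by (intro near(2)) auto
      moreover have "(\<lambda>j. y ^ j *\<^sub>R \<psi> j s) sums F (t + s, y *\<^sub>R ?\<omega>)"
        using has_sum_imp_sums[OF \<psi>_sum[OF s, of y]] y by (simp add: \<Phi>_def)
      ultimately show "(\<lambda>j. y ^ j *\<^sub>R (\<psi> j s - gen l ^ j * f j (t + s))) sums 0"
        using sums_diff by (fastforce simp: vect_scaleR vect_axis power_of_scaleR scaleR_right_diff_distrib)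
    qed
    then show ?thesis by simp
  qed
  obtain K where K: "K > 0" and Kb: "\<And>x y :: 'n clifford. norm (x * y) \<le> norm x * norm y * K"
    using bounded_bilinear.pos_bounded[OF bounded_bilinear_clifford_mult] by blast
  have Kn: "norm (gen l * x) \<le> K * norm (gen l) * norm x" for x :: "'n clifford"
    using Kb[of "gen l" x] by (simp add: mult_ac)
  define C where "C = 1 + K * norm (gen l :: 'n clifford)"
  have C: "C \<ge> 1" "norm ((- gen l) ^ j * x) \<le> C * norm x" for j and x :: "'n clifford"
  proof -
    show "C \<ge> 1" using K by (simp add: C_def)
    have "(- gen l) ^ j = (if even j then (- 1) ^ (j div 2) *\<^sub>R 1 else (- 1) ^ (j div 2) *\<^sub>R (- gen l :: 'n clifford))"
      using unit_vect_pow[of "- ?\<omega>" j] by (simp add: vect_axis vect_uminus)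
    then have "norm ((- gen l) ^ j * x) = norm x \<or> norm ((- gen l) ^ j * x) = norm (gen l * x)"
      by simp
    moreover have "0 \<le> K * norm (gen l :: 'n clifford) * norm x" using K by simp
    then have "norm (gen l * x) \<le> C * norm x" "norm x \<le> C * norm x"
      using Kn[of x] norm_ge_zero[of x] unfolding C_def distrib_right by linarith+
    ultimately show "norm ((- gen l) ^ j * x) \<le> C * norm x" by auto
  qed
  have cancel: "(- gen l) ^ j * (gen l ^ j * x) = x" for j and x :: "'n clifford"
  proof -
    have "(- gen l) ^ j * gen l ^ j = (1 :: 'n clifford)"
    proof (induction j)
      case (Suc j)
      have "(- gen l) ^ Suc j * gen l ^ Suc j = - gen l * ((- gen l) ^ j * gen l ^ j) * gen l"
        by (simp only: power_Suc power_Suc2 mult.assoc) (simp add: power_commutes)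
      then show ?case using Suc by (simp add: gen_square)
    qed simp
    then show ?thesis by (simp flip: mult.assoc)
  qed
  have m: "maj \<rho> (\<lambda>s. f j (t + s)) (C * N j)" for j
  proof -
    have "maj \<rho> (\<lambda>s. (- gen l) ^ j * \<psi> j s) (C * N j)"
      by (rule maj_linear[OF \<rho>(1) bounded_linear_clifford_mult_right C(2) _ \<psi>(1)]) (use C(1) in simp)
    then show ?thesis by (rule maj_cong) (simp add: coeff cancel cube_def)
  qed
  have "(\<lambda>j. C * (N j * \<rho> ^ j)) summable_on UNIV"
    by (rule summable_on_cmult_right[OF \<psi>(2)])
  then have Ns: "(\<lambda>j. (C * N j) * \<rho> ^ j) summable_on UNIV" by (simp add: mult.assoc)
  have "e / 2 > 0" using e by simp
  then obtain \<rho>1 where \<rho>1: "\<rho>1 > 0"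
    and small: "\<And>h0 v. (h0, v) \<in> (cube \<rho>1 :: 'n paravector set) \<Longrightarrow> \<bar>h0\<bar> < e / 2 \<and> norm v < e / 2"
    using small_cube_paravector by blast
  obtain \<rho>' where \<rho>': "\<rho>' > 0" "\<rho>' \<le> \<rho>" "\<rho>' \<le> \<rho>1" "vect_series t \<rho>' F f"
  proof (rule vect_series_of_coefficients[OF \<rho>(1) \<rho>1 m Ns])
    fix h0 :: real and v :: "(real, 'n) vec" assume "(h0, v) \<in> cube \<rho>1"
    then show "(\<lambda>j. vect v ^ j * f j (t + h0)) sums F (t + h0, v)"
      using small by (intro near(2)) auto
  qed
  have R: "{t - \<rho>'..t + \<rho>'} \<subseteq> real_part W"
  proof
    fix s assume "s \<in> {t - \<rho>'..t + \<rho>'}"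
    then have "\<bar>s - t\<bar> < e" using \<rho> \<rho>' e by (auto simp: abs_less_iff)
    then have "complex_of_real s \<in> ball (of_real t) e"
      by (simp add: dist_complex_def norm_minus_commute flip: of_real_diff)
    then show "s \<in> real_part W" using e by auto
  qed
  have f0: "f 0 s = 0" if s: "\<bar>s - t\<bar> < e / 2" for s
  proof -
    have "complex_of_real s \<in> ball (of_real t) e"
      using s e by (simp add: dist_complex_def abs_minus_commute[of t s] flip: of_real_diff)
    then have "s \<in> real_part W" using e by auto
    moreover have "(\<lambda>j. vect 0 ^ j * f j s) sums F (s, 0)" using s e by (intro near(2)) auto
    note sums_unique2[OF this vect_series_at_axis]
    ultimately show ?thesis using zero[of s] by simp
  qed
  have coeffs0: "f j s = 0" if "\<bar>s - t\<bar> < \<rho>' / 2" for j s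
  proof (rule monogenic_series_zero[OF \<rho>'(4,1), of "{t - \<rho>'..t + \<rho>'}"])
    show "(f j has_vector_derivative dir_deriv 1 (f j) s) (at s)" if "s \<in> {t - \<rho>'..t + \<rho>'}" for j s
      by (rule real_analytic_on_line_derivative[OF f]) (use R that in auto)
    show "dirac_op F ((t, 0) + h) = 0" if "h \<in> cube \<rho>'" for h
    proof (cases h)
      case (Pair h0 v)
      then have "(h0, v) \<in> cube \<rho>1" using that cube_mono[OF \<rho>'(3)] by auto
      then show ?thesis using small[of h0 v] Pair by (simp, intro dirac near(1)) auto
    qed
    show "f 0 s = 0" if "s \<in> {t - \<rho>'..t + \<rho>'}" for s
      by (rule f0) (use that \<rho> \<rho>' in \<open>auto simp: abs_if split: if_splits\<close>)
  qed (use that in auto)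
  show thesis
  proof (rule that[of "\<rho>' / 4"])
    show "\<rho>' / 4 > 0" using \<rho>' by simp
    fix h :: "'n paravector" assume h: "h \<in> cube (\<rho>' / 4)"
    obtain h0 v where hv: "h = (h0, v)" by (cases h)
    have "\<bar>h0\<bar> \<le> \<rho>' / 4" using h by (simp add: hv in_cube_paravector)
    moreover have "(t + h0 - t, v) \<in> cube \<rho>'"
      using h cube_mono[of "\<rho>' / 4" \<rho>'] \<rho>' by (auto simp: hv)
    ultimately have "(\<lambda>j. 0) sums F (t + h0, v)"
      using vect_series_sums[OF \<rho>'(4), of "t + h0" v] \<rho>' by (simp add: coeffs0)
    from sums_unique2[OF this sums_zero] show "F ((t, 0) + h) = 0" by (simp add: hv)
  qed
qed

text \<open>
  The difference of two extensions vanishes near a real point, hence everywhere by the identity theorem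
  on the slices.
\<close>

theorem GCK_unique:
  fixes F1 F2 :: "'n::{finite,linorder} paravector \<Rightarrow> 'n clifford"
  assumes W: "intrinsic_domain W" and 1: "is_GCK W f0 F1" and 2: "is_GCK W f0 F2" and x: "x \<in> axial_set W"
  shows "F1 x = F2 x"
proof -
  have W': "open W" "cnj_closed W" using W by (auto simp: intrinsic_domain_def)
  obtain t where t: "t \<in> real_part W" using intrinsic_domain_meets_reals[OF W] by blast
  define F where "F = (\<lambda>x. F1 x - F2 x)"
  have an: "real_analytic_on F1 (axial_set W)" "real_analytic_on F2 (axial_set W)"
    using 1 2 by (auto simp: is_GCK_def axially_monogenic_def)
  have F: "real_analytic_on F (axial_set W)" unfolding F_def by (rule real_analytic_on_diff[OF an])
  have dirac: "dirac_op F x = 0" if "x \<in> axial_set W" for x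
    using dirac_op_linear_combination[OF an that, of 1 "- 1"] 1 2 that
    by (auto simp: F_def is_GCK_def axially_monogenic_def)
  obtain V1 f1 where 11: "open V1" "cnj_closed V1" "\<forall>t\<in>real_part W. of_real t \<in> V1"
      "\<forall>j. real_analytic_on (f1 j) (real_part W)"
      "\<forall>(x0, v)\<in>axial_set V1. (\<lambda>j. vect v ^ j * f1 j x0) sums F1 (x0, v)"
    using 1 unfolding is_GCK_def by blast
  obtain V2 f2 where 22: "open V2" "cnj_closed V2" "\<forall>t\<in>real_part W. of_real t \<in> V2"
      "\<forall>j. real_analytic_on (f2 j) (real_part W)"
      "\<forall>(x0, v)\<in>axial_set V2. (\<lambda>j. vect v ^ j * f2 j x0) sums F2 (x0, v)"
    using 2 unfolding is_GCK_def by blast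
  have "open (W \<inter> V1 \<inter> V2)" "complex_of_real t \<in> W \<inter> V1 \<inter> V2"
    using W' 11 22 t by auto
  then obtain e where e: "e > 0" "ball (of_real t) e \<subseteq> W \<inter> V1 \<inter> V2" using openE by blast
  obtain \<rho> where "\<rho> > 0" "\<And>h. h \<in> cube \<rho> \<Longrightarrow> F ((t, 0) + h) = 0"
  proof (rule GCK_difference_vanishes_nearby[OF W F dirac _ t e(1)])
    show "real_analytic_on (\<lambda>s. f1 j s - f2 j s) (real_part W)" for j
      using 11(4) 22(4) by (intro real_analytic_on_diff) auto
    show "ball (of_real t) e \<subseteq> W" using e by auto
    show "F (s, 0) = 0" if "s \<in> real_part W" for s
      using 1 2 that by (simp add: F_def is_GCK_def)
    fix x0 and v :: "(real, 'n) vec" assume "Complex x0 (norm v) \<in> ball (of_real t) e"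
    then have "Complex x0 (norm v) \<in> V1" "Complex x0 (norm v) \<in> V2" using e by auto
    then have "(x0, v) \<in> axial_set V1" "(x0, v) \<in> axial_set V2"
      by (simp_all add: mem_axial_set 11(2) 22(2))
    then have "(\<lambda>j. vect v ^ j * f1 j x0 - vect v ^ j * f2 j x0) sums (F1 (x0, v) - F2 (x0, v))"
      using 11(5) 22(5) by (intro sums_diff) auto
    then show "(\<lambda>j. vect v ^ j * (f1 j x0 - f2 j x0)) sums F (x0, v)"
      by (simp add: F_def right_diff_distrib)
  next
    fix \<rho> :: real assume "\<rho> > 0" "\<And>h. h \<in> cube \<rho> \<Longrightarrow> F ((t, 0) + h) = 0"
    then show thesis by (rule that)
  qed
  from axial_identity[OF W F t this x] show ?thesis by (simp add: F_def)
qed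

corollary GCK_eq:
  fixes F :: "'n::{finite,linorder} paravector \<Rightarrow> 'n clifford"
  assumes W: "intrinsic_domain W" and F: "is_GCK W f0 F" and x: "x \<in> axial_set W"
  shows "GCK W f0 x = F x"
proof -
  \<comment> \<open>The normalization that makes the extension unique as a total function.\<close>
  define G where "G = (\<lambda>x. if x \<in> axial_set W then F x else 0)"
  have "is_GCK W f0 G"
    by (rule is_GCK_cong[OF _ _ F]) (use W in \<open>auto simp: G_def intrinsic_domain_def\<close>)
  then have "GCK W f0 = G"
    unfolding GCK_def
    by (intro the_equality) (auto simp: G_def fun_eq_iff intro: GCK_unique[OF W _ F])
  then show ?thesis using x by (simp add: G_def)
qed

section \<open>Iterated Laplacians of slice functions\<close>

text \<open>
  Applying the Laplacian \<open>k\<close> times to \<open>\<Sum> v\<^sup>j f\<^bsup>(j)\<^esup>(x\<^sub>0) / j!\<close> multiplies the \<open>j\<close>-th coefficient by this number, where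
  \<open>p\<close> is \<open>j\<close> rounded up to an even number, and replaces \<open>f\<close> by \<open>f\<^bsup>(2k)\<^esup>\<close>.
\<close>

definition lap_coeff :: "nat \<Rightarrow> nat \<Rightarrow> real \<Rightarrow> real" where
  "lap_coeff m k p = (\<Prod>l<k. (2 * real l + 1 - real m) / (p + 2 * real l + 1))"

text \<open>
  Shifting \<open>p\<close> by 2 shifts the denominators by one index, so all factors but the first and the last cancel.
\<close>

lemma lap_coeff_shift:
  assumes "p \<ge> 0"
  shows "lap_coeff m k (p + 2) * (p + 2 * real k + 1) = lap_coeff m k p * (p + 1)"
proof (induction k)
  case (Suc k)
  have "lap_coeff m (Suc k) (p + 2) * (p + 2 * real (Suc k) + 1)
      = lap_coeff m k (p + 2) * (2 * real k + 1 - real m)"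
    using assms by (simp add: lap_coeff_def field_simps)
  also have "\<dots> = (lap_coeff m k (p + 2) * (p + 2 * real k + 1)) * ((2 * real k + 1 - real m) / (p + 2 * real k + 1))"
    using assms by (simp add: field_simps add_nonneg_eq_0_iff)
  also have "\<dots> = lap_coeff m (Suc k) p * (p + 1)"
    unfolding Suc by (simp add: lap_coeff_def)
  finally show ?case .
qed (simp add: lap_coeff_def)

lemma lap_coeff_Suc:
  assumes "p \<ge> 0"
  shows "lap_coeff m (Suc k) p = lap_coeff m k p - (p + real m) / (p + 1) * lap_coeff m k (p + 2)"
proof -
  have pos: "p + 1 > 0" "p + 2 * real k + 1 > 0" using assms by (auto intro: add_nonneg_pos)
  have "lap_coeff m k (p + 2) = lap_coeff m k p * (p + 1) / (p + 2 * real k + 1)"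
    using lap_coeff_shift[OF assms, of m k] pos by (simp add: field_simps)
  then have "lap_coeff m k p - (p + real m) / (p + 1) * lap_coeff m k (p + 2)
      = lap_coeff m k p * (1 - (p + real m) / (p + 2 * real k + 1))"
    using pos by (simp add: field_simps)
  also have "1 - (p + real m) / (p + 2 * real k + 1) = (2 * real k + 1 - real m) / (p + 2 * real k + 1)"
    using pos by (simp add: field_simps)
  finally show ?thesis by (simp add: lap_coeff_def)
qed

definition round_even :: "nat \<Rightarrow> real" where
  "round_even j = real (if even j then j else j + 1)"

lemma lap_coeff_laplacian_step:
  "lap_coeff m k (round_even j) / fact j - lap_factor m (j + 2) * (lap_coeff m k (round_even (j + 2)) / fact (j + 2))
     = lap_coeff m (Suc k) (round_even j) / fact j"
proof -
  let ?p = "round_even j"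
  have f: "fact (j + 2) = (real j + 2) * (real j + 1) * (fact j :: real)"
    by (simp add: algebra_simps)
  have l: "lap_factor m (j + 2) / ((real j + 2) * (real j + 1)) = (?p + real m) / (?p + 1)"
  proof (cases "even j")
    case True
    then have "lap_factor m (j + 2) = (real j + 2) * (real j + real m)"
      by (auto simp: lap_factor_def Let_def elim!: evenE)
    then show ?thesis using True by (simp add: round_even_def)
  next
    case False
    then have "lap_factor m (j + 2) = (real j + 1) * (real j + 1 + real m)"
      by (auto simp: lap_factor_def Let_def elim!: oddE)
    then show ?thesis using False by (simp add: round_even_def add_ac)
  qed
  have "lap_factor m (j + 2) * (lap_coeff m k (round_even (j + 2)) / fact (j + 2))
      = lap_factor m (j + 2) / ((real j + 2) * (real j + 1)) * lap_coeff m k (?p + 2) / fact j"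
    unfolding f by (simp add: round_even_def field_simps)
  also have "\<dots> = (?p + real m) / (?p + 1) * lap_coeff m k (?p + 2) / fact j" unfolding l ..
  finally have eq: "lap_factor m (j + 2) * (lap_coeff m k (round_even (j + 2)) / fact (j + 2))
      = (?p + real m) / (?p + 1) * lap_coeff m k (?p + 2) / fact j" .
  have "?p \<ge> 0" by (simp add: round_even_def)
  from lap_coeff_Suc[OF this, of m k] show ?thesis
    unfolding eq by (simp add: diff_divide_distrib)
qed

text \<open>
  Here the oddness of the dimension enters: for \<open>m = 2 n + 1\<close> the ratio of neighbouring coefficients is
  the one that the Dirac operator requires.
\<close>

lemma lap_coeff_dirac_step:
  assumes "m = 2 * n + 1"
  shows "lap_coeff m n (round_even j) / fact j = dirac_factor m (j + 1) * (lap_coeff m n (round_even (j + 1)) / fact (j + 1))"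
proof (cases "even j")
  case True
  have "lap_coeff m n (real j + 2) * (real j + real m) = lap_coeff m n (real j) * (real j + 1)"
    using lap_coeff_shift[of "real j" m n] assms by (simp add: algebra_simps)
  then have "(real j + real m) * (lap_coeff m n (real j + 2) / ((real j + 1) * fact j))
      = lap_coeff m n (real j) * (real j + 1) / ((real j + 1) * fact j)"
    by (simp add: mult.commute)
  also have "\<dots> = lap_coeff m n (real j) / fact j" by simp
  finally show ?thesis
    using True by (simp add: round_even_def dirac_factor_def add.commute)
next
  case False
  have "(real j + 1) * (lap_coeff m n (real j + 1) / ((real j + 1) * fact j)) = lap_coeff m n (real j + 1) / fact j"
    by simp
  then show ?thesis using False by (simp add: round_even_def dirac_factor_def add.commute)
qed

context slice_family
begin

text \<open>
  Near the axis the series in powers of \<open>v\<close> converges normally. Off the axis \<open>\<bar>v\<bar>\<close> and \<open>1 / \<bar>v\<bar>\<close> are analytic,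
  and the slice function is composed of analytic functions.
\<close>

lemma real_analytic_on_slice: "real_analytic_on slice (axial_set W)"
proof (rule real_analytic_onI[OF open_axial_set[OF open_W cnj_W]])
  fix a :: "'n paravector" assume a: "a \<in> axial_set W"
  obtain x0 v where av: "a = (x0, v)" by (cases a)
  show "\<exists>\<rho>>0. \<exists>M. maj \<rho> (\<lambda>h. slice (a + h)) M"
  proof (cases "v = 0")
    case True
    then have "x0 \<in> real_part W" using a by (simp add: av mem_axial_set[OF cnj_W] complex_of_real_def)
    then obtain \<rho> where "\<rho> > 0" "vect_series x0 \<rho> slice (\<lambda>j s. real_jet j s /\<^sub>R fact j)"
      using slice_vect_series by blast
    then show ?thesis
      using maj_series_maj unfolding vect_series_def av True by blast
  next
    case False
    define U where "U = (axial_set W :: 'n paravector set) \<inter> {x. snd x \<noteq> 0}"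
    have "open {x :: 'n paravector. snd x \<noteq> 0}"
      by (intro open_Collect_neq continuous_intros)
    then have U: "open U" unfolding U_def by (intro open_Int open_axial_set open_W cnj_W)
    have n: "real_analytic_on (\<lambda>x. norm (snd x)) U"
      by (rule real_analytic_on_norm_snd[OF U]) (simp add: U_def)
    have z: "real_analytic_on (\<lambda>x. of_real (fst x) + \<i> * of_real (norm (snd x))) U"
      by (rule real_analytic_on_add[OF
            real_analytic_on_linear[OF real_analytic_on_bounded_linear[OF bounded_linear_fst U] bounded_linear_of_real]
            real_analytic_on_linear[OF n bounded_linear_compose[OF bounded_linear_mult_right bounded_linear_of_real]]])
    have zW: "(\<lambda>x. of_real (fst x) + \<i> * of_real (norm (snd x))) ` U \<subseteq> W"
      by (auto simp: U_def mem_axial_set[OF cnj_W] Complex_eq)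
    have gz: "real_analytic_on (\<lambda>x. g A (of_real (fst x) + \<i> * of_real (norm (snd x)))) U" for A
      using real_analytic_on_compose[OF real_analytic_on_holomorphic[OF holo[of 0 A] open_W] z zW] by simp
    have part: "real_analytic_on (\<lambda>x. \<Sum>A\<in>UNIV. L (g A (of_real (fst x) + \<i> * of_real (norm (snd x)))) *\<^sub>R (blade A :: 'n clifford)) U"
      if L: "bounded_linear L" for L
      by (rule real_analytic_on_sum[OF finite U],
          rule real_analytic_on_linear[OF real_analytic_on_linear[OF gz L] bounded_linear_scaleR_left])
    have inv: "real_analytic_on (\<lambda>x. inverse (norm (snd x))) U"
      by (rule real_analytic_on_compose[OF real_analytic_on_inverse n]) (auto simp: U_def)
    have vec: "real_analytic_on (\<lambda>x :: 'n paravector. vect (snd x)) U"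
      by (rule real_analytic_on_bounded_linear[OF bounded_linear_compose[OF bounded_linear_vect bounded_linear_snd] U])
    have an: "real_analytic_on slice U"
      using real_analytic_on_add[OF part[OF bounded_linear_Re]
          real_analytic_on_bilinear[OF bounded_bilinear_clifford_mult
            real_analytic_on_bilinear[OF bounded_bilinear_scaleR inv vec] part[OF bounded_linear_Im]]]
      by (rule real_analytic_on_cong) (auto simp: slice_def axial_fun_def Complex_eq)
    have "a \<in> U" using a False by (simp add: U_def av)
    then obtain \<rho> M where "\<rho> > 0" "maj \<rho> (\<lambda>h. slice (a + h)) M" by (rule real_analytic_onE[OF an])
    then show ?thesis by blast
  qed
qed

lemma real_analytic_on_laplacian_slice: "real_analytic_on ((laplacian ^^ k) slice) (axial_set W)"
  by (induction k) (simp_all add: real_analytic_on_slice real_analytic_on_laplacian)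

lemma laplacian_slice_vect_series:
  assumes t: "t \<in> real_part W"
  shows "\<exists>\<rho>>0. {t - \<rho>..t + \<rho>} \<subseteq> real_part W \<and> vect_series t \<rho> ((laplacian ^^ k) slice)
     (\<lambda>j s. (lap_coeff CARD('n) k (round_even j) / fact j) *\<^sub>R real_jet (j + 2 * k) s)"
proof (induction k)
  case 0
  then show ?case
    using slice_vect_series[OF t] by (auto simp: lap_coeff_def divide_inverse)
next
  case (Suc k)
  let ?c = "\<lambda>k j. lap_coeff CARD('n) k (round_even j) / fact j"
  obtain \<rho> where \<rho>: "\<rho> > 0" "{t - \<rho>..t + \<rho>} \<subseteq> real_part W"
    "vect_series t \<rho> ((laplacian ^^ k) slice) (\<lambda>j s. ?c k j *\<^sub>R real_jet (j + 2 * k) s)"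
    using Suc by blast
  have D: "((\<lambda>s. r *\<^sub>R real_jet i s) has_vector_derivative r *\<^sub>R real_jet (Suc i) s) (at s)"
    if "s \<in> real_part W" for r i s
    by (rule bounded_linear.has_vector_derivative[OF bounded_linear_scaleR_right real_jet_derivative[OF that]])
  have "vect_series t (\<rho> / 2) (laplacian ((laplacian ^^ k) slice))
      (\<lambda>j s. ?c k j *\<^sub>R real_jet (Suc (Suc (j + 2 * k))) s
         - lap_factor CARD('n) (j + 2) *\<^sub>R (?c k (j + 2) *\<^sub>R real_jet (j + 2 + 2 * k) s))"
    by (rule vect_series_laplacian[OF \<rho>(3) open_real_part[OF open_W] \<rho>(2) D D]) (use \<rho> in auto)
  moreover have "?c k j *\<^sub>R real_jet (Suc (Suc (j + 2 * k))) s
         - lap_factor CARD('n) (j + 2) *\<^sub>R (?c k (j + 2) *\<^sub>R real_jet (j + 2 + 2 * k) s)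
      = ?c (Suc k) j *\<^sub>R real_jet (j + 2 * Suc k) s" for j s
    unfolding lap_coeff_laplacian_step[symmetric] by (simp add: scaleR_left_diff_distrib)
  ultimately have "vect_series t (\<rho> / 2) ((laplacian ^^ Suc k) slice) (\<lambda>j s. ?c (Suc k) j *\<^sub>R real_jet (j + 2 * Suc k) s)"
    by simp
  moreover have "{t - \<rho> / 2..t + \<rho> / 2} \<subseteq> {t - \<rho>..t + \<rho>}" using \<rho>(1) by auto
  ultimately show ?case using \<rho> by (intro exI[of _ "\<rho> / 2"]) auto
qed

text \<open>
  All defining properties hold near the real axis, where the function is an explicit series. Its Dirac
  derivative is analytic, so its vanishing spreads over the domain, and so does the axial form.
\<close>

theorem laplacian_slice_is_GCK:
  assumes m: "CARD('n) = 2 * n + 1"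
  shows "is_GCK W (\<lambda>t. lap_coeff CARD('n) n 0 *\<^sub>R real_jet (2 * n) t) ((laplacian ^^ n) slice)"
proof -
  define G where "G = (laplacian ^^ n) slice"
  define f where "f = (\<lambda>j s. (lap_coeff CARD('n) n (round_even j) / fact j) *\<^sub>R real_jet (j + 2 * n) s)"
  have G: "real_analytic_on G (axial_set W)"
    unfolding G_def by (rule real_analytic_on_laplacian_slice)
  have series: "\<exists>\<rho>>0. {t - \<rho>..t + \<rho>} \<subseteq> real_part W \<and> vect_series t \<rho> G f" if "t \<in> real_part W" for t
    unfolding G_def f_def by (rule laplacian_slice_vect_series[OF that])
  obtain t where t: "t \<in> real_part W" using intrinsic_domain_meets_reals[OF domain] by blast
  obtain \<rho> where \<rho>: "\<rho> > 0" "{t - \<rho>..t + \<rho>} \<subseteq> real_part W" "vect_series t \<rho> G f"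
    using series[OF t] by blast
  have dirac: "dirac_op G x = 0" if "x \<in> axial_set W" for x
  proof -
    have "vect_series t (\<rho> / 2) (dirac_op G)
      (\<lambda>j s. (lap_coeff CARD('n) n (round_even j) / fact j) *\<^sub>R real_jet (Suc (j + 2 * n)) s
        - dirac_factor CARD('n) (j + 1) *\<^sub>R f (j + 1) s)"
      by (rule vect_series_dirac[OF \<rho>(3) \<rho>(2)])
         (use \<rho>(1) in \<open>auto simp: f_def intro!: bounded_linear.has_vector_derivative[OF bounded_linear_scaleR_right]
            real_jet_derivative\<close>)
    moreover have "(lap_coeff CARD('n) n (round_even j) / fact j) *\<^sub>R real_jet (Suc (j + 2 * n)) s
        - dirac_factor CARD('n) (j + 1) *\<^sub>R f (j + 1) s = 0" for j s
      using lap_coeff_dirac_step[OF m, of j, symmetric] unfolding f_def scaleR_scaleR by simp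
    ultimately have z: "vect_series t (\<rho> / 2) (dirac_op G) (\<lambda>j s. 0)" by simp
    have "dirac_op G ((t, 0) + h) = 0" if "h \<in> cube (\<rho> / 2)" for h
    proof (cases h)
      case (Pair h0 v)
      have "(t + h0 - t, v) \<in> cube (\<rho> / 2)" using that by (simp add: Pair)
      from vect_series_sums[OF z this] have "(\<lambda>j. 0) sums dirac_op G (t + h0, v)" by simp
      from sums_unique2[OF this sums_zero] show ?thesis by (simp add: Pair)
    qed
    then show ?thesis
      using axial_identity[OF domain real_analytic_on_dirac_op[OF G] t, of "\<rho> / 2"] \<rho>(1) that by simp
  qed
  obtain A B where "real_analytic_on A W" "real_analytic_on B W"
    "\<And>z. z \<in> W \<Longrightarrow> A (cnj z) = A z \<and> B (cnj z) = - B z" "\<And>x. x \<in> axial_set W \<Longrightarrow> G x = axial_fun A B x"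
    using axial_form_of_vect_series[OF domain G t \<rho>(1,3)] by metis
  with G dirac have mono: "G \<in> axially_monogenic W"
    unfolding axially_monogenic_def by blast
  \<comment> \<open>The radius of convergence depends on the real point, so the set over which the series converges is a union of balls.\<close>
  define near where "near = (\<lambda>t e. ball (complex_of_real t) e \<subseteq> W \<and>
     (\<forall>x0 v. Complex x0 (norm v) \<in> ball (of_real t) e \<longrightarrow> (\<lambda>j. vect v ^ j * f j x0) sums G (x0, v)))"
  define V where "V = \<Union> {ball (complex_of_real t) e |t e. near t e}"
  have "\<exists>e>0. near t e" if t': "t \<in> real_part W" for t
  proof -
    obtain \<rho> where \<rho>: "\<rho> > 0" "vect_series t \<rho> G f" using series[OF t'] by blast
    obtain e where e: "e > 0" "ball (of_real t) e \<subseteq> W" using openE[OF open_W] t' by auto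
    have "near t (min e \<rho>)"
      unfolding near_def
    proof (intro conjI allI impI)
      show "ball (of_real t) (min e \<rho>) \<subseteq> W" using e by auto
      fix x0 and v :: "(real, 'n) vec" assume "Complex x0 (norm v) \<in> ball (of_real t) (min e \<rho>)"
      then have b: "Complex x0 (norm v) \<in> ball (of_real t) \<rho>" by simp
      obtain \<omega> where \<omega>: "norm \<omega> = 1" "v = norm v *\<^sub>R \<omega>" by (rule slice_direction)
      have "(x0 - t, v) \<in> cube \<rho>"
        using slice_point_in_cube[OF b \<omega>(1)] unfolding complex.sel \<omega>(2)[symmetric] .
      then show "(\<lambda>j. vect v ^ j * f j x0) sums G (x0, v)" by (rule vect_series_sums[OF \<rho>(2)])
    qed
    then show ?thesis using e \<rho> by (intro exI[of _ "min e \<rho>"]) auto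
  qed
  then have line: "complex_of_real t \<in> V" if "t \<in> real_part W" for t
    using that centre_in_ball unfolding V_def by blast
  have oV: "open V" unfolding V_def by auto
  have cV: "cnj_closed V"
  proof -
    have "dist (complex_of_real t) (cnj z) = dist (of_real t) z" for t z
      by (metis complex_cnj_complex_of_real complex_cnj_diff complex_mod_cnj dist_norm)
    note dist_cnj = this
    show ?thesis
      unfolding cnj_closed_def
    proof
      fix z assume "z \<in> V"
      then obtain t e where te: "z \<in> ball (of_real t) e" "near t e" unfolding V_def by blast
      then have "cnj z \<in> ball (of_real t) e" by (simp add: dist_cnj)
      with te(2) show "cnj z \<in> V" unfolding V_def by blast
    qed
  qed
  have VW: "V \<subseteq> W" unfolding V_def near_def by auto
  have ReV: "Re z \<in> real_part W" if zV: "z \<in> V" for z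
  proof -
    obtain t e where te: "z \<in> ball (of_real t) e" "near t e" using zV unfolding V_def by blast
    have "norm (complex_of_real t - of_real (Re z)) \<le> norm (of_real t - z)"
      using abs_Re_le_cmod[of "of_real t - z"] by (simp flip: of_real_diff)
    then have "complex_of_real (Re z) \<in> ball (of_real t) e" using te by (simp add: dist_norm)
    then show ?thesis using te(2) unfolding near_def by auto
  qed
  have sumsV: "\<forall>(x0, v)\<in>axial_set V. (\<lambda>j. vect v ^ j * f j x0) sums G (x0, v)"
    using mem_axial_set[OF cV] unfolding V_def near_def by blast
  have an: "real_analytic_on (f j) (real_part W)" for j
    unfolding f_def by (rule real_analytic_on_scaleR[OF real_analytic_on_real_jet])
  have init: "G (t, 0) = lap_coeff CARD('n) n 0 *\<^sub>R real_jet (2 * n) t" if "t \<in> real_part W" for t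
  proof -
    have "(t, 0) \<in> (axial_set V :: 'n paravector set)"
      using line[OF that] by (simp add: mem_axial_set[OF cV] complex_of_real_def)
    then have "(\<lambda>j. vect 0 ^ j * f j t) sums G (t, 0)" using sumsV by blast
    from sums_unique2[OF this vect_series_at_axis] have "G (t, 0) = f 0 t" .
    then show ?thesis by (simp add: f_def round_even_def)
  qed
  show ?thesis
    unfolding is_GCK_def G_def[symmetric]
    using mono oV cV VW line ReV sumsV an init
    by (intro conjI exI[of _ V] exI[of _ f]) auto
qed

end

section \<open>Derivatives on the real axis\<close>

text \<open>
  An even power series is \<open>h(r) = \<phi>(r\<^sup>2)\<close>, so \<open>(1/r) h'(r) = 2 \<phi>'(r\<^sup>2)\<close>. At \<open>r = 0\<close> this is the limit, because \<open>\<phi>'\<close>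
  is continuous.
\<close>

lemma radial_deriv_even_series:
  assumes sums: "\<And>r. \<bar>r\<bar> < \<epsilon> \<Longrightarrow> (\<lambda>i. a i * r ^ (2 * i)) sums h r" and r: "\<bar>r\<bar> < \<epsilon>"
  shows "(\<lambda>i. 2 * diffs a i * r ^ (2 * i)) sums radial_deriv h r"
proof -
  define \<phi> where "\<phi> = (\<lambda>s. \<Sum>i. a i * s ^ i)"
  define \<phi>' where "\<phi>' = (\<lambda>s. \<Sum>i. diffs a i * s ^ i)"
  have \<epsilon>: "\<epsilon> > 0" using r by linarith
  have sq: "\<bar>s\<bar> < \<epsilon> \<Longrightarrow> norm (s\<^sup>2) < \<epsilon>\<^sup>2" for s :: real
    using power_strict_mono[of "\<bar>s\<bar>" \<epsilon> 2] by simp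
  have summ: "summable (\<lambda>i. a i * s ^ i)" if "norm s < \<epsilon>\<^sup>2" for s
  proof -
    define q where "q = (\<bar>s\<bar> + \<epsilon>\<^sup>2) / 2"
    have q: "\<bar>s\<bar> < q" "q < \<epsilon>\<^sup>2" "0 \<le> q" using that by (auto simp: q_def)
    then have "sqrt q < \<epsilon>" using \<epsilon> by (simp add: real_less_lsqrt)
    then have "summable (\<lambda>i. a i * sqrt q ^ (2 * i))"
      using sums[of "sqrt q"] q by (auto simp: sums_iff)
    then have "summable (\<lambda>i. a i * q ^ i)" using q by (simp add: power_mult)
    then show ?thesis by (rule powser_inside) (use q in auto)
  qed
  have D: "(\<phi> has_real_derivative \<phi>' s) (at s)" if "norm s < \<epsilon>\<^sup>2" for s
    unfolding \<phi>_def \<phi>'_def by (rule termdiffs_strong'[OF summ that])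
  have summ': "summable (\<lambda>i. diffs a i * s ^ i)" if "norm s < \<epsilon>\<^sup>2" for s
    by (rule termdiff_converges[OF that summ])
  have cont: "isCont \<phi>' 0"
    unfolding \<phi>'_def using termdiffs_strong'[OF summ', of "\<epsilon>\<^sup>2" 0] \<epsilon> by (auto intro: DERIV_isCont)
  have h: "h s = \<phi> (s\<^sup>2)" if "\<bar>s\<bar> < \<epsilon>" for s
    using sums[OF that] by (simp add: \<phi>_def sums_iff power_mult)
  have dh: "deriv h s = 2 * s * \<phi>' (s\<^sup>2)" if s: "\<bar>s\<bar> < \<epsilon>" for s
  proof -
    have "((\<lambda>s. \<phi> (s\<^sup>2)) has_real_derivative \<phi>' (s\<^sup>2) * (2 * s)) (at s)"
      by (rule DERIV_chain2[of \<phi> _ "\<lambda>s. s\<^sup>2", OF D[OF sq[OF s]]]) (auto intro!: derivative_eq_intros)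
    moreover have "s \<in> {-\<epsilon><..<\<epsilon>}" using s by auto
    ultimately have "(h has_real_derivative \<phi>' (s\<^sup>2) * (2 * s)) (at s)"
      by (rule has_field_derivative_transform_within_open[OF _ open_greaterThanLessThan]) (auto simp: h)
    then show ?thesis by (simp add: DERIV_imp_deriv mult.commute)
  qed
  have "radial_deriv h r = 2 * \<phi>' (r\<^sup>2)"
  proof (cases "r = 0")
    case True
    have "((\<lambda>s. 2 * \<phi>' (s\<^sup>2)) \<longlongrightarrow> 2 * \<phi>' (0\<^sup>2)) (at (0::real))"
      by (intro tendsto_intros isCont_tendsto_compose[of _ \<phi>'] continuous_intros) (use cont in simp_all)
    moreover have "\<forall>\<^sub>F s in at (0::real). s \<noteq> 0 \<and> \<bar>s\<bar> < \<epsilon>"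
      unfolding eventually_at using \<epsilon> by (auto simp: dist_real_def)
    then have "\<forall>\<^sub>F s in at (0::real). 2 * \<phi>' (s\<^sup>2) = deriv h s / s"
      by eventually_elim (simp add: dh)
    ultimately have "((\<lambda>s. deriv h s / s) \<longlongrightarrow> 2 * \<phi>' 0) (at 0)"
      using Lim_transform_eventually by fastforce
    then show ?thesis unfolding radial_deriv_def using True by (simp add: tendsto_Lim)
  next
    case False
    then show ?thesis using dh[OF r] by (simp add: radial_deriv_def)
  qed
  moreover have "(\<lambda>i. 2 * (diffs a i * (r\<^sup>2) ^ i)) sums (2 * \<phi>' (r\<^sup>2))"
    unfolding \<phi>'_def by (intro sums_mult summable_sums summ' sq r)
  ultimately show ?thesis by (simp add: power_mult mult.assoc)
qed

lemma radial_deriv_iterate_zero: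
  assumes "\<epsilon> > 0" "\<And>r. \<bar>r\<bar> < \<epsilon> \<Longrightarrow> (\<lambda>i. a i * r ^ (2 * i)) sums h r"
  shows "(radial_deriv ^^ n) h 0 = 2 ^ n * fact n * a n"
proof -
  have "\<bar>r\<bar> < \<epsilon> \<Longrightarrow> (\<lambda>i. (2 ^ n * (fact (i + n) / fact i) * a (i + n)) * r ^ (2 * i)) sums (radial_deriv ^^ n) h r" for r
  proof (induction n arbitrary: r)
    case (Suc n)
    have "2 * diffs (\<lambda>i. 2 ^ n * (fact (i + n) / fact i) * a (i + n)) i
        = 2 ^ Suc n * (fact (i + Suc n) / fact i) * a (i + Suc n)" for i
      by (simp add: diffs_def field_simps del: of_nat_Suc)
    note eq = this
    from radial_deriv_even_series[OF Suc.IH Suc.prems] show ?case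
      unfolding eq funpow.simps o_apply .
  qed (use assms in simp)
  from this[of 0] \<open>\<epsilon> > 0\<close>
  have "(\<lambda>i. (2 ^ n * (fact (i + n) / fact i) * a (i + n)) * 0 ^ i) sums (radial_deriv ^^ n) h 0"
    by (simp only: power_mult abs_zero zero_power2)
  from sums_unique2[OF this powser_sums_zero] show ?thesis by simp
qed

lemma line_deriv_iterate:
  assumes "open U" and D: "\<And>i t. t \<in> U \<Longrightarrow> (D i has_vector_derivative D (Suc i) t) (at t)"
    and "\<And>t. t \<in> U \<Longrightarrow> f t = D 0 t" and "t \<in> U"
  shows "(line_deriv ^^ k) f t = D k t"
  using \<open>t \<in> U\<close>
proof (induction k arbitrary: t)
  case (Suc k)
  have "((line_deriv ^^ k) f has_vector_derivative D (Suc k) t) (at t)"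
    by (rule has_vector_derivative_transform_within_open[OF D[OF Suc.prems] \<open>open U\<close> Suc.prems])
       (simp add: Suc.IH)
  then show ?case
    by (simp add: line_deriv_def[of "(line_deriv ^^ k) f" t] vector_derivative_at)
qed (use assms in simp)

lemma dfact_even: "dfact (int (2 * n)) = 2 ^ n * fact n"
proof (induction n)
  case (Suc n)
  have "dfact (int (2 * Suc n)) = nat (int (2 * Suc n)) * dfact (int (2 * n))"
    by (subst dfact.simps) simp
  then have "dfact (int (2 * Suc n)) = 2 * Suc n * (2 ^ n * fact n)"
    unfolding nat_int Suc .
  then show ?case by (simp add: algebra_simps)
qed (simp add: dfact.simps)

lemma dfact_odd: "dfact (2 * int n - 1) = (\<Prod>l<n. 2 * l + 1)"
proof (induction n)
  case (Suc n)
  have "dfact (2 * int (Suc n) - 1) = nat (2 * int n + 1) * dfact (2 * int n - 1)"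
    by (subst dfact.simps) (simp add: algebra_simps)
  moreover have "nat (2 * int n + 1) = 2 * n + 1" by linarith
  ultimately show ?case unfolding Suc by simp
qed (simp add: dfact.simps)

lemma dfact_even_odd: "dfact (int (2 * n)) * dfact (2 * int n - 1) = fact (2 * n)"
proof (induction n)
  case (Suc n)
  have "fact (2 * Suc n) = (2 * n + 2) * (2 * n + 1) * (fact (2 * n) :: nat)" by (simp add: algebra_simps)
  also have "\<dots> = (2 * n + 2) * (2 * n + 1) * (2 ^ n * fact n * (\<Prod>l<n. 2 * l + 1))"
    using Suc unfolding dfact_even dfact_odd by simp
  finally show ?case unfolding dfact_even dfact_odd by (simp add: algebra_simps)
qed (simp add: dfact.simps)

lemma lap_coeff_zero:
  "lap_coeff (2 * n + 1) n 0 = (- 1) ^ n * real (dfact (int (2 * n))) / real (dfact (2 * int n - 1))"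
proof -
  have num: "(\<Prod>l<n. 2 * real l + 1 - real (2 * n + 1)) = (- 1) ^ n * (2 ^ n * fact n)"
  proof -
    have "(\<Prod>l<n. 2 * real l + 1 - real (2 * n + 1)) = (\<Prod>l<n. (- 2) * real (n - l))"
      by (intro prod.cong) (auto simp: of_nat_diff)
    also have "\<dots> = (- 2) ^ n * (\<Prod>l<n. real (n - l))"
      by (simp only: prod.distrib prod_constant card_lessThan)
    also have "(\<Prod>l<n. real (n - l)) = fact n"
      unfolding fact_prod_rev by (simp add: atLeast0LessThan)
    finally show ?thesis by (simp add: power_mult_distrib[symmetric] mult.assoc[symmetric])
  qed
  show ?thesis
    unfolding lap_coeff_def prod_dividef num dfact_even dfact_odd by (simp add: of_nat_prod add.commute)
qed

section \<open>Holomorphic extensions\<close>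

lemma holomorphic_eq_on_reals:
  assumes W: "intrinsic_domain W" and "g1 holomorphic_on W" "g2 holomorphic_on W"
    and eq: "\<And>t. t \<in> real_part W \<Longrightarrow> g1 (of_real t) = g2 (of_real t)" and z: "z \<in> W"
  shows "g1 z = g2 z"
proof -
  have W': "open W" "connected W" using W by (auto simp: intrinsic_domain_def)
  obtain t where t: "t \<in> real_part W" using intrinsic_domain_meets_reals[OF W] by blast
  have "t islimpt real_part W"
    using open_imp_islimpt open_real_part[OF W'(1)] t by blast
  then have lim: "complex_of_real t islimpt complex_of_real ` real_part W"
    by (intro islimpt_isCont_image) (auto simp: eventually_at_filter)
  have "g1 z - g2 z = 0"
    by (rule analytic_continuation[of "\<lambda>z. g1 z - g2 z", OF holomorphic_on_diff[OF assms(2,3)] W' _ _ lim _ z])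
       (use t eq in auto)
  then show ?thesis by simp
qed

text \<open>
  The functions \<open>g(z)\<close> and \<open>cnj (g (cnj z))\<close> are holomorphic and agree on the real axis, where both are real.
\<close>

lemma hol_ext_properties:
  assumes W: "intrinsic_domain W" and \<phi>: "\<phi> \<in> \<A> W"
  shows "intrinsic_holomorphic W (hol_ext W \<phi>)"
    and "\<And>t. t \<in> real_part W \<Longrightarrow> hol_ext W \<phi> (of_real t) = of_real (\<phi> t)"
proof -
  obtain g0 where g0: "g0 holomorphic_on W" "\<And>t. t \<in> real_part W \<Longrightarrow> g0 (of_real t) = of_real (\<phi> t)"
    using \<phi> by (auto simp: \<A>_def)
  define g where "g = (\<lambda>z. if z \<in> W then g0 z else 0)"
  have g: "g holomorphic_on W" "\<And>t. t \<in> real_part W \<Longrightarrow> g (of_real t) = of_real (\<phi> t)" "\<And>z. z \<notin> W \<Longrightarrow> g z = 0"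
    using g0 by (auto simp: g_def cong: holomorphic_cong)
  have ext: "hol_ext W \<phi> = g"
    unfolding hol_ext_def
  proof (rule the_equality)
    fix g' assume g': "g' holomorphic_on W \<and> (\<forall>t\<in>real_part W. g' (of_real t) = of_real (\<phi> t)) \<and> (\<forall>z. z \<notin> W \<longrightarrow> g' z = 0)"
    show "g' = g"
    proof
      fix z show "g' z = g z"
        using holomorphic_eq_on_reals[OF W, of g' g z] g' g by (cases "z \<in> W") auto
    qed
  qed (use g in auto)
  have W': "open W" "cnj_closed W" using W by (auto simp: intrinsic_domain_def)
  have "cnj ` W = W"
    using W'(2) by (force simp: cnj_closed_def image_iff intro: bexI[of _ "cnj _"])
  then have "(cnj \<circ> g \<circ> cnj) holomorphic_on W"
    using holomorphic_on_compose_cnj_cnj[of g W] g(1) W'(1) by simp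
  then have cnj: "(cnj \<circ> g \<circ> cnj) z = g z" if "z \<in> W" for z
    by (rule holomorphic_eq_on_reals[OF W _ g(1) _ that]) (use g(2) in auto)
  have "Re (g (cnj z)) = Re (g z) \<and> Im (g (cnj z)) = - Im (g z)" if "z \<in> W" for z
    unfolding cnj[OF that, symmetric] by simp
  then show "intrinsic_holomorphic W (hol_ext W \<phi>)"
    using g(1) by (simp add: ext intrinsic_holomorphic_def)
  show "hol_ext W \<phi> (of_real t) = of_real (\<phi> t)" if "t \<in> real_part W" for t
    unfolding ext by (rule g(2)[OF that])
qed

lemma sum_coeffs_blade: "(\<Sum>A\<in>UNIV. coeffs x $ A *\<^sub>R blade A) = x"
  unfolding clifford_eq_iff
proof
  fix B
  have lin: "coeffs (\<Sum>A\<in>I. y A) $ B = (\<Sum>A\<in>I. coeffs (y A) $ B)" if "finite I" for I and y :: "'a set \<Rightarrow> 'a clifford"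
    using that by induction (simp_all add: zero_clifford.rep_eq plus_clifford.rep_eq)
  have "coeffs (coeffs x $ A *\<^sub>R blade A) $ B = (if A = B then coeffs x $ B else 0)" for A
    by (auto simp: scaleR_clifford.rep_eq blade.rep_eq axis_def)
  then show "coeffs (\<Sum>A\<in>UNIV. coeffs x $ A *\<^sub>R blade A) $ B = coeffs x $ B"
    by (simp add: lin)
qed

section \<open>The Fueter-Sce mapping as a generalized CK-extension\<close>

context slice_family
begin

theorem laplacian_slice_eq_GCK:
  assumes m: "CARD('n) = 2 * n + 1" and c: "c \<noteq> 0"
    and f0: "\<And>t. t \<in> real_part W \<Longrightarrow> c *\<^sub>R f0 t = lap_coeff CARD('n) n 0 *\<^sub>R real_jet (2 * n) t"
    and x: "x \<in> axial_set W"
  shows "(laplacian ^^ n) slice x = c *\<^sub>R GCK W f0 x"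
proof -
  let ?G = "(laplacian ^^ n) slice"
  have "is_GCK W f0 (\<lambda>x. (1 / c) *\<^sub>R ?G x)"
  proof (rule is_GCK_cong[OF open_W cnj_W is_GCK_scaleR[OF open_W laplacian_slice_is_GCK[OF m], of "1 / c"] refl])
    fix t assume "t \<in> real_part W"
    from f0[OF this] c show "f0 t = (1 / c) *\<^sub>R (lap_coeff CARD('n) n 0 *\<^sub>R real_jet (2 * n) t)"
      by (metis divide_inverse mult_1 scaleR_left_imp_eq scaleR_one scaleR_scaleR right_inverse)
  qed
  from GCK_eq[OF domain this x] c show ?thesis by simp
qed

lemma even_taylor:
  assumes "t \<in> real_part W"
  shows "\<exists>e>0. \<forall>r. \<bar>r\<bar> < e \<longrightarrow>
    (\<lambda>i. ((- 1) ^ i * Re ((deriv ^^ (2 * i)) (g A) (of_real t)) / fact (2 * i)) * r ^ (2 * i)) sums Re (g A (Complex t r))"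
proof -
  obtain e where e: "e > 0" "ball (of_real t) e \<subseteq> W" using openE[OF open_W] assms by auto
  have "(\<lambda>i. ((- 1) ^ i * Re ((deriv ^^ (2 * i)) (g A) (of_real t)) / fact (2 * i)) * r ^ (2 * i)) sums Re (g A (Complex t r))"
    if r: "\<bar>r\<bar> < e" for r
  proof -
    let ?d = "\<lambda>j. (deriv ^^ j) (g A) (of_real t) / fact j * (\<i> * of_real r) ^ j"
    note dd = imaginary_taylor_term[OF assms]
    have "(\<lambda>j. Re (?d j)) sums Re (g A (Complex t r))"
      by (rule sums_Re[OF imaginary_taylor[OF e(2) r]])
    moreover have "Re (?d j) = 0" if "j \<notin> range (\<lambda>i. 2 * i)" for j
    proof -
      have "odd j" using that by (auto elim: evenE)
      then obtain i where "j = Suc (2 * i)" by (auto elim: oddE)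
      then have "\<i> ^ j = of_real ((- 1) ^ i) * \<i>" by (simp add: power_mult)
      then show ?thesis unfolding dd Re_complex_of_real_mult by (simp only: Re_complex_of_real_mult) simp
    qed
    ultimately have "(\<lambda>i. Re (?d (2 * i))) sums Re (g A (Complex t r))"
      using sums_mono_reindex[of "\<lambda>i. 2 * i" "\<lambda>j. Re (?d j)"] by (simp add: strict_mono_def)
    moreover have "Re (?d (2 * i)) = ((- 1) ^ i * Re ((deriv ^^ (2 * i)) (g A) (of_real t)) / fact (2 * i)) * r ^ (2 * i)" for i
    proof -
      have "\<i> ^ (2 * i) = of_real ((- 1) ^ i)" by (simp add: power_mult)
      then show ?thesis unfolding dd Re_complex_of_real_mult Re_complex_of_real by simp
    qed
    ultimately show ?thesis by simp
  qed
  with e show ?thesis by blast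
qed

end
theorem theorem4p2:
  fixes \<Omega>\<^sub>2 :: "complex set" and m :: nat and \<gamma> :: real
    and \<Omega> :: "('n::{finite,linorder}) paravector set"
  assumes m: "m = CARD('n)" "odd m"
    and \<Omega>\<^sub>2: "intrinsic_domain \<Omega>\<^sub>2"
    and \<gamma>: "\<gamma> = (- 1) ^ ((m - 1) div 2) * real (dfact (int m - 1)) / real (dfact (int m - 2))"
    and \<Omega>: "\<Omega> = axial_set \<Omega>\<^sub>2"
  shows
    "(\<forall>f. intrinsic_holomorphic \<Omega>\<^sub>2 f \<longrightarrow>
        (\<forall>x\<in>\<Omega>.
          (laplacian ^^ ((m - 1) div 2)) (slice_fun f) x
            = real (dfact (int m - 1)) *\<^sub>R
                (GCK \<Omega>\<^sub>2 (\<lambda>x0. of_real ((radial_deriv ^^ ((m - 1) div 2))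
                  (\<lambda>r. Re (f (Complex x0 r))) 0)) :: _ \<Rightarrow> 'n clifford) x
          \<and> real (dfact (int m - 1)) *\<^sub>R
                (GCK \<Omega>\<^sub>2 (\<lambda>x0. of_real ((radial_deriv ^^ ((m - 1) div 2))
                  (\<lambda>r. Re (f (Complex x0 r))) 0)) :: _ \<Rightarrow> 'n clifford) x
            = ((- 1) ^ ((m - 1) div 2) * real (dfact (int m - 1)) / real (dfact (int m - 2))) *\<^sub>R
                GCK \<Omega>\<^sub>2 (\<lambda>x0. of_real ((line_deriv ^^ (m - 1)) (\<lambda>t. Re (f (of_real t))) x0)) x))
     \<and>
     (\<forall>f0 \<in> (\<A>_clifford \<Omega>\<^sub>2 :: (real \<Rightarrow> 'n clifford) set).
        (laplacian ^^ ((m - 1) div 2)) (slice_ext \<Omega>\<^sub>2 f0) \<in> axially_monogenic \<Omega>\<^sub>2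
        \<and> (\<lambda>x. \<gamma> *\<^sub>R GCK \<Omega>\<^sub>2 ((line_deriv ^^ (m - 1)) f0) x) \<in> axially_monogenic \<Omega>\<^sub>2
        \<and> (\<forall>x\<in>\<Omega>. (laplacian ^^ ((m - 1) div 2)) (slice_ext \<Omega>\<^sub>2 f0) x
              = \<gamma> *\<^sub>R GCK \<Omega>\<^sub>2 ((line_deriv ^^ (m - 1)) f0) x))"
proof -
  define n where "n = (m - 1) div 2"
  have mn: "m = 2 * n + 1" using m(2) by (auto simp: n_def elim!: oddE)
  have card: "CARD('n) = 2 * n + 1" using m(1) mn by simp
  have n: "2 * n div 2 = n" "m - 1 = 2 * n" "int m - 1 = int (2 * n)" "int m - 2 = 2 * int n - 1"
    using mn by auto
  define E where "E = real (dfact (int (2 * n)))"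
  define O' where "O' = real (dfact (2 * int n - 1))"
  have E: "E = 2 ^ n * fact n" unfolding E_def dfact_even by simp
  have EO: "E * O' = fact (2 * n)"
    unfolding E_def O'_def of_nat_mult[symmetric] dfact_even_odd by simp
  have pos: "E > 0" using E by simp
  have "O' \<noteq> 0" using EO by (metis fact_nonzero mult_zero_right)
  have \<gamma>': "\<gamma> = (- 1) ^ n * E / O'" "\<gamma> = lap_coeff CARD('n) n 0"
    unfolding card lap_coeff_zero E_def O'_def using \<gamma> by (simp_all only: n)
  then have \<gamma>0: "\<gamma> \<noteq> 0" using pos \<open>O' \<noteq> 0\<close> by simp
  have W: "open \<Omega>\<^sub>2" "cnj_closed \<Omega>\<^sub>2" using \<Omega>\<^sub>2 by (auto simp: intrinsic_domain_def)
  let ?radial = "\<lambda>f x0. of_real ((radial_deriv ^^ n) (\<lambda>r. Re (f (Complex x0 r))) 0) :: 'n clifford"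
  let ?line = "\<lambda>f x0. of_real ((line_deriv ^^ (2 * n)) (\<lambda>t. Re (f (complex_of_real t))) x0) :: 'n clifford"
  have part1: "(laplacian ^^ n) (slice_fun f) x = E *\<^sub>R GCK \<Omega>\<^sub>2 (?radial f) x"
      "(laplacian ^^ n) (slice_fun f) x = \<gamma> *\<^sub>R GCK \<Omega>\<^sub>2 (?line f) x"
    if f: "intrinsic_holomorphic \<Omega>\<^sub>2 f" and x: "x \<in> axial_set \<Omega>\<^sub>2" for f and x :: "'n paravector"
  proof -
    \<comment> \<open>The empty blade is the unit of the algebra, so this family represents the scalar function.\<close>
    define g where "g = (\<lambda>A :: 'n set. if A = {} then f else (\<lambda>_. 0))"
    interpret slice_family \<Omega>\<^sub>2 g
      by standard (use \<Omega>\<^sub>2 f in \<open>auto simp: g_def intrinsic_holomorphic_def\<close>)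
    have sum_blade: "(\<Sum>A\<in>UNIV. c A *\<^sub>R (blade A :: 'n clifford)) = of_real (c {})"
      if "\<And>A. A \<noteq> {} \<Longrightarrow> c A = 0" for c
    proof -
      have "(\<Sum>A\<in>UNIV. c A *\<^sub>R (blade A :: 'n clifford)) = (\<Sum>A\<in>{{}}. c A *\<^sub>R blade A)"
        by (rule sum.mono_neutral_right) (auto simp: that)
      then show ?thesis by (simp add: blade_empty of_real_def)
    qed
    have slice: "slice_fun f = slice"
      unfolding slice_fun_def slice_def by (subst (1 2) sum_blade) (simp_all add: g_def)
    have zero: "(deriv ^^ i) (\<lambda>_. 0 :: complex) = (\<lambda>_. 0)" for i
      by (induction i) auto
    have jet: "real_jet i t = of_real (Re ((deriv ^^ i) f (of_real t)))" for i t
      unfolding real_jet_def by (subst sum_blade) (simp_all add: g_def zero)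
    have radial: "(radial_deriv ^^ n) (\<lambda>r. Re (f (Complex t r))) 0
        = E * ((- 1) ^ n * Re ((deriv ^^ (2 * n)) f (of_real t)) / (E * O'))" if t: "t \<in> real_part \<Omega>\<^sub>2" for t
    proof -
      obtain e where "e > 0" "\<forall>r. \<bar>r\<bar> < e \<longrightarrow>
          (\<lambda>i. ((- 1) ^ i * Re ((deriv ^^ (2 * i)) (g {}) (of_real t)) / fact (2 * i)) * r ^ (2 * i))
            sums Re (g {} (Complex t r))"
        using even_taylor[OF t, of "{}"] by blast
      then have "(radial_deriv ^^ n) (\<lambda>r. Re (g {} (Complex t r))) 0
          = 2 ^ n * fact n * ((- 1) ^ n * Re ((deriv ^^ (2 * n)) (g {}) (of_real t)) / fact (2 * n))"
        by (intro radial_deriv_iterate_zero[of e]) auto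
      then show ?thesis unfolding EO by (simp add: E g_def)
    qed
    show "(laplacian ^^ n) (slice_fun f) x = E *\<^sub>R GCK \<Omega>\<^sub>2 (?radial f) x"
      unfolding slice
    proof (rule laplacian_slice_eq_GCK[OF card _ _ x])
      fix t assume "t \<in> real_part \<Omega>\<^sub>2"
      note r = radial[OF this]
      show "E *\<^sub>R of_real ((radial_deriv ^^ n) (\<lambda>r. Re (f (Complex t r))) 0)
          = lap_coeff CARD('n) n 0 *\<^sub>R real_jet (2 * n) t"
        unfolding r jet \<gamma>'(2)[symmetric] \<gamma>'(1) scaleR_conv_of_real of_real_mult[symmetric]
        using pos \<open>O' \<noteq> 0\<close> by (simp add: field_simps)
    qed (use pos in simp)
    show "(laplacian ^^ n) (slice_fun f) x = \<gamma> *\<^sub>R GCK \<Omega>\<^sub>2 (?line f) x"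
      unfolding slice
    proof (rule laplacian_slice_eq_GCK[OF card \<gamma>0 _ x])
      fix t assume t: "t \<in> real_part \<Omega>\<^sub>2"
      have "(line_deriv ^^ (2 * n)) (\<lambda>t. Re (f (of_real t))) t = Re ((deriv ^^ (2 * n)) f (of_real t))"
      proof (rule line_deriv_iterate[where D = "\<lambda>i t. Re ((deriv ^^ i) f (of_real t))", OF open_real_part[OF W(1)] _ _ t])
        fix i s assume s: "s \<in> real_part \<Omega>\<^sub>2"
        show "((\<lambda>t. Re ((deriv ^^ i) f (of_real t))) has_vector_derivative Re ((deriv ^^ Suc i) f (of_real s))) (at s)"
          using bounded_linear.has_vector_derivative[OF bounded_linear_Re line_derivative[OF s, of i "{}"]]
          by (simp add: g_def)
      qed simp
      then show "\<gamma> *\<^sub>R of_real ((line_deriv ^^ (2 * n)) (\<lambda>t. Re (f (of_real t))) t)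
          = lap_coeff CARD('n) n 0 *\<^sub>R real_jet (2 * n) t"
        by (simp only: jet \<gamma>'(2))
    qed
  qed
  have part2: "(laplacian ^^ n) (slice_ext \<Omega>\<^sub>2 f0) \<in> axially_monogenic \<Omega>\<^sub>2"
      "(\<lambda>x. \<gamma> *\<^sub>R GCK \<Omega>\<^sub>2 ((line_deriv ^^ (2 * n)) f0) x) \<in> axially_monogenic \<Omega>\<^sub>2"
      "\<forall>x\<in>axial_set \<Omega>\<^sub>2. (laplacian ^^ n) (slice_ext \<Omega>\<^sub>2 f0) x = \<gamma> *\<^sub>R GCK \<Omega>\<^sub>2 ((line_deriv ^^ (2 * n)) f0) x"
    if f0: "f0 \<in> (\<A>_clifford \<Omega>\<^sub>2 :: (real \<Rightarrow> 'n clifford) set)" for f0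
  proof -
    define g where "g = (\<lambda>A. hol_ext \<Omega>\<^sub>2 (\<lambda>t. coeffs (f0 t) $ A))"
    have \<phi>: "(\<lambda>t. coeffs (f0 t) $ A) \<in> \<A> \<Omega>\<^sub>2" for A
      using f0 by (simp add: \<A>_clifford_def)
    interpret slice_family \<Omega>\<^sub>2 g
      by standard (use \<Omega>\<^sub>2 hol_ext_properties(1)[OF \<Omega>\<^sub>2 \<phi>] in \<open>auto simp: g_def\<close>)
    have slice: "slice_ext \<Omega>\<^sub>2 f0 = slice"
      unfolding slice_def unfolding slice_ext_def g_def ..
    have jet0: "f0 t = real_jet 0 t" if "t \<in> real_part \<Omega>\<^sub>2" for t
      using hol_ext_properties(2)[OF \<Omega>\<^sub>2 \<phi> that] unfolding real_jet_def unfolding g_def by (simp add: sum_coeffs_blade)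
    have jet: "(line_deriv ^^ (2 * n)) f0 t = real_jet (2 * n) t" if "t \<in> real_part \<Omega>\<^sub>2" for t
      by (rule line_deriv_iterate[of _ real_jet, OF open_real_part[OF W(1)] real_jet_derivative jet0 that])
    show eq: "\<forall>x\<in>axial_set \<Omega>\<^sub>2. (laplacian ^^ n) (slice_ext \<Omega>\<^sub>2 f0) x = \<gamma> *\<^sub>R GCK \<Omega>\<^sub>2 ((line_deriv ^^ (2 * n)) f0) x"
      unfolding slice using laplacian_slice_eq_GCK[OF card \<gamma>0] jet \<gamma>'(2) by simp
    show "(laplacian ^^ n) (slice_ext \<Omega>\<^sub>2 f0) \<in> axially_monogenic \<Omega>\<^sub>2"
      using laplacian_slice_is_GCK[OF card] by (simp add: slice is_GCK_def)
    have "is_GCK \<Omega>\<^sub>2 (\<lambda>t. lap_coeff CARD('n) n 0 *\<^sub>R real_jet (2 * n) t)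
        (\<lambda>x. \<gamma> *\<^sub>R GCK \<Omega>\<^sub>2 ((line_deriv ^^ (2 * n)) f0) x)"
      by (rule is_GCK_cong[OF W laplacian_slice_is_GCK[OF card]]) (use eq in \<open>simp_all add: slice\<close>)
    then show "(\<lambda>x. \<gamma> *\<^sub>R GCK \<Omega>\<^sub>2 ((line_deriv ^^ (2 * n)) f0) x) \<in> axially_monogenic \<Omega>\<^sub>2"
      by (simp add: is_GCK_def)
  qed
  show ?thesis
    unfolding n \<Omega> E_def[symmetric] O'_def[symmetric] \<gamma>'(1)[symmetric]
    using part1 part2 by metis
qed

end
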